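(* In the private-cache multicore model, suppose $x$ lists $L_1,\dots,L_x$ of total size $y$ are stored contiguously in shared memory, each list $L_i$ being partitioned into $t$ consecutive buckets $B_{i1},B_{i2},\dots,B_{it}$ (so the memory layout is $B_{11},\dots,B_{1t},B_{21},\dots,B_{2t},\dots,B_{x1},\dots,B_{xt}$). Then using $p$ processors one can produce a single list partitioned into $t$ contiguous buckets, where the $j$-th output bucket consists of the contents of $B_{1j},B_{2j},\dots,B_{xj}$, in time $O\!\left(\frac{y}{p}+\log p\right)$ with a total of $O\!\left(\frac{y}{B}+xt\right)$ cache misses, provided $y\ge Mp$ and $y\ge xt$.
   Context: Private-cache multicore model: there are $p$ processors (cores), each with a private cache of size $M$, and a shared global memory; data moves between shared memory and caches in blocks of $B$ consecutive words. A cache miss occurs when a core accesses data whose block is not in its cache. A block miss occurs when a core's cached copy of a block is invalidated because another core writes to that block, forcing it to be re-read (concurrent writes by $x$ cores to one block can cost $\Omega(x^2)$). Total cache misses count all cache misses and block misses over all cores. Time refers to parallel time (maximum time taken by any processor). The algorithm is cache-oblivious: it knows $p$ but not $M$ or $B$.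
   Formalization: The formal statement additionally assumes that each private cache holds at least two blocks (M ≥ 2B); with a one-block cache and boundedly many registers, moving y words between blocks cannot be done with O(y/B + xt) misses. *)

theory Defs
  imports Complex_Main
begin

section \<open>Programs\<close>

text \<open>
  All cores run the same word-RAM program. Words are natural numbers below \<open>2 ^ w\<close>; arithmetic
  wraps around, except that subtraction truncates at 0. A program mentions only finitely many
  registers and its expressions have fixed size, so each small step below is a constant number of
  machine operations and accesses at most one word of shared memory.
\<close>

datatype binop = Add | Sub | Mul | Div | Mod | Lt | Eq

datatype expr = Const nat | Reg nat | Op binop expr expr

datatype com =
    Skip
  | Assign nat expr
  | Load nat expr  \<comment> \<open>register, address\<close>
  | Store expr expr  \<comment> \<open>address, value\<close>
  | Seq com com
  | Cond expr com com
  | While expr com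

type_synonym registers = "nat \<Rightarrow> nat"
type_synonym memory = "nat \<Rightarrow> nat"

fun apply_op :: "binop \<Rightarrow> nat \<Rightarrow> nat \<Rightarrow> nat" where
  "apply_op Add a b = a + b"
| "apply_op Sub a b = a - b"
| "apply_op Mul a b = a * b"
| "apply_op Div a b = a div b"
| "apply_op Mod a b = a mod b"
| "apply_op Lt a b = (if a < b then 1 else 0)"
| "apply_op Eq a b = (if a = b then 1 else 0)"

fun eval :: "nat \<Rightarrow> registers \<Rightarrow> expr \<Rightarrow> nat" where
  "eval w s (Const n) = n mod 2 ^ w"
| "eval w s (Reg r) = s r"
| "eval w s (Op f a b) = apply_op f (eval w s a) (eval w s b) mod 2 ^ w"

datatype access = Read (address: nat) | Write (address: nat) nat

text \<open>The shared-memory access, if any, made by the next step of a core.\<close>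

fun next_access :: "nat \<Rightarrow> com \<Rightarrow> registers \<Rightarrow> access option" where
  "next_access w (Load r a) s = Some (Read (eval w s a))"
| "next_access w (Store a e) s = Some (Write (eval w s a) (eval w s e))"
| "next_access w (Seq c d) s = next_access w c s"
| "next_access w _ s = None"

text \<open>The effect of the next step on the core itself; \<^const>\<open>Skip\<close> means that the core has halted.\<close>

fun advance :: "nat \<Rightarrow> memory \<Rightarrow> com \<Rightarrow> registers \<Rightarrow> com \<times> registers" where
  "advance w m Skip s = (Skip, s)"
| "advance w m (Assign r e) s = (Skip, s(r := eval w s e))"
| "advance w m (Load r a) s = (Skip, s(r := m (eval w s a)))"
| "advance w m (Store a e) s = (Skip, s)"
| "advance w m (Seq c d) s =
     (if c = Skip then (d, s)
      else (let (c', s') = advance w m c s in (Seq c' d, s')))"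
| "advance w m (Cond e c d) s = (if eval w s e \<noteq> 0 then c else d, s)"
| "advance w m (While e c) s = (if eval w s e \<noteq> 0 then Seq c (While e c) else Skip, s)"


section \<open>The private-cache multicore\<close>

text \<open>
  Block \<open>b\<close> consists of the words with addresses \<open>b * B, \<dots>, b * B + B - 1\<close>. The cache of a core is
  the list of the blocks of which it holds a valid copy, most recently used first.
\<close>

record machine =
  code :: "nat \<Rightarrow> com"
  regs :: "nat \<Rightarrow> registers"
  mem :: memory
  cache :: "nat \<Rightarrow> nat list"
  misses :: nat

definition core_access :: "nat \<Rightarrow> machine \<Rightarrow> nat \<Rightarrow> access option" where
  "core_access w \<sigma> c = next_access w (code \<sigma> c) (regs \<sigma> c)"

definition block_writers :: "nat \<Rightarrow> nat \<Rightarrow> nat \<Rightarrow> machine \<Rightarrow> nat \<Rightarrow> nat set" where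
  "block_writers p B w \<sigma> b =
     {c. c < p \<and> (\<exists>a v. core_access w \<sigma> c = Some (Write a v) \<and> a div B = b)}"

text \<open>
  The misses charged to core \<open>c\<close> in one step: one if the accessed block is not validly cached (never
  loaded, evicted, or invalidated earlier by a write of another core), plus one block miss for every
  other core writing to the block in the same step, since each such write may force \<open>c\<close> to read the
  block again before its own access goes through. In particular \<open>x\<close> cores that write concurrently
  to one block are charged at least \<open>x * (x - 1)\<close> misses.
\<close>

definition step_misses :: "nat \<Rightarrow> nat \<Rightarrow> nat \<Rightarrow> machine \<Rightarrow> nat \<Rightarrow> nat" where
  "step_misses p B w \<sigma> c =
     (case core_access w \<sigma> c of
        None \<Rightarrow> 0
      | Some acc \<Rightarrow>
          (let b = address acc div B
           in (if b \<in> set (cache \<sigma> c) then 0 else 1) + card (block_writers p B w \<sigma> b - {c})))"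

text \<open>LRU replacement with room for \<open>M div B\<close> blocks, followed by invalidation.\<close>

definition step_cache :: "nat \<Rightarrow> nat \<Rightarrow> nat \<Rightarrow> nat \<Rightarrow> machine \<Rightarrow> nat \<Rightarrow> nat list" where
  "step_cache p M B w \<sigma> c =
     filter (\<lambda>b. block_writers p B w \<sigma> b \<subseteq> {c})
       (case core_access w \<sigma> c of
          None \<Rightarrow> cache \<sigma> c
        | Some acc \<Rightarrow>
            (let b = address acc div B
             in take (M div B) (b # removeAll b (cache \<sigma> c))))"

text \<open>
  If several cores write the same word in one step, an unspecified one of the written values is
  stored. Reads see the memory as it was before the step.
\<close>

definition step_mem :: "nat \<Rightarrow> nat \<Rightarrow> machine \<Rightarrow> memory" where
  "step_mem p w \<sigma> a =
     (if \<exists>c<p. \<exists>v. core_access w \<sigma> c = Some (Write a v)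
      then (SOME v. \<exists>c<p. core_access w \<sigma> c = Some (Write a v))
      else mem \<sigma> a)"

text \<open>One time unit: every core makes one step.\<close>

definition step :: "nat \<Rightarrow> nat \<Rightarrow> nat \<Rightarrow> nat \<Rightarrow> machine \<Rightarrow> machine" where
  "step p M B w \<sigma> =
     \<lparr> code = (\<lambda>c. fst (advance w (mem \<sigma>) (code \<sigma> c) (regs \<sigma> c))),
       regs = (\<lambda>c. snd (advance w (mem \<sigma>) (code \<sigma> c) (regs \<sigma> c))),
       mem = step_mem p w \<sigma>,
       cache = step_cache p M B w \<sigma>,
       misses = misses \<sigma> + (\<Sum>c<p. step_misses p B w \<sigma> c) \<rparr>"

text \<open>
  Cores start with cold caches; registers 0, 1, 2, \<open>\<dots>\<close> hold the core number followed by the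
  arguments of the program, and all other registers are zero.
\<close>

definition initial :: "com \<Rightarrow> nat list \<Rightarrow> memory \<Rightarrow> machine" where
  "initial prog args m =
     \<lparr> code = (\<lambda>c. prog),
       regs = (\<lambda>c r. if r \<le> length args then (c # args) ! r else 0),
       mem = m, cache = (\<lambda>c. []), misses = 0 \<rparr>"

definition run :: "nat \<Rightarrow> nat \<Rightarrow> nat \<Rightarrow> nat \<Rightarrow> com \<Rightarrow> nat list \<Rightarrow> memory \<Rightarrow> nat \<Rightarrow> machine" where
  "run p M B w prog args m n = (step p M B w ^^ n) (initial prog args m)"

definition all_halted :: "nat \<Rightarrow> machine \<Rightarrow> bool" where
  "all_halted p \<sigma> \<longleftrightarrow> (\<forall>c<p. code \<sigma> c = Skip)"


section \<open>Bucketed lists in memory\<close>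

definition array_at :: "memory \<Rightarrow> nat \<Rightarrow> nat list \<Rightarrow> bool" where
  "array_at m a xs \<longleftrightarrow> (\<forall>i<length xs. m (a + i) = xs ! i)"

text \<open>The offsets at which the buckets start, followed by the total length.\<close>

definition boundaries :: "nat list list \<Rightarrow> nat list" where
  "boundaries bs = map (\<lambda>k. length (concat (take k bs))) [0..<Suc (length bs)]"

text \<open>The buckets stored contiguously from address \<open>a\<close>, their boundaries from address \<open>d\<close>.\<close>

definition stored_buckets :: "memory \<Rightarrow> nat \<Rightarrow> nat \<Rightarrow> nat list list \<Rightarrow> bool" where
  "stored_buckets m a d bs \<longleftrightarrow> array_at m a (concat bs) \<and> array_at m d (boundaries bs)"

text \<open>
  \<open>Ls ! i ! j\<close> is the \<open>j\<close>-th bucket of the \<open>i\<close>-th list, so \<open>concat Ls\<close> is the row-major sequence of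
  all buckets.
\<close>

definition gathered_buckets :: "nat \<Rightarrow> nat list list list \<Rightarrow> nat list list" where
  "gathered_buckets t Ls = map (\<lambda>j. concat (map (\<lambda>L. L ! j) Ls)) [0..<t]"

end

theory Submission
  imports Defs
begin

text \<open>
  Conditionals are padded so that the timing of a core depends only on \<open>p, x, t, y\<close>; hence all cores run
  in lockstep and the program is a sequence of phases separated by implicit barriers. If, during a
  phase, no block written by one core is touched by another, the phase is a product of independent
  sequential runs and causes no block misses.

  Number the buckets column by column, \<open>k = j * x + i\<close>. A parallel prefix sum over per-core totals
  yields the output offset of every bucket and its rank among the nonempty ones. Each nonempty
  bucket leaves a record at its rank, and notifies the first core whose part of the output starts
  inside it; a prefix maximum forwards this to the cores that start later in the same bucket. Every
  core then writes \<open>s = y div p + 1\<close> consecutive output words, one per iteration: ranks skip the empty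
  buckets, so an iteration never needs more than one record. All cores write their first halves
  before any second half. As \<open>s > 2 * B\<close>, words written by different cores in one phase are at least
  \<open>B\<close> apart.

  Two cached blocks serve the source and the destination of the copying, which costs \<open>O(1)\<close> misses
  per bucket and per core in addition to \<open>O(y / B)\<close>. All other phases make \<open>O(1)\<close> accesses per bucket and per
  core, and \<open>p \<le> y / (2 * B)\<close>.
\<close>

section \<open>Sequential runs and lockstep\<close>

text \<open>The program does not know \<open>B\<close>, so block conflicts are prevented by
  distances in terms of \<open>y\<close> and \<open>p\<close>: auxiliary words can be spread out,
  whereas the output must be contiguous and is therefore split into phases. Since \<open>p\<close>
  may be as large as \<open>y / (2 * B)\<close>, the miss bound leaves only a constant number of
  accesses per core on average. This rules out a doubling scan with \<open>p * log p\<close>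
  accesses, and a binary search by every core for the bucket in which its output begins; the scan
  with linear work and the notifications replace them. Work is divided by buckets while counting and
  by output words while copying, because neither division alone copes with both very long and very
  many empty buckets. Pairs of numbers up to \<open>y\<close> are packed into one word in radix
  \<open>y + 1\<close>, so that one scan or one access handles both; together with addresses of
  order \<open>y * y\<close> this is why words must hold a constant multiple of
  \<open>y * y\<close>.\<close>

type_synonym trace = "access option list"
type_synonym assertion = "(nat \<Rightarrow> registers) \<Rightarrow> memory \<Rightarrow> bool"

fun effect :: "access option \<Rightarrow> memory \<Rightarrow> memory" where
  "effect (Some (Write a v)) m = m(a := v)"
| "effect _ m = m"

text \<open>Requiring \<open>c \<noteq> Skip\<close> at each step rules out idling after
  termination, so the length of a trace is the exact running time. The memory changes by
  \<open>effect\<close> alone, as if the core had it to itself.\<close>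

fun solo :: "nat \<Rightarrow> com \<times> registers \<times> memory \<Rightarrow> trace \<Rightarrow> com \<times> registers \<times> memory \<Rightarrow> bool" where
  "solo w cfg [] cfg' \<longleftrightarrow> cfg' = cfg"
| "solo w (c, s, m) (a # tr) cfg' \<longleftrightarrow> c \<noteq> Skip \<and> a = next_access w c s \<and>
     solo w (fst (advance w m c s), snd (advance w m c s), effect a m) tr cfg'"

definition confined :: "nat set \<Rightarrow> nat set \<Rightarrow> trace \<Rightarrow> bool" where
  "confined W R tr \<longleftrightarrow> (\<forall>a. Some (Read a) \<in> set tr \<longrightarrow> a \<in> R) \<and> (\<forall>a v. Some (Write a v) \<in> set tr \<longrightarrow> a \<in> W)"

text \<open>
  The misses are counted as if only the two most recently used blocks were cached. This is an upper
  bound because \<open>M div B \<ge> 2\<close>, and the blocks that other cores invalidate in a phase are not used by the core itself.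
\<close>

fun touch :: "nat \<Rightarrow> nat list \<Rightarrow> nat list" where
  "touch b r = take 2 (b # removeAll b r)"

declare touch.simps [simp del]

fun recent :: "nat \<Rightarrow> nat list \<Rightarrow> trace \<Rightarrow> nat list" where
  "recent B r [] = r"
| "recent B r (None # tr) = recent B r tr"
| "recent B r (Some acc # tr) = recent B (touch (address acc div B) r) tr"

fun cost :: "nat \<Rightarrow> nat list \<Rightarrow> trace \<Rightarrow> nat" where
  "cost B r [] = 0"
| "cost B r (None # tr) = cost B r tr"
| "cost B r (Some acc # tr) =
     (if address acc div B \<in> set r then 0 else 1) + cost B (touch (address acc div B) r) tr"

definition accesses :: "trace \<Rightarrow> nat" where
  "accesses tr = length (filter (\<lambda>a. a \<noteq> None) tr)"

lemma solo_append:
  "solo w cfg (tr @ tr') cfg'' \<longleftrightarrow> (\<exists>cfg'. solo w cfg tr cfg' \<and> solo w cfg' tr' cfg'')"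
proof (induction tr arbitrary: cfg)
  case (Cons a tr)
  then show ?case by (cases cfg) auto
qed simp

lemma solo_Seq:
  "solo w (c, s, m) tr (c', s', m') \<Longrightarrow> solo w (Seq c d, s, m) tr (Seq c' d, s', m')"
proof (induction tr arbitrary: c s m)
  case (Cons a tr)
  then show ?case
    by (auto simp: Let_def case_prod_beta)
qed simp

lemma solo_foldl_Seq:
  "solo w (c, s, m) tr (c', s', m') \<Longrightarrow>
   solo w (foldl Seq c Qs, s, m) tr (foldl Seq c' Qs, s', m')"
  by (induction Qs arbitrary: c c') (auto intro: solo_Seq)

lemma solo_unchanged:
  "solo w (c, s, m) tr (c', s', m') \<Longrightarrow> confined W R tr \<Longrightarrow> a \<notin> W \<Longrightarrow> m' a = m a"
proof (induction tr arbitrary: c s m)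
  case (Cons x tr)
  from Cons.prems have "m' a = effect x m a"
    by (intro Cons.IH) (auto simp: confined_def)
  also have "effect x m a = m a"
    using Cons.prems(2,3) by (cases x rule: option.exhaust; cases "the x") (auto simp: confined_def)
  finally show ?case .
qed simp

lemma confined_simps [simp]:
  "confined W R []"
  "confined W R (None # tr) \<longleftrightarrow> confined W R tr"
  "confined W R (Some (Read a) # tr) \<longleftrightarrow> a \<in> R \<and> confined W R tr"
  "confined W R (Some (Write a v) # tr) \<longleftrightarrow> a \<in> W \<and> confined W R tr"
  "confined W R (tr @ tr') \<longleftrightarrow> confined W R tr \<and> confined W R tr'"
  "confined W R (replicate n None)"
  by (auto simp: confined_def)

lemma accesses_simps [simp]:
  "accesses [] = 0"
  "accesses (None # tr) = accesses tr"
  "accesses (Some a # tr) = Suc (accesses tr)"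
  "accesses (tr @ tr') = accesses tr + accesses tr'"
  "accesses (replicate n None) = 0"
  by (auto simp: accesses_def)

lemma recent_append [simp]: "recent B r (tr @ tr') = recent B (recent B r tr) tr'"
  by (induction B r tr rule: recent.induct) auto

lemma cost_append [simp]: "cost B r (tr @ tr') = cost B r tr + cost B (recent B r tr) tr'"
  by (induction B r tr rule: recent.induct) auto

lemma recent_replicate_None [simp]: "recent B r (replicate n None) = r"
  by (induction n) auto

lemma cost_replicate_None [simp]: "cost B r (replicate n None) = 0"
  by (induction n) auto

lemma cost_le_accesses: "cost B r tr \<le> accesses tr"
  by (induction B r tr rule: recent.induct) auto

section \<open>Lockstep runs of cores with block-disjoint footprints\<close>

lemma advance_cong:
  "(\<And>a. next_access w c s = Some (Read a) \<Longrightarrow> m a = m' a) \<Longrightarrow> advance w m c s = advance w m' c s"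
  by (induction c) auto

text \<open>\<open>pm c\<close> is the memory that core \<open>c\<close> would see if it ran alone;
  it agrees with the shared memory wherever no other core may write, and by \<open>sep\<close> this
  includes everything that \<open>c\<close> reads. \<open>r c\<close> is a prefix of the real LRU
  list and consists of blocks from the footprint of \<open>c\<close>. No other core writes to such a
  block, so it is never invalidated, and each step costs \<open>c\<close> at most what
  \<open>cost\<close> charges.\<close>

lemma lockstep:
  assumes B: "2 * B \<le> M" "1 \<le> B"
    and sep: "\<And>c c' a a'. \<lbrakk>c < p; c' < p; c \<noteq> c'; a \<in> W c; a' \<in> W c' \<union> R c'\<rbrakk> \<Longrightarrow> a div B \<noteq> a' div B"
  shows "\<lbrakk>\<And>c. c < p \<Longrightarrow> solo w (code cfg c, regs cfg c, pm c) (tr c) (code' c, regs' c, pm' c);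
      \<And>c. c < p \<Longrightarrow> length (tr c) = T;
      \<And>c. c < p \<Longrightarrow> confined (W c) (R c) (tr c);
      \<And>c a. c < p \<Longrightarrow> (\<And>c'. c' < p \<Longrightarrow> c' \<noteq> c \<Longrightarrow> a \<notin> W c') \<Longrightarrow> mem cfg a = pm c a;
      \<And>c. c < p \<Longrightarrow> \<exists>rest. cache cfg c = r c @ rest;
      \<And>c b. c < p \<Longrightarrow> b \<in> set (r c) \<Longrightarrow> b \<in> (\<lambda>a. a div B) ` (W c \<union> R c)\<rbrakk>
    \<Longrightarrow> (\<forall>c<p. code ((step p M B w ^^ T) cfg) c = code' c \<and> regs ((step p M B w ^^ T) cfg) c = regs' c \<and>
        (\<forall>a. (\<forall>c'<p. c' \<noteq> c \<longrightarrow> a \<notin> W c') \<longrightarrow> mem ((step p M B w ^^ T) cfg) a = pm' c a)) \<and>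
        misses ((step p M B w ^^ T) cfg) \<le> misses cfg + (\<Sum>c<p. cost B (r c) (tr c))"
proof (induction T arbitrary: cfg pm tr r)
  case 0
  then show ?case by auto
next
  case (Suc T)
  note prems = Suc.prems
  define x where "x c = hd (tr c)" for c
  have tr: "tr c = x c # tl (tr c)" if "c < p" for c
    using prems(2)[OF that] by (cases "tr c") (auto simp: x_def)
  have x: "core_access w cfg c = x c" if "c < p" for c
    using prems(1)[OF that] unfolding core_access_def by (subst (asm) tr[OF that]) simp
  have xW: "a \<in> W c" if "x c = Some (Write a v)" "c < p" for a v c
    using prems(3)[OF that(2)] by (subst (asm) tr[OF that(2)]) (use that in simp)
  have xR: "a \<in> R c" if "x c = Some (Read a)" "c < p" for a c
    using prems(3)[OF that(2)] by (subst (asm) tr[OF that(2)]) (use that in simp)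
  have xWR: "address acc \<in> W c \<union> R c" if "x c = Some acc" "c < p" for acc c
    using xW[of c] xR[of c] that by (cases acc) auto
  have bw: "block_writers p B w cfg (a div B) \<subseteq> {c}" if "c < p" "a \<in> W c \<union> R c" for a c
  proof
    fix c' assume "c' \<in> block_writers p B w cfg (a div B)"
    then obtain a' v where c': "c' < p" "core_access w cfg c' = Some (Write a' v)" "a' div B = a div B"
      by (auto simp: block_writers_def)
    then have "a' \<in> W c'" using x[of c'] xW by auto
    then show "c' \<in> {c}" using sep[of c' c a' a] that c' by auto
  qed
  define cfg1 where "cfg1 = step p M B w cfg"
  define pm1 where "pm1 c = effect (x c) (pm c)" for c
  define r1 where "r1 c = (case x c of None \<Rightarrow> r c | Some acc \<Rightarrow> touch (address acc div B) (r c))" for c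
  have r1_foot: "b \<in> (\<lambda>a. a div B) ` (W c \<union> R c)" if "c < p" "b \<in> set (r1 c)" for b c
  proof (cases "x c")
    case None
    then show ?thesis using that prems(6)[of c b] by (simp add: r1_def)
  next
    case (Some acc)
    then have "b = address acc div B \<or> b \<in> set (r c)"
      using that(2) set_take_subset[of 2 "(address acc div B) # removeAll (address acc div B) (r c)"]
      by (auto simp: r1_def touch.simps)
    then show ?thesis using xWR[OF Some that(1)] prems(6)[OF that(1), of b] by auto
  qed
  have r1_cache: "\<exists>rest. cache cfg1 c = r1 c @ rest" if c: "c < p" for c
  proof -
    obtain rest where rest: "cache cfg c = r c @ rest" using prems(5)[OF c] by auto
    have K: "2 \<le> M div B" using B div_le_mono[OF B(1), of B] by simp
    have "\<exists>rest'. (case core_access w cfg c of None \<Rightarrow> cache cfg c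
        | Some acc \<Rightarrow> (let b = address acc div B in take (M div B) (b # removeAll b (cache cfg c)))) = r1 c @ rest'"
    proof (cases "x c")
      case None
      then show ?thesis using rest x[OF c] by (simp add: r1_def)
    next
      case (Some acc)
      define b where "b = address acc div B"
      \<comment> \<open>LRU inclusion: moving \<open>b\<close> to the front respects prefixes, so
        the list cut to two blocks is a prefix of the list cut to \<open>M div B \<ge> 2\<close>
        blocks.\<close>
      have "take 2 (b # removeAll b (r c)) @ drop 2 (b # removeAll b (r c)) @ removeAll b rest =
        b # removeAll b (cache cfg c)"
        unfolding append_assoc[symmetric] append_take_drop_id by (simp add: rest)
      then have "take (M div B) (b # removeAll b (cache cfg c)) =
        take 2 (b # removeAll b (r c)) @ take (M div B - length (take 2 (b # removeAll b (r c))))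
        (drop 2 (b # removeAll b (r c)) @ removeAll b rest)"
        using K by (metis (no_types, lifting) length_take min.cobounded2 min.absorb2 le_trans take_append take_all_iff)
      then show ?thesis using Some x[OF c] by (auto simp: r1_def b_def Let_def touch.simps)
    qed
    then obtain rest' where "cache cfg1 c = filter (\<lambda>b. block_writers p B w cfg b \<subseteq> {c}) (r1 c @ rest')"
      unfolding cfg1_def step_def step_cache_def by auto
    moreover have "filter (\<lambda>b. block_writers p B w cfg b \<subseteq> {c}) (r1 c) = r1 c"
      using bw[OF c] r1_foot[OF c] by (intro filter_True) blast
    ultimately show ?thesis by auto
  qed
  have miss: "step_misses p B w cfg c + cost B (r1 c) (tl (tr c)) \<le> cost B (r c) (tr c)" if c: "c < p" for c
  proof (cases "x c")
    case None
    then show ?thesis using x[OF c] by (subst tr[OF c]) (simp add: step_misses_def r1_def)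
  next
    case (Some acc)
    define b where "b = address acc div B"
    have "block_writers p B w cfg b - {c} = {}" using bw[OF c xWR[OF Some c]] by (auto simp: b_def)
    then have "card (block_writers p B w cfg b - {c}) = 0" by (simp only: card.empty)
    moreover have "b \<in> set (r c) \<Longrightarrow> b \<in> set (cache cfg c)" using prems(5)[OF c] by auto
    ultimately have "step_misses p B w cfg c \<le> (if b \<in> set (r c) then 0 else 1)"
      using Some x[OF c] unfolding step_misses_def by (simp add: Let_def b_def[symmetric])
    then show ?thesis using Some x[OF c] by (subst tr[OF c]) (simp add: r1_def b_def)
  qed
  have read_ok: "mem cfg a = pm c a" if xc: "x c = Some (Read a)" and c: "c < p" for a c
  proof -
    have "a \<notin> W c'" if "c' < p" "c' \<noteq> c" for c'
      using sep[of c' c a a] that xR[OF xc c] c by auto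
    then show ?thesis using prems(4)[OF c] by blast
  qed
  have adv: "advance w (mem cfg) (code cfg c) (regs cfg c) = advance w (pm c) (code cfg c) (regs cfg c)" if "c < p" for c
  proof (rule advance_cong)
    fix a assume "next_access w (code cfg c) (regs cfg c) = Some (Read a)"
    then have "x c = Some (Read a)" using x[OF that] by (simp add: core_access_def)
    then show "mem cfg a = pm c a" using read_ok[OF _ that] by blast
  qed
  have priv: "solo w (code cfg1 c, regs cfg1 c, pm1 c) (tl (tr c)) (code' c, regs' c, pm' c)" if "c < p" for c
  proof -
    have "solo w (code cfg c, regs cfg c, pm c) (x c # tl (tr c)) (code' c, regs' c, pm' c)"
      using prems(1)[OF that] tr[OF that] by simp
    then show ?thesis
      unfolding cfg1_def pm1_def step_def solo.simps machine.simps adv[OF that] by blast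
  qed
  have mem1: "mem cfg1 a = pm1 c a" if c: "c < p" and a: "\<And>c'. c' < p \<Longrightarrow> c' \<noteq> c \<Longrightarrow> a \<notin> W c'" for c a
  proof -
    have only: "c' = c" if "c' < p" "core_access w cfg c' = Some (Write a v)" for c' v
      using xW[of c' a v] that x[of c'] a[of c'] by metis
    show ?thesis
    proof (cases "\<exists>v. x c = Some (Write a v)")
      case True
      then obtain v where v: "x c = Some (Write a v)" by auto
      \<comment> \<open>By \<open>only\<close>, core \<open>c\<close> is the sole writer of
        \<open>a\<close>, so the unspecified choice among concurrent writers is determined.\<close>
      have "(SOME v. \<exists>c<p. core_access w cfg c = Some (Write a v)) = v"
      proof (rule some_equality)
        show "\<exists>c<p. core_access w cfg c = Some (Write a v)" using c x[OF c] v by metis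
        fix v' assume "\<exists>c<p. core_access w cfg c = Some (Write a v')"
        then have "core_access w cfg c = Some (Write a v')" using only by metis
        then show "v' = v" using x[OF c] v by simp
      qed
      moreover have "\<exists>c<p. \<exists>v. core_access w cfg c = Some (Write a v)" using c x[OF c] v by metis
      ultimately have "mem cfg1 a = v" unfolding cfg1_def step_def step_mem_def by simp
      then show ?thesis using v by (simp add: pm1_def)
    next
      case False
      then have "\<not> (\<exists>c<p. \<exists>v. core_access w cfg c = Some (Write a v))"
        using only x[OF c] by metis
      then have "step_mem p w cfg a = mem cfg a" unfolding step_mem_def by (rule if_not_P)
      then have "mem cfg1 a = mem cfg a" unfolding cfg1_def step_def by simp
      also have "\<dots> = pm c a" using prems(4)[OF c a] .
      also have "\<dots> = pm1 c a" using False unfolding pm1_def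
        by (cases "x c"; cases "the (x c)") auto
      finally show ?thesis .
    qed
  qed
  have IH: "(\<forall>c<p. code ((step p M B w ^^ T) cfg1) c = code' c \<and> regs ((step p M B w ^^ T) cfg1) c = regs' c \<and>
        (\<forall>a. (\<forall>c'<p. c' \<noteq> c \<longrightarrow> a \<notin> W c') \<longrightarrow> mem ((step p M B w ^^ T) cfg1) a = pm' c a)) \<and>
        misses ((step p M B w ^^ T) cfg1) \<le> misses cfg1 + (\<Sum>c<p. cost B (r1 c) (tl (tr c)))"
  proof (rule Suc.IH)
    show "confined (W c) (R c) (tl (tr c))" if "c < p" for c
      using prems(3)[OF that] by (cases "tr c") (auto simp: confined_def)
    show "length (tl (tr c)) = T" if "c < p" for c
      using prems(2)[OF that] by simp
    show "b \<in> (\<lambda>a. a div B) ` (W c \<union> R c)" if "c < p" "b \<in> set (r1 c)" for c b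
      using r1_foot[OF that] .
    show "mem cfg1 a = pm1 c a" if "c < p" "\<And>c'. c' < p \<Longrightarrow> c' \<noteq> c \<Longrightarrow> a \<notin> W c'" for c a
      using mem1[OF that] .
  qed (fact priv r1_cache)+
  have "misses cfg1 + (\<Sum>c<p. cost B (r1 c) (tl (tr c))) =
      misses cfg + (\<Sum>c<p. step_misses p B w cfg c + cost B (r1 c) (tl (tr c)))"
    unfolding cfg1_def step_def by (simp add: sum.distrib)
  also have "\<dots> \<le> misses cfg + (\<Sum>c<p. cost B (r c) (tr c))"
    using miss by (intro add_left_mono sum_mono) auto
  finally show ?case using IH unfolding funpow_Suc_right o_apply cfg1_def[symmetric] by (meson le_trans)
qed

section \<open>Total correctness with traces for a single core\<close>

definition wp :: "nat \<Rightarrow> com \<Rightarrow> (trace \<Rightarrow> registers \<Rightarrow> memory \<Rightarrow> bool) \<Rightarrow> trace \<Rightarrow> registers \<Rightarrow> memory \<Rightarrow> bool" where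
  "wp w c Q tr s m \<longleftrightarrow> (\<exists>tr' s' m'. solo w (c, s, m) tr' (Skip, s', m') \<and> Q (tr @ tr') s' m')"

text \<open>A precondition computed by recursion on loop-free code, so that simplification executes
  a body symbolically. \<open>Seq\<close> adds a \<open>None\<close> for the step that discards a
  finished first component. Loops get \<open>False\<close> and are left to
  \<open>wp_While\<close>.\<close>

fun sp :: "nat \<Rightarrow> com \<Rightarrow> (trace \<Rightarrow> registers \<Rightarrow> memory \<Rightarrow> bool) \<Rightarrow> trace \<Rightarrow> registers \<Rightarrow> memory \<Rightarrow> bool" where
  "sp w Skip Q tr s m \<longleftrightarrow> Q tr s m"
| "sp w (Assign r e) Q tr s m \<longleftrightarrow> Q (tr @ [None]) (s(r := eval w s e)) m"
| "sp w (Load r a) Q tr s m \<longleftrightarrow> Q (tr @ [Some (Read (eval w s a))]) (s(r := m (eval w s a))) m"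
| "sp w (Store a e) Q tr s m \<longleftrightarrow> Q (tr @ [Some (Write (eval w s a) (eval w s e))]) s (m(eval w s a := eval w s e))"
| "sp w (Seq c d) Q tr s m \<longleftrightarrow> sp w c (\<lambda>tr s m. sp w d Q (tr @ [None]) s m) tr s m"
| "sp w (Cond e c d) Q tr s m \<longleftrightarrow> (if eval w s e \<noteq> 0 then sp w c Q (tr @ [None]) s m else sp w d Q (tr @ [None]) s m)"
| "sp w (While e c) Q tr s m \<longleftrightarrow> False"

lemma wp_mono: "wp w c Q tr s m \<Longrightarrow> (\<And>tr s m. Q tr s m \<Longrightarrow> Q' tr s m) \<Longrightarrow> wp w c Q' tr s m"
  unfolding wp_def by blast

lemma wp_Seq:
  assumes "wp w c (\<lambda>tr s m. wp w d Q (tr @ [None]) s m) tr s m"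
  shows "wp w (Seq c d) Q tr s m"
proof -
  from assms obtain tr1 s1 m1 tr2 s2 m2 where
    1: "solo w (c, s, m) tr1 (Skip, s1, m1)" "solo w (d, s1, m1) tr2 (Skip, s2, m2)" "Q ((tr @ tr1) @ [None] @ tr2) s2 m2"
    by (auto simp: wp_def)
  have "solo w (Seq c d, s, m) (tr1 @ [None] @ tr2) (Skip, s2, m2)"
    unfolding solo_append using solo_Seq[OF 1(1), of d] 1(2)
    by (intro exI[of _ "(Seq Skip d, s1, m1)"] exI[of _ "(d, s1, m1)"]) simp
  then show ?thesis using 1(3) unfolding wp_def by (metis append_assoc)
qed

lemma sp_mono: "sp w c Q tr s m \<Longrightarrow> (\<And>tr s m. Q tr s m \<Longrightarrow> Q' tr s m) \<Longrightarrow> sp w c Q' tr s m"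
proof (induction c arbitrary: Q Q' tr s m)
  case (Seq c1 c2)
  from Seq.prems(1) show ?case
    unfolding sp.simps by (rule Seq.IH(1)) (erule Seq.IH(2), rule Seq.prems(2))
qed (auto split: if_splits)

lemma wp_sp: "sp w c Q tr s m \<Longrightarrow> wp w c Q tr s m"
proof (induction c arbitrary: Q tr s m)
  case Skip
  then show ?case unfolding wp_def by (intro exI[of _ "[]"]) auto
next
  case (Assign r e)
  then show ?case unfolding wp_def by (intro exI[of _ "[None]"]) auto
next
  case (Load r a)
  then show ?case unfolding wp_def by (intro exI[of _ "[Some (Read (eval w s a))]"]) auto
next
  case (Store a e)
  then show ?case unfolding wp_def by (intro exI[of _ "[Some (Write (eval w s a) (eval w s e))]"]) auto
next
  case (Seq c1 c2)
  from Seq.prems have "sp w c1 (\<lambda>tr s m. wp w c2 Q (tr @ [None]) s m) tr s m"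
    by (auto elim!: sp_mono intro: Seq.IH(2))
  then show ?case by (intro wp_Seq Seq.IH(1))
next
  case (Cond e c1 c2)
  have "wp w (if eval w s e \<noteq> 0 then c1 else c2) Q (tr @ [None]) s m"
    using Cond by auto
  then obtain tr' s' m' where
    1: "solo w (if eval w s e \<noteq> 0 then c1 else c2, s, m) tr' (Skip, s', m')" "Q ((tr @ [None]) @ tr') s' m'"
    by (auto simp: wp_def)
  from 1(1) have "solo w (Cond e c1 c2, s, m) (None # tr') (Skip, s', m')" by simp
  with 1(2) show ?case unfolding wp_def
    by (intro exI[of _ "None # tr'"] exI[of _ s'] exI[of _ m']) simp
qed simp

text \<open>The number \<open>N\<close> of iterations is fixed in advance, which yields termination
  without a separate measure and lets \<open>I\<close> pin down the trace length. The induction is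
  on the iterations still to come.\<close>

lemma wp_While:
  assumes body: "\<And>i tr s m. \<lbrakk>i < N; I i tr s m\<rbrakk> \<Longrightarrow>
      eval w s e \<noteq> 0 \<and> wp w c (\<lambda>tr s m. I (Suc i) (tr @ [None]) s m) (tr @ [None]) s m"
    and exit: "\<And>tr s m. I N tr s m \<Longrightarrow> eval w s e = 0 \<and> Q (tr @ [None]) s m"
    and init: "I 0 tr s m"
  shows "wp w (While e c) Q tr s m"
proof -
  have "wp w (While e c) Q tr s m" if "I (N - j) tr s m" "j \<le> N" for j tr s m
    using that
  proof (induction j arbitrary: tr s m)
    case 0
    then show ?case using exit[of tr s m] unfolding wp_def by (intro exI[of _ "[None]"]) auto
  next
    case (Suc j)
    then have i: "N - Suc j < N" "Suc (N - Suc j) = N - j" by auto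
    from body[OF i(1) Suc.prems(1)] have e: "eval w s e \<noteq> 0"
      and "wp w c (\<lambda>tr s m. I (N - j) (tr @ [None]) s m) (tr @ [None]) s m" by (auto simp: i(2))
    then have "wp w c (\<lambda>tr s m. wp w (While e c) Q (tr @ [None]) s m) (tr @ [None]) s m"
      using Suc.IH Suc.prems(2) by (auto elim!: wp_mono)
    then have "wp w (Seq c (While e c)) Q (tr @ [None]) s m" by (rule wp_Seq)
    then obtain tr' s' m' where
      1: "solo w (Seq c (While e c), s, m) tr' (Skip, s', m')" "Q ((tr @ [None]) @ tr') s' m'"
      by (auto simp: wp_def)
    from 1(1) e have "solo w (While e c, s, m) (None # tr') (Skip, s', m')" by simp
    with 1(2) show ?case unfolding wp_def
      by (intro exI[of _ "None # tr'"] exI[of _ s'] exI[of _ m']) simp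
  qed
  from this[of N] init show ?thesis by simp
qed

lemma wp_prepared_While:
  assumes "sp w d (\<lambda>tr r m. I 0 (tr @ [None]) r m) [] s m"
    and "\<And>i tr s m. i < N \<Longrightarrow> I i tr s m \<Longrightarrow> eval w s e \<noteq> 0"
    and "\<And>i tr s m. i < N \<Longrightarrow> I i tr s m \<Longrightarrow> sp w c (\<lambda>tr s m. I (Suc i) (tr @ [None]) s m) (tr @ [None]) s m"
    and "\<And>tr s m. I N tr s m \<Longrightarrow> eval w s e = 0"
    and "\<And>tr s m. I N tr s m \<Longrightarrow> Q (tr @ [None]) s m"
  shows "wp w (Seq d (While e c)) Q [] s m"
proof (rule wp_Seq, rule wp_mono[OF wp_sp[OF assms(1)]])
  fix tr s m
  assume "I 0 (tr @ [None]) s m"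
  then show "wp w (While e c) Q (tr @ [None]) s m"
    by (rule wp_While[where I = I and N = N, rotated 2])
      (rule conjI[OF assms(2) wp_sp[OF assms(3)]] conjI[OF assms(4,5)]; assumption)+
qed

text \<open>
  Padding for the branch not taken: \<open>n\<close> steps that change nothing.
\<close>

fun idle :: "nat \<Rightarrow> com" where
  "idle 0 = Skip"
| "idle (Suc n) = Cond (Const 0) Skip (idle n)"

declare idle.simps [simp del]

lemma sp_idle [simp]: "sp w (idle n) Q tr s m \<longleftrightarrow> Q (tr @ replicate n None) s m"
  by (induction n arbitrary: tr) (auto simp: idle.simps)

text \<open>Meant for loop-free code whose conditionals have branches of equal length; for
  \<open>While\<close> the value 1 is a mere default. Nothing general is proved about it, as the
  symbolic execution of each body yields the length of its trace.\<close>

fun duration :: "com \<Rightarrow> nat" where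
  "duration Skip = 0"
| "duration (Seq c d) = duration c + 1 + duration d"
| "duration (Cond e c d) = 1 + max (duration c) (duration d)"
| "duration _ = 1"

lemma duration_idle [simp]: "duration (idle n) = n"
  by (induction n) (auto simp: idle.simps)

text \<open>
  Cores beyond \<open>p\<close> also step, but have no effect; their registers are masked.
\<close>

definition cores :: "nat \<Rightarrow> machine \<Rightarrow> nat \<Rightarrow> registers" where
  "cores p cfg = (\<lambda>c. if c < p then regs cfg c else (\<lambda>_. 0))"

abbreviation reaches :: "nat \<Rightarrow> nat \<Rightarrow> nat \<Rightarrow> nat \<Rightarrow> nat \<Rightarrow> nat \<Rightarrow>
    assertion \<Rightarrow> com list \<Rightarrow> machine \<Rightarrow> bool" where
  "reaches p M B w T C Post Qs cfg \<equiv>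
    (let cfg' = (step p M B w ^^ T) cfg in
      (\<forall>c<p. code cfg' c = foldl Seq Skip Qs) \<and> Post (cores p cfg') (mem cfg') \<and> misses cfg' \<le> misses cfg + C)"

text \<open>
  The list \<open>Qs\<close> is the code that remains to be run, innermost first.
\<close>

definition par :: "nat \<Rightarrow> nat \<Rightarrow> nat \<Rightarrow> nat \<Rightarrow> assertion \<Rightarrow> com \<Rightarrow> nat \<Rightarrow> nat \<Rightarrow>
    assertion \<Rightarrow> bool" where
  "par p M B w Pre P T C Post \<longleftrightarrow>
     (\<forall>Qs cfg. (\<forall>c<p. code cfg c = foldl Seq P Qs) \<and> Pre (cores p cfg) (mem cfg) \<longrightarrow>
       reaches p M B w T C Post Qs cfg)"

section \<open>Composition rules for parallel phases\<close>

lemma next_access_foldl_Seq [simp]: "next_access w (foldl Seq P Qs) s = next_access w P s"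
  by (induction Qs arbitrary: P) auto

lemma advance_foldl_Seq:
  "P \<noteq> Skip \<Longrightarrow> advance w m (foldl Seq P Qs) s =
     (foldl Seq (fst (advance w m P s)) Qs, snd (advance w m P s))"
  by (induction Qs arbitrary: P) (auto simp: Let_def case_prod_beta)

lemma silent_step:
  assumes "\<And>c. c < p \<Longrightarrow> next_access w (code cfg c) (regs cfg c) = None"
    and "\<And>c. c < p \<Longrightarrow> advance w (mem cfg) (code cfg c) (regs cfg c) = (code' c, regs cfg c)"
  shows "mem (step p M B w cfg) = mem cfg" "misses (step p M B w cfg) = misses cfg"
    "cores p (step p M B w cfg) = cores p cfg" "c < p \<Longrightarrow> code (step p M B w cfg) c = code' c"
proof -
  show "mem (step p M B w cfg) = mem cfg"
    using assms(1) by (auto simp: step_def step_mem_def core_access_def fun_eq_iff)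
  show "misses (step p M B w cfg) = misses cfg"
    using assms(1) by (auto simp: step_def step_misses_def core_access_def)
  show "cores p (step p M B w cfg) = cores p cfg"
    using assms(2) by (auto simp: step_def cores_def fun_eq_iff)
  show "c < p \<Longrightarrow> code (step p M B w cfg) c = code' c"
    using assms(2) by (auto simp: step_def)
qed

text \<open>All cores finish \<open>P\<close> after the same \<open>T1\<close> steps, so the silent
  step from \<open>Seq Skip Q\<close> to \<open>Q\<close> happens everywhere at once. It is the
  barrier between two phases and costs one time unit.\<close>

lemma par_Seq:
  assumes 1: "par p M B w Pre P T1 C1 Mid" and 2: "par p M B w Mid Q T2 C2 Post"
  shows "par p M B w Pre (Seq P Q) (T1 + 1 + T2) (C1 + C2) Post"
  unfolding par_def
proof (intro allI impI)
  fix Qs cfg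
  assume pre: "(\<forall>c<p. code cfg c = foldl Seq (Seq P Q) Qs) \<and> Pre (cores p cfg) (mem cfg)"
  define cfg1 where "cfg1 = (step p M B w ^^ T1) cfg"
  have "\<forall>c<p. code cfg c = foldl Seq P (Q # Qs)" using pre by simp
  then have s1: "\<forall>c<p. code cfg1 c = foldl Seq (Seq Skip Q) Qs" "Mid (cores p cfg1) (mem cfg1)" "misses cfg1 \<le> misses cfg + C1"
    using 1 pre unfolding par_def cfg1_def Let_def by (metis foldl_Cons)+
  define cfg2 where "cfg2 = step p M B w cfg1"
  have "mem cfg2 = mem cfg1" "misses cfg2 = misses cfg1" "cores p cfg2 = cores p cfg1" "\<forall>c<p. code cfg2 c = foldl Seq Q Qs"
    unfolding cfg2_def using s1(1)
    by (auto intro!: silent_step[where code' = "\<lambda>_. foldl Seq Q Qs"] simp: advance_foldl_Seq)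
  then have "let cfg' = (step p M B w ^^ T2) cfg2 in
        (\<forall>c<p. code cfg' c = foldl Seq Skip Qs) \<and> Post (cores p cfg') (mem cfg') \<and>
        misses cfg' \<le> misses cfg1 + C2"
    using 2 s1(2) unfolding par_def by metis
  moreover have "(step p M B w ^^ T2) cfg2 = (step p M B w ^^ (T1 + 1 + T2)) cfg"
    unfolding cfg2_def cfg1_def
    by (metis Suc_eq_plus1 add.commute comp_apply funpow.simps(2) funpow_add)
  ultimately show "reaches p M B w (T1 + 1 + T2) (C1 + C2) Post Qs cfg"
    using s1(3) by (auto simp: Let_def)
qed

lemma par_weaken:
  assumes "par p M B w Pre P T C Post" "\<And>S m. Pre' S m \<Longrightarrow> Pre S m" "\<And>S m. Post S m \<Longrightarrow> Post' S m" "C \<le> C'"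
  shows "par p M B w Pre' P T C' Post'"
  using assms unfolding par_def Let_def by (meson add_left_mono le_trans)

text \<open>The test has the same outcome on every core, so all leave the loop together. An
  iteration adds two silent steps, one for the test and one that discards the finished body; the
  failing test is the final 1.\<close>

lemma par_While:
  assumes body: "\<And>i. i < N \<Longrightarrow> par p M B w (I i) P T (C i) (I (Suc i))"
    and cont: "\<And>i S m c. \<lbrakk>i < N; I i S m; c < p\<rbrakk> \<Longrightarrow> eval w (S c) e \<noteq> 0"
    and exit: "\<And>S m c. \<lbrakk>I N S m; c < p\<rbrakk> \<Longrightarrow> eval w (S c) e = 0"
  shows "par p M B w (I 0) (While e P) (N * (T + 2) + 1) (\<Sum>i<N. C i) (I N)"
proof -
  have eval_cores: "eval w (regs cfg c) e = eval w (cores p cfg c) e" if "c < p" for cfg c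
    using that by (simp add: cores_def)
  have "par p M B w (I (N - j)) (While e P) (j * (T + 2) + 1) (\<Sum>i=N-j..<N. C i) (I N)" if "j \<le> N" for j
    using that
  proof (induction j)
    case 0
    show ?case unfolding par_def
    proof (intro allI impI)
      fix Qs cfg
      assume pre: "(\<forall>c<p. code cfg c = foldl Seq (While e P) Qs) \<and> I (N - 0) (cores p cfg) (mem cfg)"
      define cfg2 where "cfg2 = step p M B w cfg"
      have "mem cfg2 = mem cfg" "misses cfg2 = misses cfg" "cores p cfg2 = cores p cfg" "\<forall>c<p. code cfg2 c = foldl Seq Skip Qs"
        unfolding cfg2_def using pre exit[of "cores p cfg" "mem cfg"] eval_cores[of _ cfg]
        by (auto intro!: silent_step[where code' = "\<lambda>_. foldl Seq Skip Qs"] simp: advance_foldl_Seq)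
      then show "reaches p M B w (0 * (T + 2) + 1) (\<Sum>i=N-0..<N. C i) (I N) Qs cfg"
        using pre by (simp add: cfg2_def Let_def)
    qed
  next
    case (Suc j)
    then have i: "N - Suc j < N" "Suc (N - Suc j) = N - j" by auto
    have "par p M B w (I (N - Suc j)) (Seq P (While e P)) (T + 1 + (j * (T + 2) + 1)) (C (N - Suc j) + (\<Sum>i=N-j..<N. C i)) (I N)"
      using body[OF i(1)] Suc.IH Suc.prems by (intro par_Seq[where Mid = "I (N - j)"]) (auto simp: i(2))
    moreover have "C (N - Suc j) + (\<Sum>i=N-j..<N. C i) = (\<Sum>i=N-Suc j..<N. C i)"
      using sum.atLeast_Suc_lessThan[OF i(1), of C] by (simp add: i(2))
    ultimately have *: "par p M B w (I (N - Suc j)) (Seq P (While e P)) (T + 1 + (j * (T + 2) + 1)) (\<Sum>i=N-Suc j..<N. C i) (I N)"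
      by simp
    show ?case unfolding par_def
    proof (intro allI impI)
      fix Qs cfg
      assume pre: "(\<forall>c<p. code cfg c = foldl Seq (While e P) Qs) \<and> I (N - Suc j) (cores p cfg) (mem cfg)"
      define cfg2 where "cfg2 = step p M B w cfg"
      have 2: "mem cfg2 = mem cfg" "misses cfg2 = misses cfg" "cores p cfg2 = cores p cfg" "\<forall>c<p. code cfg2 c = foldl Seq (Seq P (While e P)) Qs"
        unfolding cfg2_def using pre cont[OF i(1), of "cores p cfg" "mem cfg"] eval_cores[of _ cfg]
        by (auto intro!: silent_step[where code' = "\<lambda>_. foldl Seq (Seq P (While e P)) Qs"] simp: advance_foldl_Seq)
      then have "let cfg' = (step p M B w ^^ (T + 1 + (j * (T + 2) + 1))) cfg2 in
        (\<forall>c<p. code cfg' c = foldl Seq Skip Qs) \<and> I N (cores p cfg') (mem cfg') \<and>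
        misses cfg' \<le> misses cfg2 + (\<Sum>i=N-Suc j..<N. C i)"
        using * pre unfolding par_def by metis
      moreover have "(step p M B w ^^ (T + 1 + (j * (T + 2) + 1))) cfg2 = (step p M B w ^^ (Suc j * (T + 2) + 1)) cfg"
      proof -
        have "Suc j * (T + 2) + 1 = Suc (T + 1 + (j * (T + 2) + 1))" by simp
        then show ?thesis unfolding cfg2_def by (metis funpow_simps_right(2) comp_apply)
      qed
      ultimately show "reaches p M B w (Suc j * (T + 2) + 1) (\<Sum>i=N-Suc j..<N. C i) (I N) Qs cfg"
        by (simp add: 2(2))
    qed
  qed
  from this[of N] show ?thesis by (simp add: atLeast0LessThan)
qed

definition block_disjoint :: "nat \<Rightarrow> nat \<Rightarrow> (nat \<Rightarrow> nat set) \<Rightarrow> (nat \<Rightarrow> nat set) \<Rightarrow> bool" where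
  "block_disjoint p B W R \<longleftrightarrow> (\<forall>c c' a a'. c < p \<longrightarrow> c' < p \<longrightarrow> c \<noteq> c' \<longrightarrow> a \<in> W c \<longrightarrow> a' \<in> W c' \<union> R c' \<longrightarrow> a div B \<noteq> a' div B)"

text \<open>Reduces a phase to \<open>p\<close> independent sequential proofs. \<open>mc\<close> is
  the memory that core \<open>c\<close> would leave if it ran alone; it describes the shared memory
  only outside the write sets of the other cores, and \<open>post\<close> has to get by with
  that.\<close>

lemma par_phase:
  assumes B: "2 * B \<le> M" "1 \<le> B" and p: "1 \<le> p"
    and run: "\<And>S m c. \<lbrakk>Pre S m; c < p\<rbrakk> \<Longrightarrow>
       wp w P (\<lambda>tr s' m'. length tr = T \<and> confined (W c) (R c) tr \<and> cost B [] tr \<le> C c \<and> Q S m c s' m') [] (S c) m"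
    and sep: "block_disjoint p B W R"
    and post: "\<And>S m S' m'. \<lbrakk>Pre S m;
       \<And>c. c < p \<Longrightarrow> \<exists>mc. Q S m c (S' c) mc \<and> (\<forall>a. (\<forall>c'<p. c' \<noteq> c \<longrightarrow> a \<notin> W c') \<longrightarrow> m' a = mc a);
       \<And>a. (\<And>c. c < p \<Longrightarrow> a \<notin> W c) \<Longrightarrow> m' a = m a\<rbrakk> \<Longrightarrow> Post S' m'"
  shows "par p M B w Pre P T (\<Sum>c<p. C c) Post"
  unfolding par_def
proof (intro allI impI)
  fix Qs cfg
  assume pre: "(\<forall>c<p. code cfg c = foldl Seq P Qs) \<and> Pre (cores p cfg) (mem cfg)"
  let ?S = "cores p cfg" and ?m = "mem cfg"
  have "\<forall>c. \<exists>tr s' m'. c < p \<longrightarrow> solo w (P, ?S c, ?m) tr (Skip, s', m') \<and> length tr = T \<and>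
     confined (W c) (R c) tr \<and> cost B [] tr \<le> C c \<and> Q ?S ?m c s' m'"
    using run pre unfolding wp_def by fastforce
  then obtain tr s' m' where *: "\<And>c. c < p \<Longrightarrow> solo w (P, ?S c, ?m) (tr c) (Skip, s' c, m' c) \<and> length (tr c) = T \<and>
     confined (W c) (R c) (tr c) \<and> cost B [] (tr c) \<le> C c \<and> Q ?S ?m c (s' c) (m' c)"
    by metis
  define cfg' where "cfg' = (step p M B w ^^ T) cfg"
  have L: "(\<forall>c<p. code cfg' c = foldl Seq Skip Qs \<and> regs cfg' c = s' c \<and>
        (\<forall>a. (\<forall>c'<p. c' \<noteq> c \<longrightarrow> a \<notin> W c') \<longrightarrow> mem cfg' a = m' c a)) \<and>
        misses cfg' \<le> misses cfg + (\<Sum>c<p. cost B [] (tr c))"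
    unfolding cfg'_def
  \<comment> \<open>The charge starts from the empty list, a prefix of any cache content. Each phase
    thus pays anew for its first accesses, but the costs of phases simply add up.\<close>
  proof (rule lockstep[where R = R and pm = "\<lambda>_. ?m"])
    show "a div B \<noteq> a' div B" if "c < p" "c' < p" "c \<noteq> c'" "a \<in> W c" "a' \<in> W c' \<union> R c'" for c c' a a'
      using sep that unfolding block_disjoint_def by blast
    show "solo w (code cfg c, regs cfg c, ?m) (tr c) (foldl Seq Skip Qs, s' c, m' c)" if "c < p" for c
      using *[OF that] pre that solo_foldl_Seq by (auto simp: cores_def)
  qed (use B * in auto)
  have "Post (cores p cfg') (mem cfg')"
  proof (rule post)
    show "Pre ?S ?m" using pre by simp
    show "\<exists>mc. Q ?S ?m c (cores p cfg' c) mc \<and> (\<forall>a. (\<forall>c'<p. c' \<noteq> c \<longrightarrow> a \<notin> W c') \<longrightarrow> mem cfg' a = mc a)" if "c < p" for c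
      using *[OF that] L that by (intro exI[of _ "m' c"]) (auto simp: cores_def)
    show "mem cfg' a = ?m a" if "\<And>c. c < p \<Longrightarrow> a \<notin> W c" for a
    proof -
      have "mem cfg' a = m' 0 a" using L p that by auto
      also have "\<dots> = ?m a" using *[of 0] p that[of 0] by (auto intro: solo_unchanged)
      finally show ?thesis .
    qed
  qed
  moreover have "(\<Sum>c<p. cost B [] (tr c)) \<le> (\<Sum>c<p. C c)"
    using * by (intro sum_mono) auto
  ultimately show "reaches p M B w T (\<Sum>c<p. C c) Post Qs cfg"
    using L unfolding Let_def cfg'_def[symmetric] by auto
qed

section \<open>Prefix scans\<close>

fun seqs :: "com list \<Rightarrow> com" where
  "seqs [] = Skip"
| "seqs [c] = c"
| "seqs (c # d # cs) = Seq c (seqs (d # cs))"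

abbreviation (input) add_op (infix "[+]" 65) where "a [+] b \<equiv> Op Add a b"
abbreviation (input) sub_op (infix "[-]" 65) where "a [-] b \<equiv> Op Sub a b"
abbreviation (input) mul_op (infix "[*]" 65) where "a [*] b \<equiv> Op Mul a b"
abbreviation (input) div_op (infix "['/]" 65) where "a [/] b \<equiv> Op Div a b"
abbreviation (input) mod_op (infix "[%]" 65) where "a [%] b \<equiv> Op Mod a b"
abbreviation (input) less_op (infix "[<]" 65) where "a [<] b \<equiv> Op Lt a b"
abbreviation (input) eq_op (infix "[=]" 65) where "a [=] b \<equiv> Op Eq a b"

definition guard :: "expr \<Rightarrow> com \<Rightarrow> com" where
  "guard e c = Cond e c (idle (duration c))"

lemmas eval_simps = eval.simps apply_op.simps

definition slotx :: "nat \<Rightarrow> expr \<Rightarrow> expr" where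
  "slotx K e = Reg 4 [*] ((Const 8 [+] (Const K [*] Reg 4)) [+] e)"

definition scan_step :: "nat \<Rightarrow> expr \<Rightarrow> expr \<Rightarrow> expr \<Rightarrow> com" where
  "scan_step K f act next =
     Seq (guard act (seqs
       [Load 16 (slotx K (Reg 0 [-] Reg 15)),
        Assign 14 f,
        Store (slotx K (Reg 0)) (Reg 14)]))
     (Assign 15 next)"

text \<open>Register 15 is the distance \<open>d\<close>, doubled while below \<open>p\<close> and
  then halved down to 0. On the way down the active cores are those with \<open>Suc c\<close> an odd
  multiple of \<open>d\<close> greater than \<open>d\<close>: their partner \<open>c - d\<close>
  already has its full prefix. For \<open>Suc c = d\<close> the window starts at entry 0 and nothing
  is missing.\<close>

definition scan :: "nat \<Rightarrow> expr \<Rightarrow> com" where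
  "scan K f = seqs
     [Assign 15 (Const 1),
      While (Reg 15 [<] Reg 1)
        (scan_step K f
        (((Reg 0 [+] Const 1) [%] (Const 2 [*] Reg 15)) [=] Const 0)
        (Const 2 [*] Reg 15)),
      While (Const 0 [<] Reg 15)
        (scan_step K f
        ((((Reg 0 [+] Const 1) [%] (Const 2 [*] Reg 15)) [=] Reg 15) [*] (Reg 15 [<] (Reg 0 [+] Const 1)))
        (Reg 15 [/] Const 2))]"

text \<open>The postcondition of \<open>par\<close> cannot mention the initial state. Fixing that
  state first lets the rules for scans relate the final registers and memory to it.\<close>

lemma par_cases:
  "(\<And>S0 m0. Pre S0 m0 \<Longrightarrow> par p M B w (\<lambda>S m. S = S0 \<and> m = m0) P T C Post) \<Longrightarrow> par p M B w Pre P T C Post"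
  unfolding par_def by metis

lemma distinct_blocks: "a + B \<le> a' \<Longrightarrow> 0 < B \<Longrightarrow> a div B \<noteq> a' div (B::nat)"
proof -
  assume "a + B \<le> a'" "0 < B"
  then have "(a + B) div B \<le> a' div B" by (intro div_le_mono)
  then show ?thesis using \<open>0 < B\<close> by simp
qed

text \<open>
  The number \<open>gcd n (2 ^ e)\<close> of entries that the \<open>n\<close>-th partial result covers after \<open>e\<close> rounds of the
  up-sweep of the Brent-Kung scan.
\<close>

fun window :: "nat \<Rightarrow> nat \<Rightarrow> nat" where
  "window 0 n = 1"
| "window (Suc e) n = (if 2 ^ Suc e dvd n then 2 ^ Suc e else window e n)"

lemma window_dvd: "2 ^ e dvd n \<Longrightarrow> window e n = 2 ^ e"
  by (cases e) auto

lemma dvd_pow2_if_mod: "n mod 2 ^ Suc e = 2 ^ e \<Longrightarrow> (2::nat) ^ e dvd n"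
  by (metis dvd_mod_iff dvd_refl le_imp_power_dvd le_SucI order_refl)

lemma window_mod: "n mod 2 ^ Suc e = 2 ^ e \<Longrightarrow> e \<le> E \<Longrightarrow> window E n = 2 ^ e"
proof (induction E)
  case (Suc E)
  show ?case
  proof (cases "e = Suc E")
    case True
    then show ?thesis using window_dvd dvd_pow2_if_mod Suc.prems by blast
  next
    case False
    then have "\<not> 2 ^ Suc E dvd n"
      using Suc.prems by (metis dvd_imp_mod_0 dvd_trans le_SucE le_imp_power_dvd not_less_eq_eq power_eq_0_iff zero_neq_numeral)
    then show ?thesis using False Suc by simp
  qed
qed auto

text \<open>At distance \<open>2 ^ e\<close> either sweep has at most \<open>p div 2 ^ e\<close>
  active cores; the geometric sum keeps the accesses of a whole scan linear in
  \<open>p\<close>.\<close>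

lemma sum_div_pow2: "(\<Sum>e<k. n div 2 ^ e) \<le> 2 * (n::nat)"
proof (induction k arbitrary: n)
  case (Suc k)
  have "(\<Sum>e<Suc k. n div 2 ^ e) = n + (\<Sum>e<k. (n div 2) div 2 ^ e)"
    unfolding sum.lessThan_Suc_shift by (simp add: div_mult2_eq)
  then show ?case using Suc[of "n div 2"] by linarith
qed simp

lemma card_dvd_Suc: "0 < D \<Longrightarrow> card {c. c < n \<and> D dvd Suc c} \<le> n div D"
proof -
  assume D: "0 < D"
  have "{c. c < n \<and> D dvd Suc c} \<subseteq> (\<lambda>k. D * Suc k - 1) ` {..<n div D}"
  proof
    fix c assume "c \<in> {c. c < n \<and> D dvd Suc c}"
    then obtain k where k: "Suc c = D * k" "c < n" by (auto elim: dvdE)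
    then have "D * k \<le> n" by simp
    then have "k \<le> n div D" using D by (simp add: less_eq_div_iff_mult_less_eq mult.commute)
    moreover have "0 < k" using k(1) by (cases k) auto
    ultimately show "c \<in> (\<lambda>k. D * Suc k - 1) ` {..<n div D}"
      using k(1) by (intro image_eqI[of _ _ "k - 1"]) auto
  qed
  then have "card {c. c < n \<and> D dvd Suc c} \<le> card {..<n div D}"
    by (rule surj_card_le[rotated]) simp
  then show ?thesis by simp
qed

text \<open>The bound on \<open>2 ^ w\<close> excludes wrap-around: addresses of auxiliary words
  reach \<open>8 * (y * y)\<close> and packed pairs \<open>4 * (y * y)\<close>. The factor 1000 also
  covers all constants of the program and stays below \<open>2 ^ 10\<close>.\<close>

locale multicore =
  fixes p M B w y :: nat
  assumes p: "1 \<le> p" and B: "1 \<le> B" and MB: "2 * B \<le> M" and yMp: "M * p \<le> y"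
    and w: "1000 * (y * y) < 2 ^ w"
begin

lemma By: "2 * B * p \<le> y"
  using mult_le_mono1[OF MB, of p] yMp by linarith

lemma B_le: "2 * B \<le> y"
  using By p by (metis dual_order.trans mult.right_neutral mult_le_mono2)

lemma p_le: "2 * p \<le> y"
proof -
  have "1 * (2 * p) \<le> B * (2 * p)" using B by (rule mult_le_mono1)
  also have "B * (2 * p) = 2 * B * p" by simp
  finally show ?thesis using By by linarith
qed

lemma y_ge: "2 \<le> y" using p_le p by linarith

lemma w_pos: "0 < w" using w y_ge by (cases w) auto

lemma yy: "2 * y \<le> y * y" using y_ge by simp

abbreviation "phase \<equiv> par p M B w"

text \<open>
  Auxiliary words are at least \<open>y \<ge> 2 * B\<close> apart, so no two of them share a block. The kinds are 0 for
  the sums, 1 for the first bucket of a core, 2 for the output boundaries and 3 for the records by rank.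
\<close>

definition slot :: "nat \<Rightarrow> nat \<Rightarrow> nat" where
  "slot K i = y * (8 + K * y + i)"

lemma slot_bound: "K \<le> 3 \<Longrightarrow> i < y \<Longrightarrow> slot K i \<le> 8 * (y * y)"
proof -
  assume "K \<le> 3" "i < y"
  then have "8 + K * y + i \<le> 8 + 4 * y" using mult_le_mono1[of K 3 y] by linarith
  also have "\<dots> \<le> 8 * y" using y_ge by linarith
  finally have "slot K i \<le> y * (8 * y)" unfolding slot_def by (rule mult_le_mono2)
  then show ?thesis by simp
qed

lemma slot_inj: "i < y \<Longrightarrow> i' < y \<Longrightarrow> slot K i div B = slot K' i' div B \<Longrightarrow> K = K' \<and> i = i'"
proof (rule ccontr)
  assume i: "i < y" "i' < y" and eq: "slot K i div B = slot K' i' div B" and ne: "\<not> (K = K' \<and> i = i')"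
  have "8 + K * y + i \<noteq> 8 + K' * y + i'"
  proof
    assume "8 + K * y + i = 8 + K' * y + i'"
    then have "K * y + i = K' * y + i'" by simp
    then have "(K * y + i) div y = (K' * y + i') div y" "(K * y + i) mod y = (K' * y + i') mod y" by simp_all
    then show False using ne i by auto
  qed
  moreover have far: "y * g div B \<noteq> y * g' div B" if "g < g'" for g g'
  proof (rule distinct_blocks)
    have "y * g + y \<le> y * g'" using mult_le_mono2[of "Suc g" g' y] that by simp
    then show "y * g + B \<le> y * g'" using B_le by linarith
  qed (use B in simp)
  ultimately show False
    using eq far[of "8 + K * y + i" "8 + K' * y + i'"] far[of "8 + K' * y + i'" "8 + K * y + i"]
    unfolding slot_def by linarith
qed

lemma slot_low: "a < 7 * y \<Longrightarrow> slot K i div B \<noteq> a div B"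
  using distinct_blocks[of a B "slot K i"] B B_le mult_le_mono2[of 8 "8 + K * y + i" y]
  unfolding slot_def by fastforce

lemma slot_eq_iff: "i < y \<Longrightarrow> i' < y \<Longrightarrow> slot K i = slot K' i' \<longleftrightarrow> K = K' \<and> i = i'"
  using slot_inj by metis

lemma eval_Const: "n \<le> 1000 \<Longrightarrow> eval w s (Const n) = n"
proof -
  assume "n \<le> 1000"
  also have "1000 \<le> 1000 * (y * y)" using y_ge by simp
  finally show ?thesis using w by simp
qed

declare eval.simps(1) [simp del] eval_Const [simp]

lemma eval_slotx:
  assumes "s 4 = y" "eval w s e = i" "i < y" "K \<le> 3"
  shows "eval w s (slotx K e) = slot K i"
proof -
  have "K * y \<le> 3 * y" using assms by simp
  then have 1: "K * y < 2 ^ w" "8 + K * y < 2 ^ w" "8 + K * y + i < 2 ^ w" using w y_ge yy assms by linarith+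
  have 2: "y * (8 + K * y + i) < 2 ^ w" using slot_bound[OF assms(4,3)] w unfolding slot_def by linarith
  show ?thesis using assms 1 2 eval_Const[of 8 s] eval_Const[of K s] unfolding slotx_def slot_def by simp
qed

abbreviation keeps :: "registers \<Rightarrow> registers \<Rightarrow> bool" where
  "keeps r r' \<equiv> \<forall>i. i \<notin> {14, 15, 16} \<longrightarrow> r i = r' i"

abbreviation except_slots :: "nat \<Rightarrow> memory \<Rightarrow> memory \<Rightarrow> bool" where
  "except_slots K m m' \<equiv> \<forall>a. (\<forall>c<p. a \<noteq> slot K c) \<longrightarrow> m a = m' a"

abbreviation scanned :: "nat \<Rightarrow> (nat \<Rightarrow> nat) \<Rightarrow> nat \<Rightarrow> (nat \<Rightarrow> registers) \<Rightarrow> memory \<Rightarrow> assertion" where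
  "scanned K v d S0 m1 S m \<equiv> (\<forall>c<p. S c 14 = v c \<and> m (slot K c) = v c \<and> S c 15 = d \<and> keeps (S c) (S0 c)) \<and>
     except_slots K m m1"

text \<open>\<open>A\<close> singles out the cores that act in this round. Since
  \<open>c - d\<close> is inactive whenever \<open>c\<close> acts, the word that \<open>c\<close>
  reads is not being written, and reading and writing fit into one phase. The other cores run the
  padding and keep their value.\<close>

lemma par_scan_step:
  assumes S: "\<And>c. c < p \<Longrightarrow> S0 c 0 = c \<and> S0 c 4 = y \<and> S0 c 15 = d"
    and v: "\<And>c. c < p \<Longrightarrow> S0 c 14 = v c \<and> m1 (slot K c) = v c"
    and act: "\<And>c. c < p \<Longrightarrow> eval w (S0 c) act \<noteq> 0 \<longleftrightarrow> A c"
    and A: "\<And>c. c < p \<Longrightarrow> A c \<Longrightarrow> 0 < d \<and> d \<le> c \<and> \<not> A (c - d)"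
    and f: "\<And>c s. c < p \<Longrightarrow> A c \<Longrightarrow> s 14 = v c \<Longrightarrow> s 16 = v (c - d) \<Longrightarrow> eval w s f = v' c"
    and v': "\<And>c. c < p \<Longrightarrow> \<not> A c \<Longrightarrow> v' c = v c"
    and nxt: "\<And>s. s 15 = d \<Longrightarrow> eval w s nxt = d'"
    and K: "K \<le> 3"
  shows "phase (\<lambda>S m. S = S0 \<and> m = m1) (scan_step K f act nxt) 8 (\<Sum>c<p. if A c then 2 else 0)
     (scanned K v' d' S0 m1)"
proof (rule par_phase[where W = "\<lambda>c. if A c then {slot K c} else {}" and R = "\<lambda>c. if A c then {slot K (c - d)} else {}"
      and Q = "\<lambda>S m c s m'. s 14 = v' c \<and> m' (slot K c) = v' c \<and> s 15 = d' \<and> keeps s (S0 c)"])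
  note py = p_le
  show "block_disjoint p B (\<lambda>c. if A c then {slot K c} else {}) (\<lambda>c. if A c then {slot K (c - d)} else {})"
    unfolding block_disjoint_def
  proof (intro allI impI)
    fix c c' a a'
    assume *: "c < p" "c' < p" "c \<noteq> c'" "a \<in> (if A c then {slot K c} else {})"
      "a' \<in> (if A c' then {slot K c'} else {}) \<union> (if A c' then {slot K (c' - d)} else {})"
    then have "A c" "a = slot K c" "A c'" "a' = slot K c' \<or> a' = slot K (c' - d)" by (auto split: if_splits)
    moreover have "c \<noteq> c' - d" using A[of c'] calculation * by auto
    moreover have "c < y" "c' < y" "c' - d < y" using * py by auto
    ultimately show "a div B \<noteq> a' div B" using slot_inj[of c c' K K] slot_inj[of c "c' - d" K K] *(3) by auto
  qed
  fix S m c
  assume pre: "S = S0 \<and> m = m1" and c: "c < p"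
  show "wp w (scan_step K f act nxt)
        (\<lambda>tr s' m'. length tr = 8 \<and>
        confined (if A c then {slot K c} else {}) (if A c then {slot K (c - d)} else {}) tr \<and>
        cost B [] tr \<le> (if A c then 2 else 0) \<and>
        s' 14 = v' c \<and> m' (slot K c) = v' c \<and> s' 15 = d' \<and> keeps s' (S0 c))
        [] (S c) m"
  proof (cases "A c")
    case True
    have cd: "c - d < y" "c < y" "c < 2 ^ w" "c - d < 2 ^ w" using c py w y_ge yy by linarith+
    have 1: "eval w (S0 c) (slotx K (Reg 0 [-] Reg 15)) = slot K (c - d)"
      using S[OF c] cd K by (intro eval_slotx) auto
    have 2: "eval w (s(14 := u)) (slotx K (Reg 0)) = slot K c" if "s 4 = y" "s 0 = c" for u s
      using that cd K by (intro eval_slotx) auto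
    have 3: "eval w ((S0 c)(16 := m1 (slot K (c - d)))) f = v' c"
      using f[OF c True] v[OF c] v[of "c - d"] c by auto
    have act': "eval w (S0 c) act \<noteq> 0" using act[OF c] True by simp
    have 4: "eval w (s(14 := u)) nxt = d'" if "s 15 = d" for s u
      using nxt that by auto
    show ?thesis
      by (rule wp_sp)
        (use S[OF c] act' True in \<open>simp add: scan_step_def guard_def pre 1 2 3 4 cost_le_accesses[THEN order_trans]\<close>)
  next
    case False
    then have act': "eval w (S0 c) act = 0" using act[OF c] by simp
    show ?thesis
      by (rule wp_sp)
        (use S[OF c] v[OF c] act' False v'[OF c] in \<open>simp add: scan_step_def guard_def pre nxt\<close>)
  qed
next
  fix S m S' m'
  assume pre: "S = S0 \<and> m = m1"
    and Q: "\<And>c. c < p \<Longrightarrow> \<exists>mc. (S' c 14 = v' c \<and> mc (slot K c) = v' c \<and> S' c 15 = d' \<and>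
        keeps (S' c) (S0 c)) \<and>
        (\<forall>a. (\<forall>c'<p. c' \<noteq> c \<longrightarrow> a \<notin> (if A c' then {slot K c'} else {})) \<longrightarrow> m' a = mc a)"
    and F: "\<And>a. (\<And>c. c < p \<Longrightarrow> a \<notin> (if A c then {slot K c} else {})) \<Longrightarrow> m' a = m a"
  have inj: "slot K c = slot K c' \<longleftrightarrow> c = c'" if "c < p" "c' < p" for c c'
    using slot_eq_iff[of c c' K K] that p_le by auto
  show "scanned K v' d' S0 m1 S' m'"
  proof (intro conjI allI impI)
    fix c assume c: "c < p"
    obtain mc where mc: "mc (slot K c) = v' c" "\<forall>a. (\<forall>c'<p. c' \<noteq> c \<longrightarrow> a \<notin> (if A c' then {slot K c'} else {})) \<longrightarrow> m' a = mc a"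
      using Q[OF c] by blast
    then show "m' (slot K c) = v' c" using inj c by (metis empty_iff singletonD)
  next
    fix a assume "\<forall>c<p. a \<noteq> slot K c"
    then show "m' a = m1 a" using F pre by auto
  qed (use Q in blast)+
qed (use p B MB in auto)

section \<open>Correctness and cost of the scan\<close>

definition rounds :: nat where
  "rounds = (LEAST e. p \<le> 2 ^ e)"

lemma rounds: "p \<le> 2 ^ rounds" "i < rounds \<Longrightarrow> 2 ^ i < p" "2 ^ rounds \<le> 2 * p"
proof -
  show 1: "p \<le> 2 ^ rounds" unfolding rounds_def by (rule LeastI[of _ p]) (simp add: less_imp_le)
  show 2: "2 ^ i < p" if "i < rounds" for i using not_less_Least[of i "\<lambda>e. p \<le> 2 ^ e"] that unfolding rounds_def by simp
  show "2 ^ rounds \<le> 2 * p"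
  proof (cases rounds)
    case 0
    then show ?thesis using p by simp
  next
    case (Suc k)
    then show ?thesis using 2[of k] by simp
  qed
qed

lemma active_cost: "(\<And>c. c < p \<Longrightarrow> A c \<Longrightarrow> 2 ^ e dvd Suc c) \<Longrightarrow> (\<Sum>c<p. if A c then 2 else 0) \<le> 2 * (p div 2 ^ e)"
proof -
  assume A: "\<And>c. c < p \<Longrightarrow> A c \<Longrightarrow> 2 ^ e dvd Suc c"
  have "(\<Sum>c<p. if A c then 2 else 0) = (\<Sum>c | c < p \<and> A c. 2)"
    by (simp add: sum.If_cases Int_def)
  also have "\<dots> = 2 * card {c. c < p \<and> A c}" by simp
  also have "card {c. c < p \<and> A c} \<le> card {c. c < p \<and> 2 ^ e dvd Suc c}"
    using A by (intro card_mono) auto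
  also have "\<dots> \<le> p div 2 ^ e" by (rule card_dvd_Suc) simp
  finally show ?thesis by simp
qed

text \<open>\<open>G l u\<close> stands for the combination of the entries \<open>l..<u\<close>.
  Asking \<open>f\<close> to join adjacent nonempty intervals takes the place of associativity and
  fits both uses: sums as differences of prefix values, and maxima by \<open>Max\<close>, which is
  unspecified on an empty interval.\<close>

lemma par_scan:
  fixes G :: "nat \<Rightarrow> nat \<Rightarrow> nat"
  assumes S: "\<And>c. c < p \<Longrightarrow> S0 c 0 = c \<and> S0 c 1 = p \<and> S0 c 4 = y"
    and v: "\<And>c. c < p \<Longrightarrow> S0 c 14 = G c (Suc c) \<and> m1 (slot K c) = G c (Suc c)"
    and f: "\<And>l k u s. l < k \<Longrightarrow> k < u \<Longrightarrow> u \<le> p \<Longrightarrow> s 16 = G l k \<Longrightarrow> s 14 = G k u \<Longrightarrow> eval w s f = G l u"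
    and K: "K \<le> 3"
  shows "phase (\<lambda>S m. S = S0 \<and> m = m1) (scan K f) (20 * rounds + 15) (8 * p)
     (\<lambda>S m. (\<forall>c<p. S c 14 = G 0 (Suc c) \<and> keeps (S c) (S0 c)) \<and>
        except_slots K m m1)"
proof -
  define I where "I d V S m \<longleftrightarrow> (\<forall>c<p. S c 14 = V c \<and> m (slot K c) = V c \<and> S c 15 = d \<and>
       keeps (S c) (S0 c)) \<and> except_slots K m m1"
    for d and V :: "nat \<Rightarrow> nat" and S and m :: memory
  define Vu where "Vu e c = G (Suc c - window e (Suc c)) (Suc c)" for e c
  \<comment> \<open>The values after \<open>i\<close> rounds down: multiples of the current power of
    two hold full prefixes, all others still hold what the way up left.\<close>
  define Vd where "Vd i c = (if 2 ^ (Suc rounds - i) dvd Suc c then G 0 (Suc c) else Vu rounds c)" for i c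
  have w': "5 * p < 2 ^ w" using w yy p_le y_ge by linarith
  have c1: "\<And>s. eval w s (Const 0) = 0" "\<And>s. eval w s (Const 1) = 1" "\<And>s. eval w s (Const 2) = 2"
    by (rule eval_Const, simp)+
  have wsmall: "1 < (2::nat) ^ w" "\<And>u. u \<le> 5 * p \<Longrightarrow> u mod 2 ^ w = u" using w' p by auto
  let ?act1 = "((Reg 0 [+] Const 1) [%] (Const 2 [*] Reg 15)) [=] Const 0"
  let ?act2 = "(((Reg 0 [+] Const 1) [%] (Const 2 [*] Reg 15)) [=] Reg 15) [*] (Reg 15 [<] (Reg 0 [+] Const 1))"
  let ?up = "scan_step K f ?act1 (Const 2 [*] Reg 15)"
  let ?down = "scan_step K f ?act2 (Reg 15 [/] Const 2)"
  let ?end = "I (2 ^ (Suc rounds - Suc rounds) div 2) (Vd (Suc rounds))"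
  let ?cost = "(\<Sum>c<p. 0) + (4 * p + (\<Sum>i<Suc rounds. 2 * (p div 2 ^ (rounds - i))))"
  have md: "eval w s ((Reg 0 [+] Const 1) [%] (Const 2 [*] Reg 15)) = Suc c mod (2 * d)"
    if "s 0 = c" "s 15 = d" "c < p" "d \<le> 2 * p" for s c d
  proof -
    have "Suc c \<le> 5 * p" using that by simp
    then have "Suc c mod (2 * d) \<le> 5 * p" using mod_less_eq_dividend[of "Suc c" "2 * d"] by linarith
    then show ?thesis using that wsmall(2)[of "Suc c mod (2 * d)"] wsmall(2)[of "Suc c"] wsmall(2)[of "2 * d"] by (simp add: c1)
  qed
  have act1: "eval w s ?act1 \<noteq> 0 \<longleftrightarrow> 2 * d dvd Suc c" if "s 0 = c" "s 15 = d" "c < p" "d \<le> 2 * p" for s c d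
    using md[OF that] wsmall(1) by (auto simp: c1 eval.simps(3)[of _ _ Eq] simp flip: mod_eq_0_iff_dvd simp del: eval.simps(3))
  have act2: "eval w s ?act2 \<noteq> 0 \<longleftrightarrow> Suc c mod (2 * d) = d \<and> d < Suc c" if "s 0 = c" "s 15 = d" "c < p" "d \<le> 2 * p" for s c d
  proof -
    have "eval w s (Reg 0 [+] Const 1) = Suc c" using that wsmall(2)[of "Suc c"] by (simp add: c1)
    then show ?thesis using md[OF that] that wsmall(1) by (simp add: c1 eval.simps(3)[of _ _ Eq] eval.simps(3)[of _ _ Lt] eval.simps(3)[of _ _ Mul] del: eval.simps(3))
  qed
  have up: "phase (I (2 ^ e) (Vu e)) ?up 8 (2 * (p div 2 ^ e)) (I (2 ^ Suc e) (Vu (Suc e)))"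
    if e: "e < rounds" for e
  proof (rule par_cases)
    fix S m assume I: "I (2 ^ e) (Vu e) S m"
    have e': "2 ^ e < p" using rounds(2)[OF e] .
    have "phase (\<lambda>S' m'. S' = S \<and> m' = m) ?up 8
       (\<Sum>c<p. if 2 ^ Suc e dvd Suc c then 2 else 0)
       (scanned K (Vu (Suc e)) (2 ^ Suc e) S m)"
    proof (rule par_scan_step[where d = "2 ^ e" and v = "Vu e"])
      fix c assume c: "c < p"
      show "S c 0 = c \<and> S c 4 = y \<and> S c 15 = 2 ^ e" using I c S[OF c] by (auto simp: I_def)
      show "S c 14 = Vu e c \<and> m (slot K c) = Vu e c" using I c by (auto simp: I_def)
      show "eval w (S c) ?act1 \<noteq> 0 \<longleftrightarrow> 2 ^ Suc e dvd Suc c"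
        using act1[of "S c" c "2 ^ e"] I c S[OF c] e' by (auto simp: I_def)
      show "Vu (Suc e) c = Vu e c" if "\<not> 2 ^ Suc e dvd Suc c" using that by (simp add: Vu_def)
      assume A: "2 ^ Suc e dvd Suc c"
      then have le: "2 * 2 ^ e \<le> Suc c" using dvd_imp_le[OF A] by simp
      have le1: "0 < (2::nat) ^ e" by simp
      have le2: "2 ^ e \<le> c" using le le1 by linarith
      have eq: "Suc (c - 2 ^ e) = Suc c - 2 ^ e" using le2 by simp
      have nA: "\<not> 2 ^ Suc e dvd Suc (c - 2 ^ e)"
      proof
        assume "2 ^ Suc e dvd Suc (c - 2 ^ e)"
        then have "2 ^ Suc e dvd Suc c - (Suc c - 2 ^ e)" unfolding eq using A dvd_diff_nat by blast
        then have "(2::nat) ^ Suc e dvd 2 ^ e" using le2 by simp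
        then show False by (auto dest: dvd_imp_le)
      qed
      then show "0 < (2::nat) ^ e \<and> 2 ^ e \<le> c \<and> \<not> 2 ^ Suc e dvd Suc (c - 2 ^ e)" using le2 by simp
      have d1: "2 ^ e dvd Suc c" using A by (metis dvd_trans le_imp_power_dvd le_SucI order_refl)
      then have d2: "2 ^ e dvd Suc c - 2 ^ e" by (intro dvd_diff_nat) auto
      have V: "Vu e c = G (Suc c - 2 ^ e) (Suc c)" "Vu e (c - 2 ^ e) = G (Suc c - 2 * 2 ^ e) (Suc c - 2 ^ e)"
        "Vu (Suc e) c = G (Suc c - 2 * 2 ^ e) (Suc c)"
        using d1 d2 A by (simp_all add: Vu_def eq window_dvd mult_2)
      show "eval w s f = Vu (Suc e) c" if "s 14 = Vu e c" "s 16 = Vu e (c - 2 ^ e)" for s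
      proof -
        have "Suc c - 2 * 2 ^ e < Suc c - 2 ^ e" "Suc c - 2 ^ e < Suc c" using le le1 by linarith+
        then show ?thesis using that c unfolding V by (intro f[of "Suc c - 2 * 2 ^ e" "Suc c - 2 ^ e" "Suc c"]) auto
      qed
    next
      show "eval w s (Const 2 [*] Reg 15) = 2 ^ Suc e" if "s 15 = 2 ^ e" for s
        using that c1 wsmall(2)[of "2 * 2 ^ e"] e' by simp
    qed (rule K)
    then show "phase (\<lambda>S' m'. S' = S \<and> m' = m) ?up 8 (2 * (p div 2 ^ e)) (I (2 ^ Suc e) (Vu (Suc e)))"
    proof (rule par_weaken)
      show "(\<Sum>c<p. if 2 ^ Suc e dvd Suc c then 2 else 0) \<le> 2 * (p div 2 ^ e)"
        by (rule active_cost) (metis dvd_trans le_imp_power_dvd le_SucI order_refl)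
    qed (use I in \<open>auto simp: I_def\<close>)
  qed
  have down: "phase (I (2 ^ (Suc rounds - i) div 2) (Vd i)) ?down 8
     (2 * (p div 2 ^ (rounds - i))) (I (2 ^ (Suc rounds - Suc i) div 2) (Vd (Suc i)))"
    if i: "i < Suc rounds" for i
  proof (rule par_cases)
    fix S m assume I: "I (2 ^ (Suc rounds - i) div 2) (Vd i) S m"
    define e where "e = rounds - i"
    have e: "Suc rounds - i = Suc e" "e \<le> rounds" using i by (auto simp: e_def)
    have e': "(2::nat) ^ e \<le> 2 * p"
      using rounds(3) power_increasing[OF e(2), of "2::nat"] by linarith
    have I: "I (2 ^ e) (Vd i) S m" using I by (simp add: e)
    define A where "A c \<longleftrightarrow> Suc c mod 2 ^ Suc e = 2 ^ e \<and> 2 ^ e < Suc c" for c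
    have "phase (\<lambda>S' m'. S' = S \<and> m' = m) ?down 8
       (\<Sum>c<p. if A c then 2 else 0)
       (scanned K (Vd (Suc i)) (2 ^ e div 2) S m)"
    proof (rule par_scan_step[where d = "2 ^ e" and v = "Vd i"])
      fix c assume c: "c < p"
      show "S c 0 = c \<and> S c 4 = y \<and> S c 15 = 2 ^ e" using I c S[OF c] by (auto simp: I_def)
      show "S c 14 = Vd i c \<and> m (slot K c) = Vd i c" using I c by (auto simp: I_def)
      show "eval w (S c) ?act2 \<noteq> 0 \<longleftrightarrow> A c"
        using act2[of "S c" c "2 ^ e"] I c S[OF c] e' by (auto simp: I_def A_def)
      have V1: "Vd (Suc i) c = (if 2 ^ e dvd Suc c then G 0 (Suc c) else Vu rounds c)" for c
        by (simp add: Vd_def e_def)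
      have V0: "Vd i c = (if 2 ^ Suc e dvd Suc c then G 0 (Suc c) else Vu rounds c)" for c
        by (simp add: Vd_def e)
      have odd: "n mod 2 ^ Suc e = 2 ^ e" if n: "\<not> 2 ^ Suc e dvd n" "2 ^ e dvd n" for n :: nat
      proof -
        obtain k where k: "n = 2 ^ e * k" using n(2) by (elim dvdE)
        have "odd k" using n(1) k by auto
        then have "2 ^ e * (k mod 2) = (2::nat) ^ e" by (simp add: odd_iff_mod_2_eq_one)
        then show ?thesis unfolding k mult_mod_right by (simp add: mult.commute)
      qed
      have U: "Vu rounds c = G (Suc c - 2 ^ e) (Suc c)" if "Suc c mod 2 ^ Suc e = 2 ^ e" for c
        using window_mod[OF that e(2)] by (simp add: Vu_def)
      \<comment> \<open>The only odd multiple of \<open>2 ^ e\<close> among the inactive cores is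
        \<open>Suc c = 2 ^ e\<close>, whose window already begins at 0.\<close>
      show "Vd (Suc i) c = Vd i c" if "\<not> A c"
      proof (cases "2 ^ e dvd Suc c \<and> \<not> 2 ^ Suc e dvd Suc c")
        case True
        then have m: "Suc c mod 2 ^ Suc e = 2 ^ e" using odd by blast
        then have "Suc c = 2 ^ e" using that True by (auto simp: A_def dest!: dvd_imp_le)
        then show ?thesis using U[OF m] True by (auto simp: V1 V0)
      next
        case False
        moreover have "2 ^ Suc e dvd Suc c \<Longrightarrow> 2 ^ e dvd Suc c" by (metis dvd_trans le_imp_power_dvd le_SucI order_refl)
        ultimately show ?thesis by (auto simp: V1 V0)
      qed
      assume A: "A c"
      then have m: "Suc c mod 2 ^ Suc e = 2 ^ e" and lt: "2 ^ e < Suc c" by (auto simp: A_def)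
      have eq: "Suc (c - 2 ^ e) = Suc c - 2 ^ e" using lt by simp
      have ev: "2 ^ Suc e dvd Suc (c - 2 ^ e)" unfolding eq using m minus_mod_eq_mult_div[of "Suc c" "2 ^ Suc e"] by simp
      show "0 < (2::nat) ^ e \<and> 2 ^ e \<le> c \<and> \<not> A (c - 2 ^ e)" using lt ev unfolding A_def
        by (auto simp: dvd_eq_mod_eq_0)
      have n0: "\<not> 2 ^ Suc e dvd Suc c" using m by (auto simp: dvd_eq_mod_eq_0)
      have V: "Vd i c = G (Suc c - 2 ^ e) (Suc c)" "Vd i (c - 2 ^ e) = G 0 (Suc c - 2 ^ e)" "Vd (Suc i) c = G 0 (Suc c)"
        using n0 ev U[OF m] dvd_pow2_if_mod[OF m] unfolding V1 V0 eq by simp_all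
      show "eval w s f = Vd (Suc i) c" if "s 14 = Vd i c" "s 16 = Vd i (c - 2 ^ e)" for s
        using that lt c unfolding V by (intro f[of 0 "Suc c - 2 ^ e" "Suc c"]) auto
    next
      show "eval w s (Reg 15 [/] Const 2) = 2 ^ e div 2" if "s 15 = 2 ^ e" for s
        using that c1 wsmall(2)[of "2 ^ e div 2"] e' by simp
    qed (rule K)
    then show "phase (\<lambda>S' m'. S' = S \<and> m' = m) ?down 8
       (2 * (p div 2 ^ (rounds - i))) (I (2 ^ (Suc rounds - Suc i) div 2) (Vd (Suc i)))"
    proof (rule par_weaken)
      show "(\<Sum>c<p. if A c then 2 else 0) \<le> 2 * (p div 2 ^ (rounds - i))"
        unfolding e_def[symmetric] by (rule active_cost) (auto simp: A_def intro: dvd_pow2_if_mod)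
    qed (use I e in \<open>auto simp: I_def e_def\<close>)
  qed
  have U: "phase (I (2 ^ 0) (Vu 0)) (While (Reg 15 [<] Reg 1) ?up)
     (rounds * (8 + 2) + 1) (\<Sum>e<rounds. 2 * (p div 2 ^ e)) (I (2 ^ rounds) (Vu rounds))"
    using up
  proof (rule par_While[where I = "\<lambda>e. I (2 ^ e) (Vu e)"])
    show "eval w (S c) (Reg 15 [<] Reg 1) \<noteq> 0" if "i < rounds" "I (2 ^ i) (Vu i) S m" "c < p" for i S m c
      using that rounds(2)[of i] S[of c] wsmall w_pos by (auto simp: I_def)
    show "eval w (S c) (Reg 15 [<] Reg 1) = 0" if "I (2 ^ rounds) (Vu rounds) S m" "c < p" for S m c
      using that rounds(1) S[of c] wsmall w_pos by (auto simp: I_def)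
  qed
  have D: "phase (I (2 ^ (Suc rounds - 0) div 2) (Vd 0)) (While (Const 0 [<] Reg 15) ?down)
     (Suc rounds * (8 + 2) + 1) (\<Sum>i<Suc rounds. 2 * (p div 2 ^ (rounds - i))) ?end"
    using down
  proof (rule par_While[where I = "\<lambda>i. I (2 ^ (Suc rounds - i) div 2) (Vd i)"])
    show "eval w (S c) (Const 0 [<] Reg 15) \<noteq> 0" if "i < Suc rounds" "I (2 ^ (Suc rounds - i) div 2) (Vd i) S m" "c < p" for i S m c
      using that wsmall w_pos by (auto simp: I_def Suc_diff_le)
    show "eval w (S c) (Const 0 [<] Reg 15) = 0" if "I (2 ^ (Suc rounds - Suc rounds) div 2) (Vd (Suc rounds)) S m" "c < p" for S m c
      using that wsmall w_pos by (auto simp: I_def)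
  qed
  have A: "phase (\<lambda>S m. S = S0 \<and> m = m1) (Assign 15 (Const 1)) 1 (\<Sum>c<p. 0) (I (2 ^ 0) (Vu 0))"
  proof (rule par_phase[where W = "\<lambda>_. {}" and R = "\<lambda>_. {}" and Q = "\<lambda>S m c s m'. s = (S c)(15 := 1) \<and> m' = m"])
    show "wp w (Assign 15 (Const 1)) (\<lambda>tr s' m'. length tr = 1 \<and> confined {} {} tr \<and> cost B [] tr \<le> 0 \<and>
        s' = (S c)(15 := 1) \<and> m' = m) [] (S c) m" for S c m
      by (rule wp_sp) (use c1 in simp)
  qed (use p B MB v in \<open>auto simp: block_disjoint_def I_def Vu_def\<close>)
  \<comment> \<open>The way down begins at distance \<open>2 ^ rounds \<ge> p\<close>, where no core
    is active. No \<open>Suc c\<close> is a multiple of \<open>2 ^ Suc rounds\<close>, so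
    \<open>Vd 0\<close> claims no prefix yet.\<close>
  have V0: "Vd 0 c = Vu rounds c" if "c < p" for c
  proof -
    have "Suc c < 2 ^ Suc rounds" using that rounds(1) p by simp
    then have "\<not> 2 ^ Suc rounds dvd Suc c" by (metis dvd_imp_le not_le zero_less_Suc)
    then show ?thesis by (simp add: Vd_def)
  qed
  have U': "phase (I (2 ^ 0) (Vu 0)) (While (Reg 15 [<] Reg 1) ?up)
     (rounds * (8 + 2) + 1) (4 * p) (I (2 ^ (Suc rounds - 0) div 2) (Vd 0))"
  proof (rule par_weaken[OF U])
    show "I (2 ^ rounds) (Vu rounds) S m \<Longrightarrow> I (2 ^ (Suc rounds - 0) div 2) (Vd 0) S m" for S m
      using V0 by (auto simp: I_def)
    show "(\<Sum>e<rounds. 2 * (p div 2 ^ e)) \<le> 4 * p"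
      using sum_div_pow2[where k = rounds and n = p] unfolding sum_distrib_left[symmetric] by linarith
  qed
  have c2: "(\<Sum>i<Suc rounds. 2 * (p div 2 ^ (rounds - i))) \<le> 4 * p"
  proof -
    have "(\<Sum>i<Suc rounds. p div 2 ^ (rounds - i)) = (\<Sum>e<Suc rounds. p div 2 ^ e)"
      using sum.nat_diff_reindex[of "\<lambda>e. p div 2 ^ e" "Suc rounds"] by simp
    then show ?thesis using sum_div_pow2[where k = "Suc rounds" and n = p] unfolding sum_distrib_left[symmetric] by linarith
  qed
  have "phase (\<lambda>S m. S = S0 \<and> m = m1) (scan K f)
    (1 + 1 + ((rounds * (8 + 2) + 1) + 1 + (Suc rounds * (8 + 2) + 1)))
    ?cost ?end"
    unfolding scan_def seqs.simps by (intro par_Seq[OF A] par_Seq[OF U'] D)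
  moreover have "1 + 1 + ((rounds * (8 + 2) + 1) + 1 + (Suc rounds * (8 + 2) + 1)) = 20 * rounds + 15" by simp
  ultimately have F: "phase (\<lambda>S m. S = S0 \<and> m = m1) (scan K f) (20 * rounds + 15)
    ?cost ?end"
    by (simp only:)
  show ?thesis
    by (rule par_weaken[OF F]) (use c2 in \<open>auto simp: I_def Vd_def\<close>)
qed

end

section \<open>Counting and placing the buckets\<close>

text \<open>
  Registers: 5 to 8 hold \<open>y + 1\<close>, the numbers \<open>q\<close> of buckets and \<open>s\<close> of output words per core, and
  \<open>x * t\<close>; 9 and 23 loop bounds; 10 the total of the core; 11 the bucket number; 14 to 16 the value,
  the distance and the partner of a scan; 17 and 18 the offset and the rank of the current bucket;
  19 the output position; 21 and 22 the next source address and the rest of the current bucket.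
\<close>

definition bdx :: expr where
  "bdx = Reg 4 [+] (((Reg 11 [%] Reg 2) [*] Reg 3) [+] (Reg 11 [/] Reg 2))"

definition init_code :: com where
  "init_code = seqs
     [Assign 5 (Reg 4 [+] Const 1),
      Assign 6 (((Reg 2 [*] Reg 3) [/] Reg 1) [+] Const 1),
      Assign 7 ((Reg 4 [/] Reg 1) [+] Const 1),
      Assign 8 (Reg 2 [*] Reg 3)]"

text \<open>A nonempty bucket contributes its length plus \<open>y + 1\<close>. As all lengths sum
  to \<open>y\<close>, in radix \<open>y + 1\<close> the low digit is the offset and the high part
  the number of nonempty buckets, without carry, so one scan computes both.\<close>

definition count_body :: com where
  "count_body = Seq (guard (Reg 11 [<] Reg 8) (seqs
     [Load 12 bdx,
      Load 13 (bdx [+] Const 1),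
      Assign 12 (Reg 13 [-] Reg 12),
      Assign 10 (Reg 10 [+] (Reg 12 [+] ((Const 0 [<] Reg 12) [*] Reg 5)))]))
     (Assign 11 (Reg 11 [+] Const 1))"

text \<open>Memory beyond the input is arbitrary, so the notification word of kind 1 is cleared
  here; 0 is neutral for the later maximum.\<close>

definition count_code :: com where
  "count_code = Seq (seqs
     [Assign 10 (Const 0),
      Assign 11 (Reg 0 [*] Reg 6),
      Assign 9 (Reg 11 [+] Reg 6)])
     (Seq (While (Reg 11 [<] Reg 9) count_body)
     (seqs
      [Store (slotx 1 (Reg 0)) (Const 0),
       Store (slotx 0 (Reg 0)) (Reg 10),
       Assign 14 (Reg 10)]))"

text \<open>Register 19 receives the offset divided by \<open>s\<close>, rounded up. Kind 2 is
  written only for the first bucket of a column, whose offset is the boundary of an output bucket.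
  Record and notification pack pairs in radix \<open>y + 1\<close>: source address and length, rank
  and offset.\<close>

definition place_body :: com where
  "place_body = Seq (guard (Reg 11 [<] Reg 8) (seqs
     [Load 12 bdx,
      Load 13 (bdx [+] Const 1),
      Assign 13 (Reg 13 [-] Reg 12),
      guard ((Reg 11 [%] Reg 2) [=] Const 0)
        (Store (slotx 2 (Reg 11 [/] Reg 2)) (Reg 17)),
      Assign 19 ((Reg 17 [+] (Reg 7 [-] Const 1)) [/] Reg 7),
      guard (Const 0 [<] Reg 13) (seqs
        [Store (slotx 3 (Reg 18)) ((Reg 12 [*] Reg 5) [+] Reg 13),
        guard ((Reg 19 [*] Reg 7) [<] (Reg 17 [+] Reg 13))
        (Store (slotx 1 (Reg 19)) ((Reg 18 [*] Reg 5) [+] Reg 17)),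
        Assign 18 (Reg 18 [+] Const 1)]),
      Assign 17 (Reg 17 [+] Reg 13)]))
     (Assign 11 (Reg 11 [+] Const 1))"

definition place_code :: com where
  "place_code = Seq (seqs
     [Assign 17 ((Reg 14 [-] Reg 10) [%] Reg 5),
      Assign 18 ((Reg 14 [-] Reg 10) [/] Reg 5),
      Assign 11 (Reg 0 [*] Reg 6)])
     (While (Reg 11 [<] Reg 9) place_body)"

text \<open>For a \<open>Q\<close> that looks at memory only within \<open>W c\<close>: no other
  core writes there, so what holds in the private memory carries over to the shared one.\<close>

lemma par_phase_local:
  assumes B: "2 * B \<le> M" "1 \<le> B" and p: "1 \<le> p"
    and run: "\<And>S m c. \<lbrakk>Pre S m; c < p\<rbrakk> \<Longrightarrow>
       wp w P (\<lambda>tr s' m'. length tr = T \<and> confined (W c) (R c) tr \<and> cost B [] tr \<le> C c \<and> Q c s' m') [] (S c) m"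
    and sep: "block_disjoint p B W R"
    and loc: "\<And>c s' m' m''. c < p \<Longrightarrow> Q c s' m' \<Longrightarrow> (\<And>a. a \<in> W c \<Longrightarrow> m'' a = m' a) \<Longrightarrow> Q c s' m''"
    and post: "\<And>S m S' m'. \<lbrakk>Pre S m; \<And>c. c < p \<Longrightarrow> Q c (S' c) m';
       \<And>a. (\<And>c. c < p \<Longrightarrow> a \<notin> W c) \<Longrightarrow> m' a = m a\<rbrakk> \<Longrightarrow> Post S' m'"
  shows "par p M B w Pre P T (\<Sum>c<p. C c) Post"
proof (rule par_phase[OF B p _ sep, where Q = "\<lambda>S m. Q"])
  fix S m S' m'
  assume pre: "Pre S m"
    and Q: "\<And>c. c < p \<Longrightarrow> \<exists>mc. Q c (S' c) mc \<and> (\<forall>a. (\<forall>c'<p. c' \<noteq> c \<longrightarrow> a \<notin> W c') \<longrightarrow> m' a = mc a)"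
    and F: "\<And>a. (\<And>c. c < p \<Longrightarrow> a \<notin> W c) \<Longrightarrow> m' a = m a"
  show "Post S' m'"
  proof (rule post[OF pre _ F])
    fix c assume c: "c < p"
    obtain mc where mc: "Q c (S' c) mc" "\<forall>a. (\<forall>c'<p. c' \<noteq> c \<longrightarrow> a \<notin> W c') \<longrightarrow> m' a = mc a"
      using Q[OF c] by blast
    have "a \<notin> W c'" if "c' < p" "c' \<noteq> c" "a \<in> W c" for a c'
      using sep c that unfolding block_disjoint_def by blast
    then show "Q c (S' c) m'" using loc[OF c mc(1)] mc(2) by blast
  qed
qed (rule run)

lemma confined_mono: "confined W R tr \<Longrightarrow> W \<subseteq> W' \<Longrightarrow> R \<subseteq> R' \<Longrightarrow> confined W' R' tr"
  unfolding confined_def by blast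

text \<open>Bucket \<open>k\<close> belongs to list \<open>k mod x\<close> and column
  \<open>k div x\<close>. The row-major table of boundaries, stored from address \<open>y\<close>,
  therefore describes it at index \<open>k mod x * t + k div x\<close>, and the entry after that
  gives its end.\<close>

locale gathering = multicore +
  fixes x t :: nat and src len :: "nat \<Rightarrow> nat" and m0 :: memory
  assumes n_le: "x * t \<le> y"
    and bd: "k < x * t \<Longrightarrow> m0 (y + (k mod x * t + k div x)) = src k \<and> m0 (Suc (y + (k mod x * t + k div x))) = src k + len k"
    and src_le: "k < x * t \<Longrightarrow> src k + len k \<le> y"
    and sum_len: "(\<Sum>k<x * t. len k) = y"
begin

section \<open>Offsets, ranks and the division of work among the cores\<close>

abbreviation n :: nat where "n \<equiv> x * t"

definition off :: "nat \<Rightarrow> nat" where "off k = (\<Sum>i<k. len i)"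
definition rank :: "nat \<Rightarrow> nat" where "rank k = (\<Sum>i<k. if 0 < len i then 1 else 0)"
definition PK :: "nat \<Rightarrow> nat" where "PK k = off k + (y + 1) * rank k"
definition q :: nat where "q = n div p + 1"
text \<open>The increment gives \<open>p * s > y\<close> strictly: even position \<open>y\<close>
  lies in the range of some core, as the output boundaries with indices up to
  \<open>t \<le> y\<close> require. With \<open>M * p \<le> y\<close> it also gives
  \<open>s \<ge> 2 * B + 1\<close>.\<close>

definition s :: nat where "s = y div p + 1"
definition lo :: "nat \<Rightarrow> nat" where "lo c = min (c * q) n"

definition base :: "nat \<Rightarrow> registers \<Rightarrow> bool" where
  "base c r \<longleftrightarrow> r 0 = c \<and> r 1 = p \<and> r 2 = x \<and> r 3 = t \<and> r 4 = y \<and> r 5 = y + 1 \<and> r 6 = q \<and> r 7 = s \<and> r 8 = n"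

lemma baseD:
  assumes "base c r"
  shows "r 0 = c" "r 1 = p" "r 2 = x" "r 3 = t" "r 4 = y" "r 5 = y + 1" "r 6 = q" "r 7 = s" "r 8 = n"
  using assms by (auto simp: base_def)

definition input :: "memory \<Rightarrow> bool" where "input m \<longleftrightarrow> (\<forall>a<3 * y. m a = m0 a)"

lemma xt_pos: "0 < x" "0 < t"
  using sum_len y_ge by (auto intro!: Nat.gr0I)

lemma off_Suc [simp]: "off (Suc k) = off k + len k" by (simp add: off_def)
lemma rank_Suc: "rank (Suc k) = rank k + (if 0 < len k then 1 else 0)" by (simp add: rank_def)
lemma off_0 [simp]: "off 0 = 0" by (simp add: off_def)
lemma off_n: "off n = y" using sum_len by (simp add: off_def)

lemma off_mono: "k \<le> k' \<Longrightarrow> off k \<le> off k'"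
  by (rule lift_Suc_mono_le[of off]) auto

lemma rank_mono: "k \<le> k' \<Longrightarrow> rank k \<le> rank k'"
  by (rule lift_Suc_mono_le[of rank]) (auto simp: rank_Suc)

lemma rank_le: "rank k \<le> k"
  by (induction k) (auto simp: rank_def)

lemma PK_mono: "k \<le> k' \<Longrightarrow> PK k \<le> PK k'"
  unfolding PK_def by (intro add_mono mult_le_mono off_mono rank_mono) auto

lemma PK_Suc: "PK (Suc k) = PK k + (len k + (if 0 < len k then y + 1 else 0))"
  by (simp add: PK_def rank_Suc)

lemma off_le: "k \<le> n \<Longrightarrow> off k \<le> y"
  using off_mono[of k n] off_n by simp

lemma PK_le: "k \<le> n \<Longrightarrow> PK k \<le> 4 * (y * y)"
proof -
  assume k: "k \<le> n"
  have "(y + 1) * rank k \<le> (2 * y) * y"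
    using rank_le[of k] k n_le y_ge by (intro mult_le_mono) auto
  then show ?thesis using off_le[OF k] yy unfolding PK_def by linarith
qed

lemma q_bounds: "n < p * q" "c < p \<Longrightarrow> c * q + q \<le> 2 * y"
proof -
  show "n < p * q" unfolding q_def using p dividend_less_times_div[of p n] by simp
  assume "c < p"
  then have "c * q + q \<le> p * q" using mult_le_mono1[of "Suc c" p q] by simp
  also have "\<dots> \<le> n + p" unfolding q_def by simp
  finally show "c * q + q \<le> 2 * y" using n_le p_le by linarith
qed

lemma s_bounds: "y < p * s" "c < p \<Longrightarrow> c * s + s \<le> 2 * y" "2 * B + 1 \<le> s"
proof -
  show "y < p * s" unfolding s_def using p dividend_less_times_div[of p y] by simp
  have "M \<le> y div p" using yMp p by (simp add: less_eq_div_iff_mult_less_eq)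
  then show "2 * B + 1 \<le> s" using MB by (simp add: s_def)
  assume "c < p"
  then have "c * s + s \<le> p * s" using mult_le_mono1[of "Suc c" p s] by simp
  also have "\<dots> \<le> y + p" unfolding s_def by simp
  finally show "c * s + s \<le> 2 * y" using p_le by linarith
qed

lemma lo_0: "lo 0 = 0" and lo_p: "lo p = n" and lo_mono: "c \<le> c' \<Longrightarrow> lo c \<le> lo c'" and lo_le: "lo c \<le> n"
  using q_bounds(1) by (auto simp: lo_def min_def dest: mult_le_mono1[of c c' q])

lemma sum_lo: "(\<Sum>c<p. lo (Suc c) - lo c) = n"
proof -
  have "(\<Sum>c<k. lo (Suc c) - lo c) = lo k" for k
    by (induction k) (auto simp: lo_0 lo_mono)
  then show ?thesis by (simp add: lo_p)
qed

abbreviation adr :: "nat \<Rightarrow> nat" where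
  "adr k \<equiv> y + (k mod x * t + k div x)"

lemma index_less: "k < n \<Longrightarrow> k mod x * t + k div x < n"
proof -
  assume k: "k < n"
  have "k div x < t" using k by (simp add: less_mult_imp_div_less mult.commute)
  moreover have "Suc (k mod x) * t \<le> x * t" using xt_pos by (intro mult_le_mono1) (simp add: Suc_leI)
  ultimately show ?thesis by simp
qed

lemma eval_bdx:
  assumes "r 2 = x" "r 3 = t" "r 4 = y" "r 11 = k" "k < n"
  shows "eval w r bdx = adr k" "eval w r (bdx [+] Const 1) = Suc (adr k)"
proof -
  have "k mod x \<le> k" "k div x \<le> k" by simp_all
  then have "k mod x < 2 ^ w" "k mod x * t < 2 ^ w" "k div x < 2 ^ w" "k mod x * t + k div x < 2 ^ w"
     "adr k < 2 ^ w" "Suc (adr k) < 2 ^ w"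
    using index_less[OF assms(5)] n_le yy y_ge assms(5) w by linarith+
  then show "eval w r bdx = adr k" "eval w r (bdx [+] Const 1) = Suc (adr k)"
    using assms by (simp_all add: bdx_def)
qed

section \<open>Setup and the counting phase\<close>

abbreviation started :: assertion where
  "started S m \<equiv> (\<forall>c<p. S c 0 = c \<and> S c 1 = p \<and> S c 2 = x \<and> S c 3 = t \<and> S c 4 = y) \<and> m = m0"

lemma par_init:
  "phase started
     init_code 7 (\<Sum>c<p. 0) (\<lambda>S m. (\<forall>c<p. base c (S c)) \<and> m = m0)"
proof (rule par_phase[where W = "\<lambda>_. {}" and R = "\<lambda>_. {}" and Q = "\<lambda>S m c s' m'. base c s'"])
  fix S :: "nat \<Rightarrow> registers" and m :: memory and c
  assume "started S m" and c: "c < p"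
  then have r: "S c 0 = c" "S c 1 = p" "S c 2 = x" "S c 3 = t" "S c 4 = y" by auto
  have "n div p \<le> n" "y div p \<le> y" by simp_all
  then have "n < 2 ^ w" "y + 1 < 2 ^ w" "n div p < 2 ^ w" "y div p < 2 ^ w" "n div p + 1 < 2 ^ w" "y div p + 1 < 2 ^ w"
    using w n_le yy y_ge by linarith+
  then show "wp w init_code (\<lambda>tr s' m'. length tr = 7 \<and> confined {} {} tr \<and> cost B [] tr \<le> 0 \<and> base c s') [] (S c) m"
    by (intro wp_sp) (use r in \<open>simp add: init_code_def base_def q_def s_def\<close>)
qed (use p B MB in \<open>auto simp: block_disjoint_def\<close>)

text \<open>For the sake of equal timing every core makes exactly \<open>q\<close> iterations;
  \<open>min k n\<close> freezes the bookkeeping in those beyond the last bucket. Stating the total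
  as \<open>r 10 + PK j\<close> avoids truncated subtraction.\<close>

lemma sp_count_body:
  assumes r: "base c r" "r 11 = k" "k < 2 * y" "r 10 + PK j = PK (min k n)" and m: "input m"
  shows "sp w count_body (\<lambda>tr' r' m'. (\<exists>ac. tr' = tr @ ac \<and> length ac = 10 \<and> confined {} {y..<3 * y} ac \<and>
        accesses ac \<le> 2 * (min (Suc k) n - min k n)) \<and>
        m' = m \<and> base c r' \<and> r' 9 = r 9 \<and> r' 11 = Suc k \<and> r' 10 + PK j = PK (min (Suc k) n)) tr r m"
proof (cases "k < n")
  case True
  note b = r(1)[unfolded base_def]
  have bl: "Suc (adr k) < 3 * y"
    using index_less[OF True] n_le y_ge by linarith
  have mm: "m (adr k) = src k" "m (Suc (adr k)) = src k + len k"
    using m bd[OF True] bl by (auto simp: input_def)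
  have P: "PK (Suc k) \<le> 4 * (y * y)" using True by (intro PK_le) simp
  have r10: "r 10 \<le> PK k" "r 10 + PK j = PK k" using r(4) True by (auto simp: min_def)
  have lk: "len k \<le> y" using src_le[OF True] by simp
  have ov: "len k < 2 ^ w" "y + 1 < 2 ^ w" "len k + (y + 1) < 2 ^ w" "Suc k < 2 ^ w"
     "r 10 + (len k + (if 0 < len k then y + 1 else 0)) < 2 ^ w"
    using w lk yy y_ge r(3) r10 P PK_Suc[of k] by linarith+
  note ev = eval_bdx[where r = r, OF _ _ _ r(2) True] eval_bdx[where r = "r(12 := u)" for u, OF _ _ _ _ True]
  show ?thesis
    using True b r(2) ev mm bl ov r10 PK_Suc[of k] w_pos
    by (auto simp add: count_body_def guard_def base_def min_def)
next
  case False
  have "Suc k < 2 ^ w" using w yy y_ge r(3) by linarith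
  with False show ?thesis
    using r w_pos by (simp add: count_body_def guard_def base_def min_def)
qed

abbreviation counted_by :: "nat \<Rightarrow> registers \<Rightarrow> memory \<Rightarrow> bool" where
  "counted_by c r m \<equiv> base c r \<and> r 9 = c * q + q \<and> r 10 + PK (lo c) = PK (lo (Suc c)) \<and> r 14 = r 10 \<and> m (slot 0 c) = r 10 \<and> m (slot 1 c) = 0"

abbreviation counted :: assertion where
  "counted S m \<equiv> (\<forall>c<p. counted_by c (S c) m) \<and> input m"

lemma par_count:
  "phase (\<lambda>S m. (\<forall>c<p. base c (S c)) \<and> m = m0) count_code (12 * q + 13) (\<Sum>c<p. 2 * (lo (Suc c) - lo c) + 2)
    counted"
proof (rule par_phase_local[where W = "\<lambda>c. {slot 0 c, slot 1 c}" and R = "\<lambda>_. {y..<3 * y}" and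
    Q = "counted_by"])
  show "block_disjoint p B (\<lambda>c. {slot 0 c, slot 1 c}) (\<lambda>_. {y..<3 * y})"
    unfolding block_disjoint_def
  proof (intro allI impI)
    fix c c' a a'
    assume *: "c < p" "c' < p" "c \<noteq> c'" "a \<in> {slot 0 c, slot 1 c}" "a' \<in> {slot 0 c', slot 1 c'} \<union> {y..<3 * y}"
    then have "c < y" "c' < y" using p_le by auto
    then have 1: "slot K c div B \<noteq> slot K' c' div B" for K K' using slot_inj[of c c' K K'] *(3) by blast
    obtain K where K: "a = slot K c" using *(4) by blast
    from *(5) consider K' where "a' = slot K' c'" | "a' < 7 * y" by fastforce
    then show "a div B \<noteq> a' div B"
      using 1[of K] slot_low[of a' K c] unfolding K by cases auto
  qed
  fix S :: "nat \<Rightarrow> registers" and m :: memory and c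
  assume pre: "(\<forall>c<p. base c (S c)) \<and> m = m0" and c: "c < p"
  define r where "r = S c"
  have r: "base c r" using pre c by (simp add: r_def)
  have m: "input m" using pre by (simp add: input_def)
  have cy: "c < y" using c p_le by linarith
  define I where "I i tr r m' \<longleftrightarrow> length tr = 6 + i * 12 \<and> confined {} {y..<3 * y} tr \<and>
     accesses tr \<le> 2 * (min (c * q + i) n - lo c) \<and> m' = m \<and> base c r \<and> r 9 = c * q + q \<and> r 11 = c * q + i \<and>
     r 10 + PK (lo c) = PK (min (c * q + i) n)" for i tr r m'
  define Q where "Q tr s' m' \<longleftrightarrow> length tr = 12 * q + 13 \<and> confined {slot 0 c, slot 1 c} {y..<3 * y} tr \<and>
      cost B [] tr \<le> 2 * (lo (Suc c) - lo c) + 2 \<and>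
      counted_by c s' m'" for tr s' m'
  have qb: "c * q + q \<le> 2 * y" using q_bounds(2)[OF c] .
  have ov: "c * q < 2 ^ w" "c * q + q < 2 ^ w" using qb w yy y_ge by linarith+
  have L: "wp w (While (Reg 11 [<] Reg 9) count_body)
     (\<lambda>tr r m. wp w (seqs [Store (slotx 1 (Reg 0)) (Const 0), Store (slotx 0 (Reg 0)) (Reg 10), Assign 14 (Reg 10)])
        Q (tr @ [None]) r m) tr r m" if "I 0 tr r m" for tr r
  proof (rule wp_While[where N = q and I = I])
    fix i tr r m' assume i: "i < q" and I: "I i tr r m'"
    have 1: "eval w r (Reg 11 [<] Reg 9) \<noteq> 0" using I i w_pos by (auto simp: I_def)
    have mn: "lo c \<le> min (c * q + i) n" by (simp add: lo_def)
    have "sp w count_body (\<lambda>tr' r' m''. (\<exists>ac. tr' = (tr @ [None]) @ ac \<and> length ac = 10 \<and> confined {} {y..<3 * y} ac \<and>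
        accesses ac \<le> 2 * (min (Suc (c * q + i)) n - min (c * q + i) n)) \<and>
        m'' = m' \<and> base c r' \<and> r' 9 = r 9 \<and> r' 11 = Suc (c * q + i) \<and> r' 10 + PK (lo c) = PK (min (Suc (c * q + i)) n)) (tr @ [None]) r m'"
      using I i m qb by (intro sp_count_body) (auto simp: I_def)
    then have "sp w count_body (\<lambda>tr. I (Suc i) (tr @ [None])) (tr @ [None]) r m'"
      by (rule sp_mono) (use I mn in \<open>auto simp: I_def\<close>)
    with 1 show "eval w r (Reg 11 [<] Reg 9) \<noteq> 0 \<and> wp w count_body (\<lambda>tr. I (Suc i) (tr @ [None])) (tr @ [None]) r m'"
      by (simp add: wp_sp)
  next
    fix tr r m' assume I: "I q tr r m'"
    have 1: "eval w r (Reg 11 [<] Reg 9) = 0" using I by (auto simp: I_def)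
    have b: "r 0 = c" "r 4 = y" using I by (auto simp: I_def base_def)
    have ne: "slot 0 c \<noteq> slot 1 c" using slot_eq_iff[OF cy cy] by simp
    have lo: "lo (Suc c) = min (c * q + q) n" by (simp add: lo_def add.commute)
    have ev: "eval w r (slotx 1 (Reg 0)) = slot 1 c" "eval w r (slotx 0 (Reg 0)) = slot 0 c"
      by (rule eval_slotx; use b cy in simp)+
    have "sp w (seqs [Store (slotx 1 (Reg 0)) (Const 0), Store (slotx 0 (Reg 0)) (Reg 10), Assign 14 (Reg 10)])
        Q ((tr @ [None]) @ [None]) r m'"
    proof -
      have cst: "cost B [] (tr @ u) \<le> 2 * (lo (Suc c) - lo c) + accesses u" for u
        using I cost_le_accesses[of B "[]" "tr @ u"] unfolding I_def lo[symmetric] by simp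
      then show ?thesis
        using I ne ev confined_mono[of "{}" "{y..<3 * y}" tr "{slot 0 c, slot 1 c}" "{y..<3 * y}"]
        unfolding I_def lo[symmetric] by (simp add: Q_def base_def del: cost_append cost.simps) (rule order_trans[OF cst], simp)
    qed
    with 1 show "eval w r (Reg 11 [<] Reg 9) = 0 \<and>
      wp w (seqs [Store (slotx 1 (Reg 0)) (Const 0), Store (slotx 0 (Reg 0)) (Reg 10), Assign 14 (Reg 10)]) Q ((tr @ [None]) @ [None]) r m'"
      by (simp add: wp_sp)
  qed (rule that)
  have "sp w (seqs [Assign 10 (Const 0), Assign 11 (Reg 0 [*] Reg 6), Assign 9 (Reg 11 [+] Reg 6)])
     (\<lambda>tr r m'. I 0 (tr @ [None]) r m' \<and> m' = m) [] r m"
    using r ov by (simp add: I_def base_def lo_def)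
  from wp_sp[OF this] have "wp w count_code Q [] r m"
    unfolding count_code_def
  proof (intro wp_Seq, elim wp_mono)
    fix tr r m' assume *: "I 0 (tr @ [None]) r m' \<and> m' = m"
    show "wp w (Seq (While (Reg 11 [<] Reg 9) count_body)
       (seqs [Store (slotx 1 (Reg 0)) (Const 0), Store (slotx 0 (Reg 0)) (Reg 10), Assign 14 (Reg 10)]))
        Q (tr @ [None]) r m'"
      using L[OF conjunct1[OF *[unfolded conjunct2[OF *]]]] unfolding conjunct2[OF *] by (rule wp_Seq)
  qed
  then show "wp w count_code
        (\<lambda>tr s' m'. length tr = 12 * q + 13 \<and> confined {slot 0 c, slot 1 c} {y..<3 * y} tr \<and>
        cost B [] tr \<le> 2 * (lo (Suc c) - lo c) + 2 \<and>
        counted_by c s' m') [] (S c) m"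
    unfolding Q_def r_def .
next
  fix S m S' m'
  assume pre: "(\<forall>c<p. base c (S c)) \<and> m = m0"
    and Q: "\<And>c. c < p \<Longrightarrow> counted_by c (S' c) m'"
    and F: "\<And>a. (\<And>c. c < p \<Longrightarrow> a \<notin> {slot 0 c, slot 1 c}) \<Longrightarrow> m' a = m a"
  have "input m'" unfolding input_def
  proof (intro allI impI)
    fix a assume a: "a < 3 * y"
    then have "a \<notin> {slot 0 c, slot 1 c}" for c using slot_low[of a 0 c] slot_low[of a 1 c] by auto
    then show "m' a = m0 a" using F pre by blast
  qed
  then show "counted S' m'" using Q by blast
qed (use p B MB in auto)

text \<open>
  The first core whose output range begins at or after the offset of \<open>k\<close>.
\<close>

definition start :: "nat \<Rightarrow> nat" where "start k = (off k + (s - 1)) div s"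

definition notifies :: "nat \<Rightarrow> bool" where "notifies k \<longleftrightarrow> 0 < len k \<and> start k * s < off k + len k"

definition target :: "nat \<Rightarrow> nat set" where
  "target k = (if x dvd k then {slot 2 (k div x)} else {}) \<union> (if 0 < len k then {slot 3 (rank k)} else {}) \<union>
     (if notifies k then {slot 1 (start k)} else {})"

definition placed :: "nat \<Rightarrow> memory \<Rightarrow> bool" where
  "placed k m \<longleftrightarrow> (x dvd k \<longrightarrow> m (slot 2 (k div x)) = off k) \<and>
     (0 < len k \<longrightarrow> m (slot 3 (rank k)) = src k * (y + 1) + len k) \<and>
     (notifies k \<longrightarrow> m (slot 1 (start k)) = rank k * (y + 1) + off k)"

lemma placed_cong: "placed k m \<Longrightarrow> (\<And>a. a \<in> target k \<Longrightarrow> m' a = m a) \<Longrightarrow> placed k m'"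
  by (simp add: placed_def target_def)

lemma s_pos: "0 < s" using s_bounds(3) by simp

lemma off_le_start: "off k \<le> start k * s"
proof -
  have "start k * s + (off k + (s - 1)) mod s = off k + (s - 1)" unfolding start_def by (rule div_mult_mod_eq)
  moreover have "(off k + (s - 1)) mod s \<le> s - 1" using s_pos by (simp add: less_Suc_eq_le[symmetric])
  ultimately show ?thesis by linarith
qed

lemma start_le: "start k * s \<le> off k + (s - 1)"
  unfolding start_def by (rule div_times_less_eq_dividend)

lemma start_less: "k < n \<Longrightarrow> notifies k \<Longrightarrow> start k < p"
proof -
  assume k: "k < n" and "notifies k"
  then have "start k * s < off (Suc k)" by (simp add: notifies_def)
  also have "\<dots> \<le> y" using k by (intro off_le) simp
  also have "\<dots> < p * s" by (rule s_bounds)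
  finally show ?thesis by simp
qed

text \<open>Within each kind the indices differ: column numbers because both buckets head a column,
  ranks because a nonempty bucket raises the rank, and notified cores because \<open>i < j\<close>
  and \<open>notifies i\<close> give
  \<open>start i * s < off (Suc i) \<le> off j \<le> start j * s\<close>. Hence a core is notified
  at most once.\<close>

lemma target_disjoint:
  assumes kn: "k < n" "k' < n" "k \<noteq> k'" "a \<in> target k" "a' \<in> target k'"
  shows "a div B \<noteq> a' div B"
proof -
  have kx: "k div x \<noteq> k' div x" if "x dvd k" "x dvd k'" using that kn(3) by (metis dvd_div_mult_self)
  have rk: "rank i < rank j" if "i < j" "0 < len i" for i j
    using rank_mono[of "Suc i" j] that by (simp add: rank_Suc)
  have st: "start i < start j" if "i < j" "notifies i" for i j
  proof -
    have "start i * s < off (Suc i)" using that by (simp add: notifies_def)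
    also have "\<dots> \<le> off j" using that by (intro off_mono) simp
    also have "\<dots> \<le> start j * s" by (rule off_le_start)
    finally show ?thesis by simp
  qed
  have 1: "k div x < y" "k' div x < y" "rank k < y" "rank k' < y"
    using kn n_le rank_le[of k] rank_le[of k'] div_le_dividend[of k x] div_le_dividend[of k' x] by linarith+
  have 2: "notifies k \<Longrightarrow> start k < y" "notifies k' \<Longrightarrow> start k' < y"
    using start_less[of k] start_less[of k'] kn p_le by fastforce+
  have 3: "rank k \<noteq> rank k'" if "0 < len k" "0 < len k'"
    using rk[of k k'] rk[of k' k] that kn(3) by (cases "k < k'") auto
  have 4: "start k \<noteq> start k'" if "notifies k" "notifies k'"
    using st[of k k'] st[of k' k] that kn(3) by (cases "k < k'") auto
  obtain K i where a: "a = slot K i" "i < y"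
    "(K = 2 \<and> i = k div x \<and> x dvd k) \<or> (K = 3 \<and> i = rank k \<and> 0 < len k) \<or> (K = 1 \<and> i = start k \<and> notifies k)"
    using kn(4) 1 2 by (auto simp: target_def split: if_splits)
  obtain K' i' where a': "a' = slot K' i'" "i' < y"
    "(K' = 2 \<and> i' = k' div x \<and> x dvd k') \<or> (K' = 3 \<and> i' = rank k' \<and> 0 < len k') \<or> (K' = 1 \<and> i' = start k' \<and> notifies k')"
    using kn(5) 1 2 by (auto simp: target_def split: if_splits)
  show ?thesis
    using slot_inj[OF a(2) a'(2), of K K'] a(1,3) a'(1,3) kx 3 4 by auto
qed

lemma sp_place_body:
  assumes r: "base c r" "r 11 = k" "k < 2 * y" "r 17 = off (min k n)" "r 18 = rank (min k n)"
    and m: "input m" and pl: "\<And>k'. j \<le> k' \<Longrightarrow> k' < min k n \<Longrightarrow> placed k' m"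
  shows "sp w place_body (\<lambda>tr' r' m'. (\<exists>ac. tr' = tr @ ac \<and> length ac = 23 \<and>
        confined (if k < n then target k else {}) {y..<3 * y} ac \<and>
        accesses ac \<le> 5 * (min (Suc k) n - min k n)) \<and>
        input m' \<and> base c r' \<and> r' 9 = r 9 \<and> r' 11 = Suc k \<and> r' 17 = off (min (Suc k) n) \<and>
        r' 18 = rank (min (Suc k) n) \<and> (\<forall>k'. j \<le> k' \<longrightarrow> k' < min (Suc k) n \<longrightarrow> placed k' m')) tr r m"
proof (cases "k < n")
  case True
  note b = r(1)[unfolded base_def]
  have bl: "Suc (adr k) < 3 * y"
    using index_less[OF True] n_le y_ge by linarith
  have mm: "m (adr k) = src k" "m (Suc (adr k)) = src k + len k"
    using m bd[OF True] bl by (auto simp: input_def)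
  have lk: "src k + len k \<le> y" using src_le[OF True] by simp
  have ok: "off k + len k \<le> y" using off_le[of "Suc k"] True by simp
  have rk: "rank k < y" using rank_le[of k] True n_le by linarith
  have sy: "s \<le> y + 1" by (simp add: s_def)
  have le1: "src k * (y + 1) \<le> y * (2 * y)" using lk y_ge by (intro mult_le_mono) auto
  have le2: "rank k * (y + 1) \<le> y * (2 * y)" using rk y_ge by (intro mult_le_mono) auto
  have kd: "k mod x \<le> k" "k div x \<le> k" "start k \<le> off k + (s - 1)" unfolding start_def by (rule mod_less_eq_dividend div_le_dividend)+
  have ov: "len k < 2 ^ w" "Suc k < 2 ^ w" "k mod x < 2 ^ w" "k div x < 2 ^ w" "s - 1 < 2 ^ w" "off k + (s - 1) < 2 ^ w" "start k < 2 ^ w"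
     "src k * (y + 1) < 2 ^ w" "src k * (y + 1) + len k < 2 ^ w" "rank k * (y + 1) < 2 ^ w" "rank k * (y + 1) + off k < 2 ^ w"
     "start k * s < 2 ^ w" "off k + len k < 2 ^ w" "Suc (rank k) < 2 ^ w"
    using w lk ok yy y_ge r(3) True n_le rk sy start_le[of k] le1 le2 kd by linarith+
  have ov': "(off k + (s - 1)) div s < 2 ^ w" "(off k + (s - 1)) div s * s < 2 ^ w"
    using ov unfolding start_def by simp_all
  note bx = eval_bdx[where r = r, OF _ _ _ r(2) True] eval_bdx[where r = "r(12 := u)" for u, OF _ _ _ _ True]
  have kx0: "k div x < y" using kd True n_le by linarith
  have e2: "eval w r' (slotx 2 (Reg 11 [/] Reg 2)) = slot 2 (k div x)" if "r' 4 = y" "r' 11 = k" "r' 2 = x" for r'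
    using that(1) kx0 ov(4) by (intro eval_slotx) (simp_all add: that)
  have e3: "eval w r' (slotx 3 (Reg 18)) = slot 3 (rank k)" if "r' 4 = y" "r' 18 = rank k" for r'
    by (intro eval_slotx) (use that rk in simp_all)
  have e1: "eval w r' (slotx 1 (Reg 19)) = slot 1 (start k)" if "r' 4 = y" "r' 19 = start k" "notifies k" for r'
    by (intro eval_slotx) (use that start_less[OF True that(3)] p_le in simp_all)
  \<comment> \<open>The memory after each of the three optional stores; \<open>mC\<close> is the one
    final memory for all combinations of their conditions.\<close>
  define mA where "mA = (if x dvd k then m(slot 2 (k div x) := off k) else m)"
  define mB where "mB = (if 0 < len k then mA(slot 3 (rank k) := src k * (y + 1) + len k) else mA)"
  define mC where "mC = (if notifies k then mB(slot 1 (start k) := rank k * (y + 1) + off k) else mB)"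
  note kx = kx0
  have st: "notifies k \<Longrightarrow> start k < y" using start_less[OF True] p_le by linarith
  have pC: "placed k mC"
    using slot_eq_iff[OF kx rk, of 2 3] slot_eq_iff[OF kx st, of 2 1] slot_eq_iff[OF rk st, of 3 1]
    by (auto simp: placed_def mA_def mB_def mC_def)
  have fr: "mC a = m a" if "a \<notin> target k" for a
    using that by (auto simp: target_def mA_def mB_def mC_def split: if_splits)
  have iC: "input mC" unfolding input_def
  proof (intro allI impI)
    fix a assume a: "a < 3 * y"
    have "a \<noteq> slot K i" for K i using slot_low[of a K i] a by auto
    then have "a \<notin> target k" by (auto simp: target_def)
    then show "mC a = m0 a" using fr m a by (simp add: input_def)
  qed
  have plC: "placed k' mC" if "j \<le> k'" "k' < Suc k" for k'
  proof (cases "k' = k")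
    case False
    then have "k' < k" using that by simp
    then show ?thesis
      using target_disjoint[of k k'] True by (intro placed_cong[OF pl[OF that(1)]] fr) auto
  qed (simp add: pC)
  have "sp w place_body (\<lambda>tr' r' m'. (\<exists>ac. tr' = tr @ ac \<and> length ac = 23 \<and> confined (target k) {y..<3 * y} ac \<and>
        accesses ac \<le> 5) \<and> m' = mC \<and> base c r' \<and> r' 9 = r 9 \<and> r' 11 = Suc k \<and> r' 17 = off k + len k \<and>
        r' 18 = rank (Suc k)) tr r m"
  proof -
    have g1: "eval w r' (Reg 11 [<] Reg 8) = 1" if "r' 11 = k" "r' 8 = n" for r'
      using that True w_pos by simp
    have e13: "eval w r' (Reg 13 [-] Reg 12) = len k" if "r' 13 = src k + len k" "r' 12 = src k" for r'
      using that ov(1) by simp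
    have c2: "eval w r' ((Reg 11 [%] Reg 2) [=] Const 0) = (if x dvd k then 1 else 0)" if "r' 11 = k" "r' 2 = x" for r'
      using that ov(3) w_pos by (auto simp: dvd_eq_mod_eq_0)
    have e19: "eval w r' ((Reg 17 [+] (Reg 7 [-] Const 1)) [/] Reg 7) = start k" if "r' 17 = off k" "r' 7 = s" for r'
      using that ov(5,6) ov'(1) by (simp add: start_def)
    have gl: "eval w r' (Const 0 [<] Reg 13) = (if 0 < len k then 1 else 0)" if "r' 13 = len k" for r'
      using that w_pos by simp
    have er: "eval w r' ((Reg 12 [*] Reg 5) [+] Reg 13) = src k * (y + 1) + len k"
      if "r' 12 = src k" "r' 5 = y + 1" "r' 13 = len k" for r'
      unfolding eval_simps that mod_less[OF ov(8)] by (rule mod_less[OF ov(9)])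
    have gn: "eval w r' ((Reg 19 [*] Reg 7) [<] (Reg 17 [+] Reg 13)) = (if notifies k then 1 else 0)"
      if "r' 19 = start k" "r' 7 = s" "r' 17 = off k" "r' 13 = len k" "0 < len k" for r'
      using that(5) w_pos unfolding eval_simps that(1-4) mod_less[OF ov(12)] mod_less[OF ov(13)]
      by (simp add: notifies_def)
    have en: "eval w r' ((Reg 18 [*] Reg 5) [+] Reg 17) = rank k * (y + 1) + off k"
      if "r' 18 = rank k" "r' 5 = y + 1" "r' 17 = off k" for r'
      unfolding eval_simps that mod_less[OF ov(10)] by (rule mod_less[OF ov(11)])
    have e18: "eval w r' (Reg 18 [+] Const 1) = Suc (rank k)" if "r' 18 = rank k" for r'
      using that ov(14) by simp
    have e17: "eval w r' (Reg 17 [+] Reg 13) = off k + len k" if "r' 17 = off k" "r' 13 = len k" for r'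
      using that ov(13) by simp
    have e11: "eval w r' (Reg 11 [+] Const 1) = Suc k" if "r' 11 = k" for r'
      using that ov(2) by simp
    have r17: "r 17 = off k" "r 18 = rank k" using r(4,5) True by (simp_all add: min_def)
    have ba: "adr k \<in> {y..<3 * y}" "Suc (adr k) \<in> {y..<3 * y}" using bl by auto
    note b' = baseD[OF r(1)]
    have no: "0 < len k" if "notifies k" using that by (simp add: notifies_def)
    define ad where "ad = adr k"
    note E = b' r(2) r17 bx[folded ad_def] mm[folded ad_def] g1 e13 c2 e19 gl er gn en e18 e17 e11 e1 e2 e3 ba[folded ad_def]
    show ?thesis
      by (cases "x dvd k"; cases "0 < len k"; cases "notifies k")
        (simp_all add: E place_body_def guard_def base_def mA_def mB_def mC_def target_def rank_Suc no
        del: eval.simps(3) One_nat_def atLeastLessThan_iff)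
  qed
  then show ?thesis
    by (rule sp_mono) (use True plC iC in auto)
next
  case False
  have "Suc k < 2 ^ w" using w yy y_ge r(3) by linarith
  with False show ?thesis
    using r m pl w_pos by (simp add: place_body_def guard_def base_def min_def)
qed

lemma target_bound: "a \<in> target k \<Longrightarrow> \<exists>K i. a = slot K i"
  by (auto simp: target_def split: if_splits)

abbreviation summed :: assertion where
  "summed S m \<equiv> (\<forall>c<p. base c (S c) \<and> S c 9 = c * q + q \<and> S c 10 + PK (lo c) = PK (lo (Suc c)) \<and> S c 14 = PK (lo (Suc c)) \<and> m (slot 1 c) = 0) \<and> input m"

abbreviation distributed :: assertion where
  "distributed S m \<equiv> (\<forall>c<p. base c (S c)) \<and> input m \<and> (\<forall>k<n. placed k m) \<and> (\<forall>c<p. (\<forall>k<n. notifies k \<longrightarrow> start k \<noteq> c) \<longrightarrow> m (slot 1 c) = 0)"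

abbreviation placed_by :: "nat \<Rightarrow> registers \<Rightarrow> memory \<Rightarrow> bool" where
  "placed_by c r m \<equiv> base c r \<and> (\<forall>k. lo c \<le> k \<longrightarrow> k < lo (Suc c) \<longrightarrow> placed k m)"

lemma par_place:
  "phase summed
    place_code (25 * q + 7) (\<Sum>c<p. 5 * (lo (Suc c) - lo c))
    distributed"
proof (rule par_phase_local[where W = "\<lambda>c. \<Union>k\<in>{lo c..<lo (Suc c)}. target k" and R = "\<lambda>_. {y..<3 * y}" and
    Q = "placed_by"])
  show "block_disjoint p B (\<lambda>c. \<Union>k\<in>{lo c..<lo (Suc c)}. target k) (\<lambda>_. {y..<3 * y})"
    unfolding block_disjoint_def
  proof (intro allI impI)
    fix c c' a a'
    assume *: "c < p" "c' < p" "c \<noteq> c'" "a \<in> (\<Union>k\<in>{lo c..<lo (Suc c)}. target k)"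
      "a' \<in> (\<Union>k\<in>{lo c'..<lo (Suc c')}. target k) \<union> {y..<3 * y}"
    from *(4) obtain k where k: "lo c \<le> k" "k < lo (Suc c)" "a \<in> target k" by auto
    have kn: "k < n" using k(2) lo_le[of "Suc c"] by linarith
    from *(5) consider k' where "lo c' \<le> k'" "k' < lo (Suc c')" "a' \<in> target k'" | "a' < 7 * y" by fastforce
    then show "a div B \<noteq> a' div B"
    proof cases
      case 1
      have "k \<noteq> k'"
      proof (cases "c < c'")
        case True
        then show ?thesis using lo_mono[of "Suc c" c'] 1 k by linarith
      next
        case False
        then show ?thesis using *(3) lo_mono[of "Suc c'" c] 1 k by linarith
      qed
      then show ?thesis using target_disjoint[OF kn _ _ k(3) 1(3)] 1(2) lo_le[of "Suc c'"] by linarith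
    next
      case 2
      then show ?thesis using target_bound[OF k(3)] slot_low by blast
    qed
  qed
  fix S :: "nat \<Rightarrow> registers" and m :: memory and c
  assume pre: "summed S m" and c: "c < p"
  define r where "r = S c"
  have r: "base c r" "r 9 = c * q + q" "r 10 + PK (lo c) = PK (lo (Suc c))" "r 14 = PK (lo (Suc c))" using pre c by (auto simp: r_def)
  have m: "input m" using pre by simp
  define W where "W = (\<Union>k\<in>{lo c..<lo (Suc c)}. target k)"
  define I where "I i tr r m' \<longleftrightarrow> length tr = 6 + i * 25 \<and> confined W {y..<3 * y} tr \<and>
     accesses tr \<le> 5 * (min (c * q + i) n - lo c) \<and> input m' \<and> base c r \<and> r 9 = c * q + q \<and> r 11 = c * q + i \<and>
     r 17 = off (min (c * q + i) n) \<and> r 18 = rank (min (c * q + i) n) \<and>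
     (\<forall>k. lo c \<le> k \<longrightarrow> k < min (c * q + i) n \<longrightarrow> placed k m')" for i tr r m'
  define Q where "Q tr s' m' \<longleftrightarrow> length tr = 25 * q + 7 \<and> confined W {y..<3 * y} tr \<and>
      cost B [] tr \<le> 5 * (lo (Suc c) - lo c) \<and> placed_by c s' m'" for tr s' m'
  have qb: "c * q + q \<le> 2 * y" using q_bounds(2)[OF c] .
  have ov: "c * q < 2 ^ w" using qb w yy y_ge by linarith
  have lo: "lo (Suc c) = min (c * q + q) n" by (simp add: lo_def add.commute)
  \<comment> \<open>Unpacking is exact since \<open>off (lo c) \<le> y < y + 1\<close>.\<close>
  have PKlo: "PK (lo c) mod (y + 1) = off (lo c)" "PK (lo c) div (y + 1) = rank (lo c)"
    using off_le[OF lo_le[of c]] unfolding PK_def by (simp_all del: add_Suc_right mult_Suc)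
  \<comment> \<open>The scan is inclusive; removing the core's own total leaves the sum over all
    earlier cores.\<close>
  have diff: "r 14 - r 10 = PK (lo c)" using r by simp
  have Psm: "PK (lo c) < 2 ^ w" "off (lo c) < 2 ^ w" "rank (lo c) < 2 ^ w"
    using PK_le[OF lo_le[of c]] off_le[OF lo_le[of c]] rank_le[of "lo c"] lo_le[of c] n_le w yy y_ge by linarith+
  have e: "eval w r' ((Reg 14 [-] Reg 10) [%] Reg 5) = off (lo c)"
     "eval w r' ((Reg 14 [-] Reg 10) [/] Reg 5) = rank (lo c)"
    if "r' 14 = r 14" "r' 10 = r 10" "r' 5 = y + 1" for r'
    unfolding eval_simps that diff mod_less[OF Psm(1)] PKlo
    by (rule mod_less[OF Psm(2)], rule mod_less[OF Psm(3)])
  have prep: "sp w (seqs [Assign 17 ((Reg 14 [-] Reg 10) [%] Reg 5),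
      Assign 18 ((Reg 14 [-] Reg 10) [/] Reg 5), Assign 11 (Reg 0 [*] Reg 6)])
     (\<lambda>tr. I 0 (tr @ [None])) [] r m"
  proof -
    have "\<forall>k\<ge>min (c * q) n. k < c * q \<and> k < n \<longrightarrow> placed k m" by auto
    moreover have "c * q mod 2 ^ w = c * q" using ov by simp
    ultimately show ?thesis
      using r m by (simp add: I_def base_def lo_def e eval.simps(3)[of _ _ Mul] del: eval.simps(3))
  qed
  have "wp w place_code Q [] r m"
    unfolding place_code_def
  proof (rule wp_prepared_While[where I = I and N = q, OF prep])
    fix i tr r m' assume i: "i < q" and I: "I i tr r m'"
    show "eval w r (Reg 11 [<] Reg 9) \<noteq> 0" using I i w_pos by (auto simp: I_def)
    have mn: "lo c \<le> min (c * q + i) n" by (simp add: lo_def)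
    have sub: "(if c * q + i < n then target (c * q + i) else {}) \<subseteq> W"
      using i mn by (auto simp: W_def lo intro!: bexI[of _ "c * q + i"])
    have "sp w place_body (\<lambda>tr' r' m''. (\<exists>ac. tr' = (tr @ [None]) @ ac \<and> length ac = 23 \<and>
        confined (if c * q + i < n then target (c * q + i) else {}) {y..<3 * y} ac \<and>
        accesses ac \<le> 5 * (min (Suc (c * q + i)) n - min (c * q + i) n)) \<and>
        input m'' \<and> base c r' \<and> r' 9 = r 9 \<and> r' 11 = Suc (c * q + i) \<and> r' 17 = off (min (Suc (c * q + i)) n) \<and>
        r' 18 = rank (min (Suc (c * q + i)) n) \<and>
        (\<forall>k'. lo c \<le> k' \<longrightarrow> k' < min (Suc (c * q + i)) n \<longrightarrow> placed k' m'')) (tr @ [None]) r m'" (is "sp w place_body ?post _ _ _")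
      using I i qb by (intro sp_place_body) (auto simp: I_def)
    then show "sp w place_body (\<lambda>tr. I (Suc i) (tr @ [None])) (tr @ [None]) r m'"
    proof (rule sp_mono)
      fix tr' r' m''
      assume *: "?post tr' r' m''"
      then obtain ac where ac: "tr' = (tr @ [None]) @ ac" "length ac = 23" "confined W {y..<3 * y} ac"
        "accesses ac \<le> 5 * (min (Suc (c * q + i)) n - min (c * q + i) n)"
        using confined_mono[OF _ sub order_refl] by blast
      then have "confined W {y..<3 * y} tr'" using I by (simp add: I_def)
      moreover have "accesses tr' \<le> 5 * (min (Suc (c * q + i)) n - lo c)"
      proof -
        have "accesses tr' = accesses tr + accesses ac" using ac(1) by simp
        moreover have "accesses tr \<le> 5 * (min (c * q + i) n - lo c)" using I by (simp add: I_def)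
        moreover have "min (c * q + i) n \<le> min (Suc (c * q + i)) n" by simp
        ultimately show ?thesis using ac(4) mn by linarith
      qed
      ultimately show "I (Suc i) (tr' @ [None]) r' m''"
        using ac(1,2) * I by (simp add: I_def)
    qed
  next
    fix tr r m' assume I: "I q tr r m'"
    have "cost B [] tr \<le> 5 * (lo (Suc c) - lo c)"
      using I cost_le_accesses[of B "[]" tr] unfolding I_def lo by linarith
    then show "Q (tr @ [None]) r m'" using I by (auto simp: I_def Q_def lo)
    show "eval w r (Reg 11 [<] Reg 9) = 0" using I by (simp add: I_def)
  qed
  then show "wp w place_code
        (\<lambda>tr s' m'. length tr = 25 * q + 7 \<and> confined (\<Union>k\<in>{lo c..<lo (Suc c)}. target k) {y..<3 * y} tr \<and>
      cost B [] tr \<le> 5 * (lo (Suc c) - lo c) \<and> placed_by c s' m') [] (S c) m"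
    unfolding Q_def r_def W_def .
next
  fix c s' m' m''
  assume *: "placed_by c s' m'"
    and ag: "\<And>a. a \<in> (\<Union>k\<in>{lo c..<lo (Suc c)}. target k) \<Longrightarrow> m'' a = m' a"
  have "placed k m''" if k: "lo c \<le> k" "k < lo (Suc c)" for k
  proof (rule placed_cong)
    show "placed k m'" using * k by blast
    show "m'' a = m' a" if "a \<in> target k" for a
      by (rule ag, rule UN_I[of k]) (use that k in auto)
  qed
  then show "placed_by c s' m''"
    using * by blast
next
  fix S m S' m'
  assume pre: "summed S m"
    and Q: "\<And>c. c < p \<Longrightarrow> placed_by c (S' c) m'"
    and F: "\<And>a. (\<And>c. c < p \<Longrightarrow> a \<notin> (\<Union>k\<in>{lo c..<lo (Suc c)}. target k)) \<Longrightarrow> m' a = m a"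
  have F': "m' a = m a" if "\<And>k. k < n \<Longrightarrow> a \<notin> target k" for a
  proof (rule F)
    fix c show "a \<notin> (\<Union>k\<in>{lo c..<lo (Suc c)}. target k)" using that lo_le[of "Suc c"] by fastforce
  qed
  have "placed k m'" if k: "k < n" for k
  proof -
    have qp: "0 < q" by (simp add: q_def)
    have "k div q < p" using k q_bounds(1) qp by (simp add: div_less_iff_less_mult)
    moreover have "lo (k div q) \<le> k" using div_times_less_eq_dividend[of k q] by (simp add: lo_def min.coboundedI1)
    moreover have "k < lo (Suc (k div q))" using k qp dividend_less_times_div[of q k] by (simp add: lo_def mult.commute)
    ultimately show ?thesis using Q by blast
  qed
  moreover have "input m'" unfolding input_def
  proof (intro allI impI)
    fix a assume a: "a < 3 * y"
    have "a \<notin> target k" for k using target_bound[of a k] slot_low[of a] a by force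
    then show "m' a = m0 a" using F' pre a by (simp add: input_def)
  qed
  moreover have "m' (slot 1 c) = 0" if c: "c < p" "\<forall>k<n. notifies k \<longrightarrow> start k \<noteq> c" for c
  proof -
    have "slot 1 c \<notin> target k" if k: "k < n" for k
    proof -
      have 1: "c < y" "k div x < y" "rank k < y"
        using c(1) k n_le rank_le[of k] div_le_dividend[of k x] p_le by linarith+
      have 2: "start k < y" if "notifies k" using start_less[OF k that] p_le by linarith
      show ?thesis
        using c(2) k slot_eq_iff[OF 1(1,2), of 1 2] slot_eq_iff[OF 1(1,3), of 1 3] slot_eq_iff[OF 1(1) 2, of 1 1]
        by (auto simp: target_def)
    qed
    then show ?thesis using F' pre c by simp
  qed
  ultimately show "distributed S' m'" using Q by blast
qed (use p B MB in auto)

end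

text \<open>Subtraction truncates at 0, which makes this the maximum of registers 14 and 16.\<close>

abbreviation max_expr :: expr where
  "max_expr \<equiv> Reg 14 [+] (Reg 16 [-] Reg 14)"

section \<open>Copying\<close>

definition locate_code :: com where
  "locate_code = Seq (Load 14 (slotx 1 (Reg 0))) (scan 1 max_expr)"

text \<open>\<open>Reg 19 [-] Reg 17\<close> is how far into its first bucket the core starts; it
  advances the source address and shortens the rest. Cores with \<open>c * s \<ge> y\<close> have
  nothing to write and skip the lookup.\<close>

definition seek_code :: com where
  "seek_code = seqs
     [Assign 18 (Reg 14 [/] Reg 5),
      Assign 17 (Reg 14 [%] Reg 5),
      Assign 19 (Reg 0 [*] Reg 7),
      guard (Reg 19 [<] Reg 4) (seqs
        [Load 20 (slotx 3 (Reg 18)),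
        Assign 21 ((Reg 20 [/] Reg 5) [+] (Reg 19 [-] Reg 17)),
        Assign 22 ((Reg 20 [%] Reg 5) [-] (Reg 19 [-] Reg 17))])]"

context gathering
begin

definition tables :: "memory \<Rightarrow> bool" where
  "tables m \<longleftrightarrow> input m \<and> (\<forall>k<n. x dvd k \<longrightarrow> m (slot 2 (k div x)) = off k) \<and>
     (\<forall>k<n. 0 < len k \<longrightarrow> m (slot 3 (rank k)) = src k * (y + 1) + len k)"

section \<open>The bucket in which an output position falls\<close>

lemma exists_bucket: "pos < y \<Longrightarrow> \<exists>k<n. off k \<le> pos \<and> pos < off k + len k"
proof -
  assume pos: "pos < y"
  define k where "k = (LEAST k. pos < off (Suc k))"
  have "pos < off (Suc n)" using pos off_mono[of n "Suc n"] off_n by simp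
  then have 1: "pos < off (Suc k)" unfolding k_def by (rule LeastI)
  have 2: "off k \<le> pos"
  proof (cases k)
    case (Suc j)
    then have "\<not> pos < off (Suc j)" unfolding k_def by (metis lessI not_less_Least)
    then show ?thesis using Suc by simp
  qed simp
  moreover have "k < n"
  proof (rule ccontr)
    assume "\<not> k < n"
    then show False using off_mono[of n k] off_n 2 pos by simp
  qed
  ultimately show ?thesis using 1 by auto
qed

lemma bucket_le: "off k' \<le> pos \<Longrightarrow> pos < off k + len k \<Longrightarrow> k' \<le> k"
  using off_mono[of "Suc k" k'] by (cases "k' \<le> k") auto

lemma rank_eq: "i \<le> j \<Longrightarrow> off j = off i \<Longrightarrow> rank j = rank i"
proof (induction j rule: dec_induct)
  case (step j)
  then have "off i \<le> off j" by (intro off_mono)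
  then show ?case using step by (simp add: rank_Suc)
qed simp

lemma max_eq: "b + (a - b) = max a (b::nat)" by simp

lemma packed_le: "k < n \<Longrightarrow> rank k * (y + 1) + off k \<le> 4 * (y * y)"
  using PK_le[of k] by (simp add: PK_def mult.commute)

abbreviation located :: assertion where
  "located S m \<equiv> (\<forall>c<p. base c (S c) \<and> (c * s < y \<longrightarrow> (\<exists>k<n. 0 < len k \<and> off k \<le> c * s \<and> c * s < off k + len k \<and> S c 14 = rank k * (y + 1) + off k))) \<and> tables m"

text \<open>The bucket \<open>k\<close> that contains position \<open>c * s\<close> notified core
  \<open>start k \<le> c\<close>. Whatever the cores up to \<open>c\<close> received comes from
  buckets up to \<open>k\<close>, and rank and offset are both monotone, so the packed word of
  \<open>k\<close> is the maximum. The default 0 cannot exceed it; for the first nonempty bucket the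
  two coincide.\<close>

lemma par_locate:
  "phase distributed
     locate_code (20 * rounds + 17) (9 * p)
     located"
proof (rule par_cases)
  fix S0 m1
  assume pre: "distributed S0 m1"
  define nt where "nt c = m1 (slot 1 c)" for c
  have nt: "(\<exists>k<n. notifies k \<and> start k = c \<and> nt c = rank k * (y + 1) + off k) \<or> nt c = 0" if "c < p" for c
  proof (cases "\<exists>k<n. notifies k \<and> start k = c")
    case True
    then obtain k where k: "k < n" "notifies k" "start k = c" by blast
    then have "placed k m1" using pre by blast
    then have "nt c = rank k * (y + 1) + off k" using k by (simp add: placed_def nt_def)
    then show ?thesis using k by blast
  next
    case False
    then have "m1 (slot 1 c) = 0" using pre that by blast
    then show ?thesis by (simp add: nt_def)
  qed
  have nt_le: "nt c \<le> 4 * (y * y)" if "c < p" for c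
    using nt[OF that]
  proof
    assume "\<exists>k<n. notifies k \<and> start k = c \<and> nt c = rank k * (y + 1) + off k"
    then obtain k where "k < n" "nt c = rank k * (y + 1) + off k" by blast
    then show ?thesis using packed_le[of k] by linarith
  qed simp
  define G where "G l u = Max (nt ` {l..<u})" for l u
  let ?scanned = "\<lambda>S m. (\<forall>c<p. S c 14 = G 0 (Suc c) \<and> base c (S c)) \<and> except_slots 1 m m1"
  have load: "phase (\<lambda>S m. S = S0 \<and> m = m1) (Load 14 (slotx 1 (Reg 0))) 1 (\<Sum>c<p. 1)
     (\<lambda>S m. (\<forall>c<p. S c 14 = nt c \<and> (\<forall>r. r \<noteq> 14 \<longrightarrow> S c r = S0 c r)) \<and> m = m1)"
  proof (rule par_phase_local[where W = "\<lambda>_. {}" and R = "\<lambda>c. {slot 1 c}" and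
      Q = "\<lambda>c s' m'. s' 14 = nt c \<and> (\<forall>r. r \<noteq> 14 \<longrightarrow> s' r = S0 c r)"])
    fix S :: "nat \<Rightarrow> registers" and m c
    assume S: "S = S0 \<and> m = m1" and c: "c < p"
    have "eval w (S0 c) (slotx 1 (Reg 0)) = slot 1 c"
    proof (rule eval_slotx)
      show "S0 c 4 = y" "eval w (S0 c) (Reg 0) = c" using pre c by (simp_all add: base_def)
    qed (use c p_le in auto)
    then show "wp w (Load 14 (slotx 1 (Reg 0))) (\<lambda>tr s' m'. length tr = 1 \<and> confined {} {slot 1 c} tr \<and> cost B [] tr \<le> 1 \<and>
        s' 14 = nt c \<and> (\<forall>r. r \<noteq> 14 \<longrightarrow> s' r = S0 c r)) [] (S c) m"
      by (intro wp_sp) (simp add: S nt_def)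
  qed (use p B MB in \<open>auto simp: block_disjoint_def\<close>)
  have scan: "phase (\<lambda>S m. (\<forall>c<p. S c 14 = nt c \<and> (\<forall>r. r \<noteq> 14 \<longrightarrow> S c r = S0 c r)) \<and> m = m1)
    (scan 1 max_expr) (20 * rounds + 15) (8 * p)
    ?scanned"
  proof (rule par_cases)
    fix S1 m assume S1: "(\<forall>c<p. S1 c 14 = nt c \<and> (\<forall>r. r \<noteq> 14 \<longrightarrow> S1 c r = S0 c r)) \<and> m = m1"
    have "phase (\<lambda>S m'. S = S1 \<and> m' = m) (scan 1 max_expr) (20 * rounds + 15) (8 * p)
     (\<lambda>S m'. (\<forall>c<p. S c 14 = G 0 (Suc c) \<and> keeps (S c) (S1 c)) \<and>
        except_slots 1 m' m)"
    proof (rule par_scan)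
      fix c assume c: "c < p"
      show "S1 c 0 = c \<and> S1 c 1 = p \<and> S1 c 4 = y" using S1 pre c by (auto simp: base_def)
      show "S1 c 14 = G c (Suc c) \<and> m (slot 1 c) = G c (Suc c)"
        using S1 c by (auto simp: G_def nt_def)
    next
      fix l k u :: nat and r :: registers
      assume lku: "l < k" "k < u" "u \<le> p" and r: "r 16 = G l k" "r 14 = G k u"
      have "G l u = max (G l k) (G k u)"
      proof -
        have "nt ` {l..<u} = nt ` {l..<k} \<union> nt ` {k..<u}"
        using lku by (simp add: image_Un[symmetric] ivl_disj_un(17))
        then show ?thesis unfolding G_def using lku by (simp add: Max_Un)
      qed
      moreover have "G l k \<le> 4 * (y * y)" "G k u \<le> 4 * (y * y)"
      proof -
        have "Max (nt ` {l'..<u'}) \<le> 4 * (y * y)" if "l' < u'" "u' \<le> p" for l' u'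
        by (rule Max.boundedI) (use that nt_le in auto)
        then show "G l k \<le> 4 * (y * y)" "G k u \<le> 4 * (y * y)" unfolding G_def using lku by simp_all
      qed
      moreover from this have "max (G l k) (G k u) < 2 ^ w" "G l k - G k u < 2 ^ w" using w by linarith+
      ultimately show "eval w r max_expr = G l u"
        using r by (simp add: max_eq)
    qed simp
    then show "phase (\<lambda>S m'. S = S1 \<and> m' = m) (scan 1 max_expr) (20 * rounds + 15) (8 * p)
     ?scanned"
      by (rule par_weaken) (use S1 pre in \<open>auto simp: base_def\<close>)
  qed
  have fin: "\<exists>k<n. 0 < len k \<and> off k \<le> c * s \<and> c * s < off k + len k \<and> G 0 (Suc c) = rank k * (y + 1) + off k"
    if c: "c < p" "c * s < y" for c
  proof -
    obtain k where k: "k < n" "off k \<le> c * s" "c * s < off k + len k" using exists_bucket[OF c(2)] by auto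
    \<comment> \<open>Rounding up adds less than \<open>s\<close>, so the notified core does not
      come after \<open>c\<close>.\<close>
    have "start k * s < Suc c * s" using start_le[of k] k(2) s_pos by simp
    then have st: "start k \<le> c" unfolding mult_less_cancel2 by simp
    then have "start k * s \<le> c * s" by (rule mult_le_mono1)
    then have "start k * s < off k + len k" "0 < len k" using k(2,3) by linarith+
    then have nk: "notifies k" unfolding notifies_def by blast
    have "G 0 (Suc c) = rank k * (y + 1) + off k" unfolding G_def
    proof (rule Max_eqI)
      show "rank k * (y + 1) + off k \<in> nt ` {0..<Suc c}"
        using pre nk k(1) st by (intro image_eqI[of _ _ "start k"]) (auto simp: nt_def placed_def)
      fix v assume "v \<in> nt ` {0..<Suc c}"
      then obtain c' where c': "c' \<le> c" "v = nt c'"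
        unfolding atLeast0LessThan lessThan_Suc_atMost by blast
      have "c' < p" using c' c by simp
      from nt[OF this] show "v \<le> rank k * (y + 1) + off k"
      proof
        assume "\<exists>k<n. notifies k \<and> start k = c' \<and> nt c' = rank k * (y + 1) + off k"
        then obtain k' where k': "start k' = c'" "nt c' = rank k' * (y + 1) + off k'" by auto
        have "off k' \<le> c * s" using off_le_start[of k', unfolded k'(1)] mult_le_mono1[OF c'(1), of s] by linarith
        then have "k' \<le> k" using k(3) by (rule bucket_le)
        then show ?thesis unfolding c'(2) k'(2) by (intro add_mono mult_le_mono1 rank_mono off_mono)
      qed (simp add: c'(2))
    qed simp
    then show ?thesis using k by (intro exI[of _ k]) auto
  qed
  have "phase (\<lambda>S m. S = S0 \<and> m = m1) locate_code (1 + 1 + (20 * rounds + 15)) ((\<Sum>c<p. 1) + 8 * p)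
    ?scanned"
    unfolding locate_code_def by (rule par_Seq[OF load scan])
  moreover have "1 + 1 + (20 * rounds + 15) = 20 * rounds + 17" "(\<Sum>c<p. 1) + 8 * p = 9 * p" by simp_all
  ultimately have *: "phase (\<lambda>S m. S = S0 \<and> m = m1) locate_code (20 * rounds + 17) (9 * p)
    ?scanned"
    by (simp only:)
  have tab: "tables m" if F: "except_slots 1 m m1" for m
  proof -
    have 1: "m a = m0 a" if "a < 3 * y" for a
    proof -
      have "a \<noteq> slot 1 c" for c using slot_low[of a 1 c] that by auto
      then show ?thesis using F pre that by (simp add: input_def)
    qed
    have 2: "m (slot K i) = m1 (slot K i)" if "i < y" "K \<noteq> 1" for K i
      using F slot_eq_iff[OF that(1), of _ K 1] that(2) p_le by auto
    have 3: "k div x < y" "rank k < y" if "k < n" for k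
      using that n_le rank_le[of k] div_le_dividend[of k x] by linarith+
    show ?thesis unfolding tables_def input_def using 1 2 3 pre by (simp add: placed_def)
  qed
  show "phase (\<lambda>S m. S = S0 \<and> m = m1) locate_code (20 * rounds + 17) (9 * p)
     located"
  proof (rule par_weaken[OF *])
    fix S m assume "(\<forall>c<p. S c 14 = G 0 (Suc c) \<and> base c (S c)) \<and> except_slots 1 m m1"
    then show "located S m"
      using fin tab by presburger
  qed simp_all
qed

text \<open>The bound \<open>pos \<le> off k + len k\<close> is not strict: a bucket just used up
  stays current with \<open>r 22 = 0\<close>, and the next record is fetched only when another word
  is due. So no record is sought after the last bucket.\<close>

definition current :: "nat \<Rightarrow> registers \<Rightarrow> bool" where
  "current pos r \<longleftrightarrow> (\<exists>k<n. 0 < len k \<and> off k \<le> pos \<and> pos \<le> off k + len k \<and>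
     r 18 = rank k \<and> r 21 = src k + (pos - off k) \<and> r 22 = off k + len k - pos)"

lemma packed: "k < n \<Longrightarrow> (src k * (y + 1) + len k) div (y + 1) = src k" "k < n \<Longrightarrow> (src k * (y + 1) + len k) mod (y + 1) = len k"
   "k < n \<Longrightarrow> src k * (y + 1) + len k < 2 ^ w"
proof -
  assume k: "k < n"
  have "len k < y + 1" using src_le[OF k] by simp
  then show "(src k * (y + 1) + len k) div (y + 1) = src k" "(src k * (y + 1) + len k) mod (y + 1) = len k"
    by (simp_all del: add_Suc_right mult_Suc_right add_Suc)
  have "src k * (y + 1) \<le> y * (2 * y)" using src_le[OF k] y_ge by (intro mult_le_mono) auto
  then show "src k * (y + 1) + len k < 2 ^ w" using src_le[OF k] w yy y_ge by linarith
qed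

abbreviation sought_by :: "nat \<Rightarrow> registers \<Rightarrow> bool" where
  "sought_by c r \<equiv> base c r \<and> r 19 = c * s \<and> (c * s < y \<longrightarrow> current (c * s) r)"

abbreviation sought :: assertion where
  "sought S m \<equiv> (\<forall>c<p. sought_by c (S c)) \<and> tables m"

lemma par_seek:
  "phase located
     seek_code 12 (\<Sum>c<p. 1)
     sought"
\<comment> \<open>In a phase without writes any read set is harmless, so the reads need not be
  confined.\<close>
proof (rule par_phase_local[where W = "\<lambda>_. {}" and R = "\<lambda>_. UNIV" and
    Q = "\<lambda>c s' m'. sought_by c s'"])
  fix S m c
  assume pre: "located S m" and c: "c < p"
  define r where "r = S c"
  have b: "base c r" using pre c by (simp add: r_def)
  note b' = baseD[OF b]
  have cs: "c * s < 2 ^ w" using s_bounds(2)[OF c] w yy y_ge by linarith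
  have e19: "eval w r' (Reg 0 [*] Reg 7) = c * s" if "r' 0 = c" "r' 7 = s" for r'
    using that cs by simp
  have g: "eval w r' (Reg 19 [<] Reg 4) = (if c * s < y then 1 else 0)" if "r' 19 = c * s" "r' 4 = y" for r'
    using that w_pos by simp
  show "wp w seek_code (\<lambda>tr s' m'. length tr = 12 \<and> confined {} UNIV tr \<and> cost B [] tr \<le> 1 \<and>
      sought_by c s') [] (S c) m"
  proof (cases "c * s < y")
    case True
    then obtain k where k: "k < n" "0 < len k" "off k \<le> c * s" "c * s < off k + len k" "r 14 = rank k * (y + 1) + off k"
      using pre c by (auto simp: r_def)
    have ok: "off k < y + 1" using off_le[of k] k(1) by simp
    have rk: "rank k < y" using rank_le[of k] k(1) n_le by linarith
    have d: "(rank k * (y + 1) + off k) div (y + 1) = rank k" "(rank k * (y + 1) + off k) mod (y + 1) = off k"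
      using ok by (simp_all del: add_Suc_right mult_Suc_right add_Suc)
    have sm: "rank k < 2 ^ w" "off k < 2 ^ w" "src k < 2 ^ w" "len k < 2 ^ w" "c * s - off k < 2 ^ w"
       "src k + (c * s - off k) < 2 ^ w" "len k - (c * s - off k) < 2 ^ w"
      using ok rk src_le[OF k(1)] k(3,4) w yy y_ge by linarith+
    have e18: "eval w r' (Reg 14 [/] Reg 5) = rank k" if "r' 14 = r 14" "r' 5 = y + 1" for r'
      unfolding eval_simps that k(5) d by (rule mod_less[OF sm(1)])
    have e17: "eval w r' (Reg 14 [%] Reg 5) = off k" if "r' 14 = r 14" "r' 5 = y + 1" for r'
      unfolding eval_simps that k(5) d by (rule mod_less[OF sm(2)])
    have e3: "eval w r' (slotx 3 (Reg 18)) = slot 3 (rank k)" if "r' 4 = y" "r' 18 = rank k" for r'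
      by (rule eval_slotx) (use that rk in simp_all)
    have e21: "eval w r' ((Reg 20 [/] Reg 5) [+] (Reg 19 [-] Reg 17)) = src k + (c * s - off k)"
      if "r' 20 = src k * (y + 1) + len k" "r' 5 = y + 1" "r' 19 = c * s" "r' 17 = off k" for r'
      unfolding eval_simps that packed[OF k(1)] mod_less[OF sm(3)] mod_less[OF sm(5)] by (rule mod_less[OF sm(6)])
    have e22: "eval w r' ((Reg 20 [%] Reg 5) [-] (Reg 19 [-] Reg 17)) = len k - (c * s - off k)"
      if "r' 20 = src k * (y + 1) + len k" "r' 5 = y + 1" "r' 19 = c * s" "r' 17 = off k" for r'
      unfolding eval_simps that packed[OF k(1)] mod_less[OF sm(4)] mod_less[OF sm(5)] by (rule mod_less[OF sm(7)])
    have m3: "m (slot 3 (rank k)) = src k * (y + 1) + len k" using pre k by (simp add: tables_def)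
    have cur: "current (c * s) r'" if "r' 18 = rank k" "r' 21 = src k + (c * s - off k)" "r' 22 = len k - (c * s - off k)" for r'
      unfolding current_def using that k by (intro exI[of _ k]) auto
    show ?thesis unfolding r_def[symmetric]
      by (rule wp_sp)
        (simp add: True seek_code_def guard_def base_def cur b' e17 e18 e19 e21 e22 e3 g m3 del: eval.simps(3) One_nat_def)
  next
    case False
    show ?thesis unfolding r_def[symmetric]
      by (rule wp_sp)
        (simp add: False seek_code_def guard_def base_def b' e19 g del: eval.simps(3) One_nat_def)
  qed
next
  fix S m S' m'
  assume pre: "located S m"
    and Q: "\<And>c. c < p \<Longrightarrow> sought_by c (S' c)"
    and F: "\<And>a. (\<And>c. c < p \<Longrightarrow> a \<notin> {}) \<Longrightarrow> m' a = m a"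
  have "m' = m" using F by auto
  then show "sought S' m'"
    using Q pre by blast
qed (use p B MB in \<open>auto simp: block_disjoint_def\<close>)

end

definition copy_body :: com where
  "copy_body = Seq (guard (Reg 19 [<] Reg 4) (seqs
     [guard (Reg 22 [=] Const 0) (seqs
        [Assign 18 (Reg 18 [+] Const 1),
        Load 20 (slotx 3 (Reg 18)),
        Assign 21 (Reg 20 [/] Reg 5),
        Assign 22 (Reg 20 [%] Reg 5)]),
      Load 24 (Reg 21),
      Store ((Const 3 [*] Reg 4) [+] Reg 19) (Reg 24),
      Assign 21 (Reg 21 [+] Const 1),
      Assign 22 (Reg 22 [-] Const 1)]))
     (Assign 19 (Reg 19 [+] Const 1))"

definition copy_code :: "expr \<Rightarrow> com" where
  "copy_code e = Seq (Assign 23 e) (While (Reg 19 [<] Reg 23) copy_body)"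

text \<open>Silent steps do not affect the cache. Without them an iteration consists of two or three
  accesses, a list short enough to be stated exactly in \<open>streams\<close>.\<close>

definition accessed :: "trace \<Rightarrow> trace" where
  "accessed tr = filter (\<lambda>a. a \<noteq> None) tr"

lemma accessed_simps [simp]:
  "accessed [] = []"
  "accessed (None # tr) = accessed tr"
  "accessed (Some a # tr) = Some a # accessed tr"
  "accessed (tr @ tr') = accessed tr @ accessed tr'"
  "accessed (replicate k None) = []"
  by (auto simp: accessed_def)

lemma cost_accessed: "cost B r (accessed tr) = cost B r tr"
  by (induction B r tr rule: cost.induct) auto

lemma recent_accessed: "recent B r (accessed tr) = recent B r tr"
  by (induction B r tr rule: recent.induct) auto

lemma confined_accessed: "confined W R (accessed tr) \<longleftrightarrow> confined W R tr"
  by (auto simp: confined_def accessed_def)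

text \<open>Accesses to two different blocks determine the recent list completely, whatever was
  there before; hence the fixed form of \<open>R\<close> in \<open>stream\<close>.\<close>

lemma touch_touch: "a \<noteq> d \<Longrightarrow> touch d (touch a r) = [d, a]"
proof -
  assume "a \<noteq> d"
  then have "touch a r = a # take 1 (removeAll a r)" by (simp add: touch.simps numeral_2_eq_2)
  then show ?thesis using \<open>a \<noteq> d\<close> by (simp add: touch.simps numeral_2_eq_2)
qed

text \<open>The potential argument for one pointer: an advance either raises the residue by 1 or
  drops it from \<open>B - 1\<close> to 0, which pays \<open>B\<close> for the miss in the new
  block.\<close>

lemma block_step: "0 < B \<Longrightarrow> B * (if Suc l div B = l div B then 0 else 1) + Suc l mod B = Suc (l mod (B::nat))"
  by (auto simp: mod_Suc div_Suc)

text \<open>Reading the next source word can evict only the old source block, the less recent of the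
  two; the write then misses only if it enters a new block itself.\<close>

lemma stream_cost:
  assumes B: "0 < B" and ne: "Suc l div B \<noteq> d div B" "Suc l div B \<noteq> Suc d div B"
  shows "B * cost B [d div B, l div B] [Some (Read (Suc l)), Some (Write (Suc d) v)] + Suc l mod B + Suc d mod B
    \<le> Suc (l mod B) + Suc (d mod B)"
proof -
  let ?a = "if Suc l div B = l div B then 0 else 1 :: nat"
  let ?d = "if Suc d div B = d div B then 0 else 1 :: nat"
  have "d div B \<in> set (touch (Suc l div B) [d div B, l div B])"
    using ne(1) by (simp add: touch.simps numeral_2_eq_2)
  then have "cost B [d div B, l div B] [Some (Read (Suc l)), Some (Write (Suc d) v)] \<le> ?a + ?d"
    by auto
  then have "B * cost B [d div B, l div B] [Some (Read (Suc l)), Some (Write (Suc d) v)] \<le> B * ?a + B * ?d"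
    by (metis add_mult_distrib2 mult_le_mono2)
  then show ?thesis using block_step[OF B, of l] block_step[OF B, of d] by linarith
qed

context gathering
begin

section \<open>The contents of the output and the cost of writing it\<close>

definition val :: "nat \<Rightarrow> nat" where
  "val pos = (let k = (LEAST k. pos < off (Suc k)) in m0 (src k + (pos - off k)))"

lemma val_eq: "off k \<le> pos \<Longrightarrow> pos < off k + len k \<Longrightarrow> val pos = m0 (src k + (pos - off k))"
proof -
  assume k: "off k \<le> pos" "pos < off k + len k"
  have "(LEAST k. pos < off (Suc k)) = k"
  proof (rule Least_equality)
    fix k' assume "pos < off (Suc k')"
    then show "k \<le> k'" using k(1) off_mono[of "Suc k'" k] by (cases "k \<le> k'") auto
  qed (use k in simp)
  then show ?thesis by (simp add: val_def)
qed

text \<open>Charges a change of bucket to the output position where it happens, so that the extra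
  misses can be added up over segments of the output.\<close>

definition begins :: "nat \<Rightarrow> nat" where
  "begins pos = (if \<exists>k<n. off k = pos then 1 else 0)"

lemma sum_begins: "(\<Sum>pos<u. begins pos) \<le> n"
proof -
  have "(\<Sum>pos<u. begins pos) = card {pos. pos < u \<and> (\<exists>k<n. off k = pos)}"
    unfolding begins_def by (simp add: sum.If_cases Int_def)
  also have "\<dots> \<le> card (off ` {..<n})" by (intro card_mono) auto
  also have "\<dots> \<le> n" using card_image_le[of "{..<n}" off] by simp
  finally show ?thesis .
qed

text \<open>When the current bucket is used up, only empty buckets lie between it and the bucket of
  \<open>pos\<close>. They change neither offset nor rank, so the next record has rank
  \<open>Suc (r 18)\<close> and its bucket begins exactly at \<open>pos\<close>.\<close>

lemma current_next:
  assumes cur: "current pos r" and pos: "pos < y"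
  obtains k where "k < n" "0 < len k" "off k \<le> pos" "pos < off k + len k"
    "r 22 \<noteq> 0 \<Longrightarrow> r 18 = rank k \<and> r 21 = src k + (pos - off k) \<and> r 22 = off k + len k - pos"
    "r 22 = 0 \<Longrightarrow> Suc (r 18) = rank k \<and> off k = pos"
proof -
  from cur obtain k where k: "k < n" "0 < len k" "off k \<le> pos" "pos \<le> off k + len k"
    "r 18 = rank k" "r 21 = src k + (pos - off k)" "r 22 = off k + len k - pos"
    unfolding current_def by blast
  show ?thesis
  proof (cases "r 22 = 0")
    case False
    then show ?thesis using k by (intro that[of k]) auto
  next
    case True
    then have pk: "pos = off (Suc k)" using k by simp
    obtain k' where k': "k' < n" "off k' \<le> pos" "pos < off k' + len k'" using exists_bucket[OF pos] by auto
    have "Suc k \<le> k'" using pk k'(3) off_mono[of "Suc k'" "Suc k"] by (cases "Suc k \<le> k'") auto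
    then have "off k' = off (Suc k)" "rank k' = rank (Suc k)"
      using k'(2) pk off_mono[of "Suc k" k'] rank_eq[of "Suc k" k'] by auto
    then show ?thesis using k k' True pk by (intro that[of k']) (auto simp: rank_Suc)
  qed
qed

abbreviation streams :: "nat \<Rightarrow> registers \<Rightarrow> trace \<Rightarrow> nat \<Rightarrow> bool" where
  "streams pos r ac a \<equiv>
    (if r 21 = a \<and> r 22 \<noteq> 0 then accessed ac = [Some (Read a), Some (Write (3 * y + pos) (val pos))]
     else begins pos = 1 \<and> (\<exists>i<y. accessed ac = [Some (Read (slot 3 i)), Some (Read a), Some (Write (3 * y + pos) (val pos))]))"

abbreviation copied :: "nat \<Rightarrow> registers \<Rightarrow> memory \<Rightarrow> trace \<Rightarrow> registers \<Rightarrow> memory \<Rightarrow> bool" where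
  "copied pos r m ac r' m' \<equiv>
    (if pos < y then \<exists>a. a < y \<and> m' = m(3 * y + pos := val pos) \<and> r' 21 = Suc a \<and> current (Suc pos) r' \<and> streams pos r ac a
     else m' = m \<and> accessed ac = [] \<and> (\<forall>j. j \<noteq> 19 \<longrightarrow> r' j = r j))"

lemma sp_copy_body:
  assumes b: "base c r" and r19: "r 19 = pos" and pos: "pos < 2 * y" and m: "tables m"
    and cur: "pos < y \<Longrightarrow> current pos r"
  shows "sp w copy_body (\<lambda>tr' r' m'. \<exists>ac. tr' = tr @ ac \<and> length ac = 19 \<and> base c r' \<and> r' 19 = Suc pos \<and> r' 23 = r 23 \<and>
     copied pos r m ac r' m') tr r m"
proof (cases "pos < y")
  case True
  note b' = baseD[OF b]
  obtain k where k: "k < n" "0 < len k" "off k \<le> pos" "pos < off k + len k"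
    and r0: "r 22 \<noteq> 0 \<Longrightarrow> r 18 = rank k \<and> r 21 = src k + (pos - off k) \<and> r 22 = off k + len k - pos"
    and r1: "r 22 = 0 \<Longrightarrow> Suc (r 18) = rank k \<and> off k = pos"
    using current_next[OF cur[OF True] True] by blast
  have rk: "rank k < y" using rank_le[of k] k(1) n_le by linarith
  have ok: "off k \<le> y" using off_le[of k] k(1) by simp
  define a where "a = src k + (pos - off k)"
  have a: "a < y" using src_le[OF k(1)] k(3,4) unfolding a_def by linarith
  have va: "m a = val pos" using m a val_eq[OF k(3,4)] by (simp add: tables_def input_def a_def)
  have sm: "rank k < 2 ^ w" "src k < 2 ^ w" "len k < 2 ^ w" "Suc a < 2 ^ w" "3 * y < 2 ^ w" "3 * y + pos < 2 ^ w" "Suc pos < 2 ^ w"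
     "off k + len k - pos - 1 < 2 ^ w"
    using rk src_le[OF k(1)] ok a True w yy y_ge by linarith+
  have g: "eval w r' (Reg 19 [<] Reg 4) = 1" if "r' 19 = pos" "r' 4 = y" for r'
    using that True w_pos by simp
  have z: "eval w r' (Reg 22 [=] Const 0) = (if r' 22 = 0 then 1 else 0)" for r'
    using w_pos by simp
  have e19: "eval w r' (Reg 19 [+] Const 1) = Suc pos" if "r' 19 = pos" for r'
    using that sm(7) by simp
  have est: "eval w r' ((Const 3 [*] Reg 4) [+] Reg 19) = 3 * y + pos" if "r' 4 = y" "r' 19 = pos" for r'
    using that sm(5,6) by simp
  have e21: "eval w r' (Reg 21 [+] Const 1) = Suc a" if "r' 21 = a" for r'
    using that sm(4) by simp
  have e22: "eval w r' (Reg 22 [-] Const 1) = off k + len k - pos - 1" if "r' 22 = off k + len k - pos" for r'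
    using that sm(8) by simp
  have e18: "eval w r' (Reg 18 [+] Const 1) = rank k" if "Suc (r' 18) = rank k" for r'
    using that sm(1) by simp
  have e20: "eval w r' (slotx 3 (Reg 18)) = slot 3 (rank k)" if "r' 4 = y" "r' 18 = rank k" for r'
    by (rule eval_slotx) (use that rk in simp_all)
  have ed: "eval w r' (Reg 20 [/] Reg 5) = src k" if "r' 20 = src k * (y + 1) + len k" "r' 5 = y + 1" for r'
    unfolding eval_simps that packed[OF k(1)] by (rule mod_less[OF sm(2)])
  have em: "eval w r' (Reg 20 [%] Reg 5) = len k" if "r' 20 = src k * (y + 1) + len k" "r' 5 = y + 1" for r'
    unfolding eval_simps that packed[OF k(1)] by (rule mod_less[OF sm(3)])
  have m3: "m (slot 3 (rank k)) = src k * (y + 1) + len k" using m k by (simp add: tables_def)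
  have cur': "current (Suc pos) r'" if "r' 18 = rank k" "r' 21 = Suc a" "r' 22 = off k + len k - pos - 1" for r'
    unfolding current_def using that k by (intro exI[of _ k]) (auto simp: a_def)
  show ?thesis
  proof (cases "r 22 = 0")
    case Z: True
    have r18: "Suc (r 18) = rank k" and op: "off k = pos" using r1[OF Z] by auto
    have beg: "begins pos = 1" using k(1) op by (auto simp: begins_def)
    have as: "a = src k" "off k + len k - pos = len k" using op by (simp_all add: a_def)
    have e21': "eval w r' (Reg 21 [+] Const 1) = Suc a" if "r' 21 = src k" for r'
      using e21 that as by simp
    have e22': "eval w r' (Reg 22 [-] Const 1) = off k + len k - pos - 1" if "r' 22 = len k" for r'
      using e22 that as by simp
    have va': "m (src k) = val pos" using va as by simp
    have "sp w copy_body (\<lambda>tr' r' m'. \<exists>ac. tr' = tr @ ac \<and> length ac = 19 \<and> base c r' \<and> r' 19 = Suc pos \<and> r' 23 = r 23 \<and>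
        m' = m(3 * y + pos := val pos) \<and> r' 21 = Suc a \<and> current (Suc pos) r' \<and>
        accessed ac = [Some (Read (slot 3 (rank k))), Some (Read (src k)), Some (Write (3 * y + pos) (val pos))]) tr r m"
      by (simp add: copy_body_def guard_def base_def Z b' r19 r18 g z e19 est e21' e22' e18 e20 ed em m3 va' cur'
        del: eval.simps(3) One_nat_def)
    then show ?thesis
      by (rule sp_mono) (use True a beg rk Z as in auto)
  next
    case Z: False
    have r18: "r 18 = rank k" "r 21 = a" "r 22 = off k + len k - pos" using r0[OF Z] by (auto simp: a_def)
    have Z': "off k + len k - pos \<noteq> 0" using k(4) by simp
    have "sp w copy_body (\<lambda>tr' r' m'. \<exists>ac. tr' = tr @ ac \<and> length ac = 19 \<and> base c r' \<and> r' 19 = Suc pos \<and> r' 23 = r 23 \<and>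
        m' = m(3 * y + pos := val pos) \<and> r' 21 = Suc a \<and> current (Suc pos) r' \<and>
        accessed ac = [Some (Read a), Some (Write (3 * y + pos) (val pos))]) tr r m"
      using Z' by (simp add: copy_body_def guard_def base_def b' r19 r18 g z e19 est e21 e22 va cur'
        del: eval.simps(3) One_nat_def diff_is_0_eq diff_is_0_eq')
    then show ?thesis
      by (rule sp_mono) (use True a Z r18 in auto)
  qed
next
  case False
  note b' = baseD[OF b]
  have sm: "Suc pos < 2 ^ w" using pos w yy y_ge by linarith
  have g: "eval w r' (Reg 19 [<] Reg 4) = 0" if "r' 19 = pos" "r' 4 = y" for r'
    using that False w_pos by simp
  have e19: "eval w r' (Reg 19 [+] Const 1) = Suc pos" if "r' 19 = pos" for r'
    using that sm by simp
  show ?thesis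
    by (simp add: copy_body_def guard_def base_def False b' r19 g e19 del: eval.simps(3) One_nat_def)
qed

text \<open>
  \<open>P\<close> is the next output position, \<open>R\<close> the recent blocks, \<open>K\<close> the misses so far and \<open>a\<close> the next source
  address. The two residues are a potential: every word adds 2, a word in a new block releases
  the \<open>B\<close> saved up for it, and a new bucket may cost 3 misses and reset both residues.
\<close>

definition stream :: "nat \<Rightarrow> nat \<Rightarrow> nat list \<Rightarrow> nat \<Rightarrow> nat \<Rightarrow> bool" where
  "stream st P R K a \<longleftrightarrow> (P = st \<and> K = 0) \<or>
     (st < P \<and> R = [(3 * y + P - 1) div B, (a - 1) div B] \<and> 1 \<le> a \<and>
      B * K + (a - 1) mod B + (3 * y + P - 1) mod B \<le> 2 * (P - st) + B * (6 * (\<Sum>pos=st..<P. begins pos) + 5))"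

text \<open>Source and destination never share a block, as the source lies below \<open>y\<close>
  and the output starts at \<open>3 * y\<close>. While both pointers advance by one, the potential
  pays for the misses. At the first word of a segment up to three misses and two fresh residues
  below \<open>B\<close> amount to at most \<open>5 * B\<close>, the origin of the 5; the same holds
  at a new bucket, where \<open>6 * B\<close> is allowed.\<close>

lemma stream_step:
  assumes inv: "stream st P R K a" and P: "st \<le> P" "P < y" and a': "a' < y"
    and ac: "if a = a' \<and> z then accessed ac = [Some (Read a'), Some (Write (3 * y + P) v)]
       else begins P = 1 \<and> (\<exists>i. accessed ac = [Some (Read (slot 3 i)), Some (Read a'), Some (Write (3 * y + P) v)])"
  shows "stream st (Suc P) (recent B R ac) (K + cost B R ac) (Suc a')"
proof -
  have Bp: "0 < B" using B by simp
  have nb: "a' div B \<noteq> (3 * y + u) div B" for u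
    by (rule distinct_blocks) (use a' B_le Bp in linarith)+
  have rec: "recent B R ac = [(3 * y + P) div B, a' div B]"
    unfolding recent_accessed[of B R ac, symmetric] using ac touch_touch[OF nb[of P]] by (auto split: if_splits)
  have acc3: "accesses (accessed ac) \<le> 3" using ac by (auto split: if_splits)
  have c3: "cost B R ac \<le> 3"
    using cost_le_accesses[of B R "accessed ac"] acc3 unfolding cost_accessed by linarith
  then have Bc3: "B * cost B R ac \<le> 3 * B" by (simp add: mult.commute)
  have md: "a' mod B < B" "(3 * y + P) mod B < B" using Bp by simp_all
  have sm: "(\<Sum>pos=st..<Suc P. begins pos) = (\<Sum>pos=st..<P. begins pos) + begins P" using P by simp
  define b where "b = (\<Sum>pos=st..<P. begins pos)"
  have goal: "stream st (Suc P) (recent B R ac) (K + cost B R ac) (Suc a')"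
    if "B * (K + cost B R ac) + a' mod B + (3 * y + P) mod B \<le> 2 * (Suc P - st) + B * (6 * (b + begins P) + 5)"
    unfolding stream_def using that P(1) rec sm by (simp add: b_def)
  from inv[unfolded stream_def b_def[symmetric]] show ?thesis
  proof
    assume *: "P = st \<and> K = 0"
    have "B * (6 * (b + begins P) + 5) = 6 * (B * (b + begins P)) + 5 * B" by (simp add: algebra_simps)
    moreover have "B * (K + cost B R ac) = B * cost B R ac" "2 * (Suc P - st) = 2" using * by simp_all
    ultimately show ?thesis using Bc3 md by (intro goal) linarith
  next
    assume *: "st < P \<and> R = [(3 * y + P - 1) div B, (a - 1) div B] \<and> 1 \<le> a \<and>
      B * K + (a - 1) mod B + (3 * y + P - 1) mod B \<le> 2 * (P - st) + B * (6 * b + 5)"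
    show ?thesis
    proof (cases "a = a' \<and> z")
      case True
      then have acs: "accessed ac = [Some (Read (Suc (a - 1))), Some (Write (Suc (3 * y + P - 1)) v)]" using ac * y_ge by simp
      have e: "Suc (a - 1) = a'" "Suc (3 * y + P - 1) = 3 * y + P" "3 * y + P - 1 = 3 * y + (P - 1)" using True * y_ge by auto
      have "B * cost B R (accessed ac) + Suc (a - 1) mod B + Suc (3 * y + P - 1) mod B
        \<le> Suc ((a - 1) mod B) + Suc ((3 * y + P - 1) mod B)"
        unfolding acs using stream_cost[OF Bp, of "a - 1" "3 * y + P - 1" v] nb[of "P - 1"] nb[of P] * unfolding e by simp
      then have "B * cost B R ac + a' mod B + (3 * y + P) mod B \<le> Suc ((a - 1) mod B) + Suc ((3 * y + P - 1) mod B)"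
        unfolding cost_accessed e(1,2) .
      moreover have "B * (K + cost B R ac) = B * K + B * cost B R ac" "B * (6 * (b + begins P) + 5) = B * (6 * b + 5) + 6 * (B * begins P)"
        by (simp_all add: algebra_simps)
      moreover have "2 * (Suc P - st) = 2 * (P - st) + 2" using * by (simp add: Suc_diff_le)
      ultimately show ?thesis using * by (intro goal) linarith
    next
      case False
      then have "begins P = 1" using ac by simp
      then have "B * (6 * (b + begins P) + 5) = B * (6 * b + 5) + 6 * B" by (simp add: algebra_simps)
      moreover have "B * (K + cost B R ac) = B * K + B * cost B R ac" by (simp add: algebra_simps)
      moreover have "2 * (Suc P - st) = 2 * (P - st) + 2" using * by (simp add: Suc_diff_le)
      ultimately show ?thesis using * Bc3 md by (intro goal) linarith
    qed
  qed
qed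

lemma stream_bound:
  assumes "stream st P R K a" "P \<le> st + N"
  shows "K \<le> 2 * N div B + 6 * (\<Sum>pos=st..<st+N. begins pos) + 5"
proof -
  have "(\<Sum>pos=st..<P. begins pos) \<le> (\<Sum>pos=st..<st+N. begins pos)"
    using assms(2) by (intro sum_mono2) auto
  then have le: "B * (6 * (\<Sum>pos=st..<P. begins pos) + 5) \<le> B * (6 * (\<Sum>pos=st..<st+N. begins pos) + 5)"
    by (intro mult_le_mono2) simp
  have "B * K \<le> 2 * N + B * (6 * (\<Sum>pos=st..<st+N. begins pos) + 5)"
  proof (cases "P = st \<and> K = 0")
    case False
    then have "B * K \<le> 2 * (P - st) + B * (6 * (\<Sum>pos=st..<P. begins pos) + 5)" "P - st \<le> N"
      using assms unfolding stream_def by linarith+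
    then show ?thesis using le by linarith
  qed simp
  then have "B * K div B \<le> (2 * N + B * (6 * (\<Sum>pos=st..<st+N. begins pos) + 5)) div B"
    by (rule div_le_mono)
  then show ?thesis using B by simp
qed

text \<open>Cut off at \<open>Suc y\<close> rather than \<open>y\<close> because it also serves the
  output boundaries, whose indices reach \<open>t \<le> y\<close>.\<close>

abbreviation segment :: "nat \<Rightarrow> nat \<Rightarrow> nat \<Rightarrow> nat \<Rightarrow> nat set" where
  "segment b o' N c \<equiv> (\<lambda>pos. b + pos) ` {c * s + o'..<min (c * s + o' + N) (Suc y)}"

text \<open>A phase leaves \<open>s - N \<ge> B - 1\<close> words unwritten between the segments of
  neighbouring cores, which puts the words on either side at least \<open>B\<close> apart.\<close>

lemma segments_apart:
  assumes "N + B \<le> s + 1" "c < c'" "pos < c * s + o' + N" "c' * s + o' \<le> pos'"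
  shows "pos + B \<le> pos'"
proof -
  have "c * s + s \<le> c' * s" using mult_le_mono1[of "Suc c" c' s] assms(2) by simp
  then show ?thesis using assms by linarith
qed

lemma segments_disjoint:
  assumes N: "N + B \<le> s + 1" and b: "b + y \<le> 7 * y" "3 * y \<le> b"
  shows "block_disjoint p B (segment b o' N)
     (\<lambda>_. {..<y} \<union> range (slot K))"
  unfolding block_disjoint_def
proof (intro allI impI)
  fix c c' a a'
  assume *: "c < p" "c' < p" "c \<noteq> c'" "a \<in> segment b o' N c"
    "a' \<in> segment b o' N c' \<union> ({..<y} \<union> range (slot K))"
  have Bp: "0 < B" using B by simp
  from *(4) obtain pos where pos: "a = b + pos" "c * s + o' \<le> pos" "pos < c * s + o' + N" "pos \<le> y"
    unfolding image_iff by auto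
  from *(5) consider pos' where "a' = b + pos'" "c' * s + o' \<le> pos'" "pos' < c' * s + o' + N" | "a' < y" | i where "a' = slot K i"
    unfolding image_iff Un_iff by auto
  then show "a div B \<noteq> a' div B"
  proof cases
    case 1
    show ?thesis
    proof (cases "c < c'")
      case True
      then have "pos + B \<le> pos'" using segments_apart[OF N _ pos(3) 1(2)] by blast
      then show ?thesis using pos(1) 1(1) Bp by (intro distinct_blocks) auto
    next
      case False
      then have "c' < c" using *(3) by simp
      then have "pos' + B \<le> pos" using segments_apart[OF N _ 1(3) pos(2)] by blast
      then have "a' div B \<noteq> a div B" using pos(1) 1(1) Bp by (intro distinct_blocks) auto
      then show ?thesis by simp
    qed
  next
    case 2
    have "a' div B \<noteq> a div B" by (rule distinct_blocks) (use 2 pos b B_le Bp in linarith)+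
    then show ?thesis by simp
  next
    case 3
    have "a + B \<le> a'"
    proof -
      have "y * 8 \<le> y * (8 + K * y + i)" by (rule mult_le_mono2) simp
      then show ?thesis using 3 pos b B_le unfolding slot_def by linarith
    qed
    then show ?thesis by (rule distinct_blocks[OF _ Bp])
  qed
qed

lemma tables_frame:
  assumes F: "\<And>a. (\<And>c. c < p \<Longrightarrow> a \<notin> segment b o' N c) \<Longrightarrow> m' a = m a"
    and b: "3 * y \<le> b" "b \<le> 5 * y" and m: "tables m"
  shows "tables m'"
proof -
  have "m' (slot K j) = m (slot K j)" for K j
  proof (rule F)
    fix c
    have "b + pos \<noteq> slot K j" if "pos \<le> y" for pos using slot_low[of "b + pos" K j] that b y_ge by force
    then show "slot K j \<notin> segment b o' N c"
      unfolding image_iff by (metis atLeastLessThan_iff less_Suc_eq_le min_less_iff_conj)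
  qed
  moreover have "m' a = m a" if "a < 3 * y" for a
    by (rule F) (use that b in auto)
  ultimately show ?thesis using m by (simp add: tables_def input_def)
qed

abbreviation aligned :: "nat \<Rightarrow> assertion" where
  "aligned o' S m \<equiv> (\<forall>c<p. base c (S c) \<and> S c 19 = c * s + o' \<and> (c * s + o' < y \<longrightarrow> current (c * s + o') (S c))) \<and> tables m"

abbreviation copied_by :: "nat \<Rightarrow> nat \<Rightarrow> nat \<Rightarrow> registers \<Rightarrow> memory \<Rightarrow> bool" where
  "copied_by o' N c r m \<equiv> base c r \<and> r 19 = c * s + o' + N \<and> (c * s + o' + N < y \<longrightarrow> current (c * s + o' + N) r) \<and>
     (\<forall>pos. c * s + o' \<le> pos \<longrightarrow> pos < c * s + o' + N \<longrightarrow> pos < y \<longrightarrow> m (3 * y + pos) = val pos)"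

text \<open>One rule for both halves of the output ranges. \<open>D\<close> collects positions
  already written that must survive; if such a position were written again, it would receive the
  same \<open>val\<close>.\<close>

lemma par_copy:
  assumes N: "N + B \<le> s + 1" "o' + N \<le> s" and D: "D \<subseteq> {..<y}"
    and e: "\<And>c r. c < p \<Longrightarrow> base c r \<Longrightarrow> r 19 = c * s + o' \<Longrightarrow> eval w r e = c * s + o' + N"
  shows "phase
     (\<lambda>S m. aligned o' S m \<and>
        (\<forall>pos\<in>D. m (3 * y + pos) = val pos))
     (copy_code e) (21 * N + 3) (\<Sum>c<p. 2 * N div B + 6 * (\<Sum>pos=c*s+o'..<c*s+o'+N. begins pos) + 5)
     (\<lambda>S m. (\<forall>c<p. base c (S c) \<and> S c 19 = c * s + o' + N \<and> (c * s + o' + N < y \<longrightarrow> current (c * s + o' + N) (S c))) \<and> tables m \<and>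
        (\<forall>pos\<in>D. m (3 * y + pos) = val pos) \<and>
        (\<forall>c<p. \<forall>pos. c * s + o' \<le> pos \<longrightarrow> pos < c * s + o' + N \<longrightarrow> pos < y \<longrightarrow> m (3 * y + pos) = val pos))"
proof (rule par_phase_local[where W = "segment (3 * y) o' N" and R = "\<lambda>_. {..<y} \<union> range (slot 3)" and
   Q = "copied_by o' N"])
  show "block_disjoint p B (segment (3 * y) o' N) (\<lambda>_. {..<y} \<union> range (slot 3))"
    by (rule segments_disjoint[OF N(1)]) auto
next
  fix S m c
  assume pre: "aligned o' S m \<and>
        (\<forall>pos\<in>D. m (3 * y + pos) = val pos)" and c: "c < p"
  define st where "st = c * s + o'"
  define r where "r = S c"
  have r: "base c r" "r 19 = st" "st < y \<Longrightarrow> current st r" using pre c by (auto simp: r_def st_def)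
  have tab: "tables m" using pre by simp
  have stN: "st + N \<le> 2 * y" using s_bounds(2)[OF c] N(2) unfolding st_def by linarith
  define W where "W = (\<lambda>pos. 3 * y + pos) ` {st..<min (st + N) (Suc y)}"
  define R where "R = {..<y} \<union> range (slot 3)"
  \<comment> \<open>The next position to be written, clamped at \<open>y\<close>. For a segment that
    starts at or beyond \<open>y\<close> it stays at \<open>st\<close>, and no miss is ever
    charged.\<close>
  define P where "P i = max st (min (st + i) y)" for i
  define I where "I i tr r m' \<longleftrightarrow> length tr = 2 + i * 21 \<and> confined W R tr \<and> base c r \<and> r 19 = st + i \<and> r 23 = st + N \<and> tables m' \<and>
     (st < y \<longrightarrow> current (min (st + i) y) r) \<and> (\<forall>pos. st \<le> pos \<longrightarrow> pos < st + i \<longrightarrow> pos < y \<longrightarrow> m' (3 * y + pos) = val pos) \<and>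
     stream st (P i) (recent B [] tr) (cost B [] tr) (r 21)" for i tr r m'
  define Q where "Q tr s' m' \<longleftrightarrow> length tr = 21 * N + 3 \<and> confined W R tr \<and>
     cost B [] tr \<le> 2 * N div B + 6 * (\<Sum>pos=st..<st+N. begins pos) + 5 \<and>
     base c s' \<and> s' 19 = st + N \<and> (st + N < y \<longrightarrow> current (st + N) s') \<and>
     (\<forall>pos. st \<le> pos \<longrightarrow> pos < st + N \<longrightarrow> pos < y \<longrightarrow> m' (3 * y + pos) = val pos)" for tr s' m'
  have e': "eval w r e = st + N" using e[OF c] r by (simp add: st_def)
  have prep: "sp w (Assign 23 e) (\<lambda>tr. I 0 (tr @ [None])) [] r m"
    using r e' tab by (simp add: I_def base_def P_def stream_def current_def)
  have "wp w (copy_code e) Q [] r m"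
    unfolding copy_code_def
  proof (rule wp_prepared_While[where I = I and N = N, OF prep])
    fix i tr r m' assume i: "i < N" and I: "I i tr r m'"
    show "eval w r (Reg 19 [<] Reg 23) \<noteq> 0" using I i w_pos by (auto simp: I_def)
    have I': "base c r" "r 19 = st + i" "tables m'" "st + i < y \<Longrightarrow> current (st + i) r" "st + i < 2 * y"
      using I i stN by (auto simp: I_def min_def)
    show "sp w copy_body (\<lambda>tr. I (Suc i) (tr @ [None])) (tr @ [None]) r m'"
    proof (rule sp_mono[OF sp_copy_body[OF I'(1,2,5,3,4)]])
      fix tr' r' m''
      assume *: "\<exists>ac. tr' = (tr @ [None]) @ ac \<and> length ac = 19 \<and> base c r' \<and> r' 19 = Suc (st + i) \<and> r' 23 = r 23 \<and>
        copied (st + i) r m' ac r' m''"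
      then obtain ac where ac: "tr' = (tr @ [None]) @ ac" "length ac = 19" "base c r'" "r' 19 = Suc (st + i)" "r' 23 = r 23"
        and br: "copied (st + i) r m' ac r' m''" by blast
      show "I (Suc i) (tr' @ [None]) r' m''"
      proof (cases "st + i < y")
        case True
        then obtain a where a: "a < y" "m'' = m'(3 * y + (st + i) := val (st + i))" "r' 21 = Suc a" "current (Suc (st + i)) r'"
        and acs: "streams (st + i) r ac a"
        using br by (simp only: if_True) blast
        have PP: "P i = st + i" "P (Suc i) = Suc (st + i)" using True by (auto simp: P_def)
        have inW: "3 * y + (st + i) \<in> W" using i True by (auto simp: W_def)
        have "confined W R (accessed ac)"
        using acs inW a(1) by (auto simp: R_def split: if_splits)
        then have cf: "confined W R ac" by (simp add: confined_accessed)
        have str: "stream st (Suc (st + i)) (recent B (recent B [] tr) ac) (cost B [] tr + cost B (recent B [] tr) ac) (Suc a)"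
        proof (rule stream_step)
        show "stream st (st + i) (recent B [] tr) (cost B [] tr) (r 21)" using I PP(1) by (simp add: I_def)
        show "if r 21 = a \<and> r 22 \<noteq> 0 then accessed ac = [Some (Read a), Some (Write (3 * y + (st + i)) (val (st + i)))]
        else begins (st + i) = 1 \<and> (\<exists>j. accessed ac = [Some (Read (slot 3 j)), Some (Read a), Some (Write (3 * y + (st + i)) (val (st + i)))])"
        using acs by (auto split: if_splits)
        qed (use True a in auto)
        have nt: "3 * y + (st + i) \<noteq> slot K j" for K j using slot_low[of "3 * y + (st + i)" K j] True by auto
        have tab': "tables m''" using I nt[symmetric] unfolding a(2) by (simp add: I_def tables_def input_def)
        have vals: "m'' (3 * y + pos) = val pos" if "st \<le> pos" "pos < st + Suc i" "pos < y" for pos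
        using I that unfolding a(2) by (cases "pos = st + i") (auto simp: I_def)
        show ?thesis
        unfolding I_def using I ac a(3,4) cf str PP tab' vals True
        by (simp add: I_def)
      next
        case False
        then have a: "m'' = m'" "accessed ac = []" "\<And>j. j \<noteq> 19 \<Longrightarrow> r' j = r j" using br by simp_all
        have cf: "confined W R ac" using a(2) confined_accessed[of W R ac] by simp
        have cr: "recent B u ac = u" "cost B u ac = 0" for u
        using recent_accessed[of B u ac] cost_accessed[of B u ac] a(2) by simp_all
        show ?thesis
        proof (cases "st < y")
        case True
        then have PP: "P (Suc i) = y" "P i = y" "min (st + i) y = y" "min (st + Suc i) y = y" using False by (auto simp: P_def)
        have cu: "current y r'" using I True PP a(3) by (simp add: I_def current_def)
        have "\<And>pos. st \<le> pos \<Longrightarrow> pos < st + Suc i \<Longrightarrow> pos < y \<Longrightarrow> m'' (3 * y + pos) = val pos"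
        using I False unfolding a(1) by (simp add: I_def)
        then show ?thesis using I ac cf cr PP a(1,3) cu by (simp add: I_def)
        next
        case st: False
        then have PP: "P (Suc i) = st" "P i = st" by (auto simp: P_def)
        have "cost B [] tr = 0" using I PP by (simp add: I_def stream_def)
        then show ?thesis using I ac a cf cr PP st False by (simp add: I_def stream_def)
        qed
      qed
    qed
  next
    fix tr r m' assume I: "I N tr r m'"
    have "P N \<le> st + N" by (simp add: P_def)
    then have "cost B [] tr \<le> 2 * N div B + 6 * (\<Sum>pos=st..<st+N. begins pos) + 5"
      using I by (intro stream_bound) (auto simp: I_def)
    then show "Q (tr @ [None]) r m'" using I by (auto simp: I_def Q_def min_def)
    show "eval w r (Reg 19 [<] Reg 23) = 0" using I by (simp add: I_def)
  qed
  then show "wp w (copy_code e) (\<lambda>tr s' m'. length tr = 21 * N + 3 \<and>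
      confined (segment (3 * y) o' N c) ({..<y} \<union> range (slot 3)) tr \<and>
      cost B [] tr \<le> 2 * N div B + 6 * (\<Sum>pos=c*s+o'..<c*s+o'+N. begins pos) + 5 \<and>
      copied_by o' N c s' m') [] (S c) m"
    unfolding Q_def r_def W_def R_def st_def .
next
  fix S m S' m'
  assume pre: "aligned o' S m \<and>
        (\<forall>pos\<in>D. m (3 * y + pos) = val pos)"
    and Q: "\<And>c. c < p \<Longrightarrow> copied_by o' N c (S' c) m'"
    and F: "\<And>a. (\<And>c. c < p \<Longrightarrow> a \<notin> segment (3 * y) o' N c) \<Longrightarrow> m' a = m a"
  show "(\<forall>c<p. base c (S' c) \<and> S' c 19 = c * s + o' + N \<and> (c * s + o' + N < y \<longrightarrow> current (c * s + o' + N) (S' c))) \<and> tables m' \<and>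
        (\<forall>pos\<in>D. m' (3 * y + pos) = val pos) \<and>
        (\<forall>c<p. \<forall>pos. c * s + o' \<le> pos \<longrightarrow> pos < c * s + o' + N \<longrightarrow> pos < y \<longrightarrow> m' (3 * y + pos) = val pos)"
  proof (intro conjI)
    show "tables m'" by (rule tables_frame[OF F]) (use pre in auto)
    show "\<forall>pos\<in>D. m' (3 * y + pos) = val pos"
    proof
      fix pos assume pos: "pos \<in> D"
      show "m' (3 * y + pos) = val pos"
      proof (cases "\<exists>c<p. c * s + o' \<le> pos \<and> pos < c * s + o' + N")
        case True
        then show ?thesis using Q pos D by blast
      next
        case False
        then have "m' (3 * y + pos) = m (3 * y + pos)" by (intro F) auto
        then show ?thesis using pre pos by simp
      qed
    qed
  qed (use Q in blast)+
qed (use p B MB in auto)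

end

section \<open>The output boundaries\<close>

text \<open>The closing boundary, with index \<open>t\<close>, belongs to no column, so
  \<open>y\<close> itself is stored. Both branches of the inner conditional take one step, which
  keeps the timing uniform.\<close>

definition bound_body :: com where
  "bound_body = Seq (guard (Reg 19 [<] (Reg 3 [+] Const 1)) (seqs
     [Cond (Reg 19 [<] Reg 3) (Load 24 (slotx 2 (Reg 19))) (Assign 24 (Reg 4)),
      Store ((Const 5 [*] Reg 4) [+] Reg 19) (Reg 24)]))
     (Assign 19 (Reg 19 [+] Const 1))"

definition bound_code :: "expr \<Rightarrow> expr \<Rightarrow> com" where
  "bound_code b e = Seq (seqs [Assign 19 b, Assign 23 e]) (While (Reg 19 [<] Reg 23) bound_body)"

definition half :: expr where "half = Reg 7 [/] Const 2"

definition gather :: com where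
  "gather = seqs
     [init_code,
      count_code,
      scan 0 (Reg 16 [+] Reg 14),
      place_code,
      locate_code,
      seek_code,
      copy_code (Reg 19 [+] half),
      copy_code ((Reg 0 [+] Const 1) [*] Reg 7),
      bound_code (Reg 0 [*] Reg 7) (Reg 19 [+] half),
      bound_code ((Reg 0 [*] Reg 7) [+] half) ((Reg 0 [+] Const 1) [*] Reg 7)]"

context gathering
begin

definition bnd :: "nat \<Rightarrow> nat" where "bnd j = (if j < t then off (j * x) else y)"

definition active :: "nat \<Rightarrow> nat" where "active j = (if j \<le> t then 1 else 0)"

lemma t_le: "t \<le> y"
  using xt_pos n_le by (metis dual_order.trans mult_le_mono1 nat_mult_1 Suc_leI One_nat_def)

lemma sum_active: "(\<Sum>j<u. active j) \<le> t + 1"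
proof -
  have "(\<Sum>j<u. active j) = card {j. j < u \<and> j \<le> t}"
    unfolding active_def by (simp add: sum.If_cases Int_def)
  also have "\<dots> \<le> card {..t}" by (intro card_mono) auto
  finally show ?thesis by simp
qed

lemma sp_bound_body:
  assumes b: "base c r" and r19: "r 19 = j" and j: "j < 2 * y" and m: "tables m"
  shows "sp w bound_body (\<lambda>tr' r' m'. \<exists>ac. tr' = tr @ ac \<and> length ac = 7 \<and> base c r' \<and> r' 19 = Suc j \<and> r' 23 = r 23 \<and>
     accesses ac \<le> 2 * active j \<and> m' = (if j \<le> t then m(5 * y + j := bnd j) else m) \<and>
     confined (if j \<le> t then {5 * y + j} else {}) (range (slot 2)) ac) tr r m"
proof -
  note b' = baseD[OF b]
  have sm: "Suc j < 2 ^ w" "5 * y < 2 ^ w" "5 * y + j < 2 ^ w" "t + 1 < 2 ^ w"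
    using j t_le w yy y_ge by linarith+
  have g: "eval w r' (Reg 19 [<] (Reg 3 [+] Const 1)) = (if j \<le> t then 1 else 0)" if "r' 19 = j" "r' 3 = t" for r'
    using that sm w_pos by (simp add: less_Suc_eq_le)
  have g2: "eval w r' (Reg 19 [<] Reg 3) = (if j < t then 1 else 0)" if "r' 19 = j" "r' 3 = t" for r'
    using that w_pos by simp
  have e19: "eval w r' (Reg 19 [+] Const 1) = Suc j" if "r' 19 = j" for r'
    using that sm by simp
  have est: "eval w r' ((Const 5 [*] Reg 4) [+] Reg 19) = 5 * y + j" if "r' 4 = y" "r' 19 = j" for r'
    using that sm by simp
  have e2: "eval w r' (slotx 2 (Reg 19)) = slot 2 j" if "r' 4 = y" "r' 19 = j" "j < t" for r'
    by (rule eval_slotx) (use that t_le in simp_all)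
  have m2: "m (slot 2 j) = off (j * x)" if "j < t"
  proof -
    have "j * x < n" using that xt_pos by (simp add: mult.commute)
    moreover have "\<forall>k<n. x dvd k \<longrightarrow> m (slot 2 (k div x)) = off k" using m unfolding tables_def by blast
    ultimately have "m (slot 2 (j * x div x)) = off (j * x)" using dvd_triv_right by blast
    then show ?thesis using xt_pos by simp
  qed
  consider "j < t" | "j = t" | "t < j" by linarith
  then show ?thesis
    by cases (simp_all add: bound_body_def guard_def base_def b' r19 g g2 e19 est e2 m2 bnd_def active_def del: eval.simps(3) One_nat_def)
qed

abbreviation contents :: "memory \<Rightarrow> bool" where
  "contents m \<equiv> \<forall>pos<y. m (3 * y + pos) = val pos"

abbreviation bounded_by :: "nat \<Rightarrow> nat \<Rightarrow> nat \<Rightarrow> registers \<Rightarrow> memory \<Rightarrow> bool" where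
  "bounded_by o' N c r m \<equiv> base c r \<and>
     (\<forall>j. c * s + o' \<le> j \<longrightarrow> j < c * s + o' + N \<longrightarrow> j \<le> t \<longrightarrow> m (5 * y + j) = bnd j)"

lemma par_bound:
  assumes N: "N + B \<le> s + 1" "o' + N \<le> s" and D: "D \<subseteq> {..t}"
    and b: "\<And>c r. c < p \<Longrightarrow> base c r \<Longrightarrow> eval w r b = c * s + o'"
    and e: "\<And>c r. c < p \<Longrightarrow> base c r \<Longrightarrow> r 19 = c * s + o' \<Longrightarrow> eval w r e = c * s + o' + N"
  shows "phase
     (\<lambda>S m. (\<forall>c<p. base c (S c)) \<and> tables m \<and> contents m \<and> (\<forall>j\<in>D. m (5 * y + j) = bnd j))
     (bound_code b e) (9 * N + 5) (\<Sum>c<p. 2 * (\<Sum>j=c*s+o'..<c*s+o'+N. active j))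
     (\<lambda>S m. (\<forall>c<p. base c (S c)) \<and> tables m \<and> contents m \<and> (\<forall>j\<in>D. m (5 * y + j) = bnd j) \<and>
        (\<forall>c<p. \<forall>j. c * s + o' \<le> j \<longrightarrow> j < c * s + o' + N \<longrightarrow> j \<le> t \<longrightarrow> m (5 * y + j) = bnd j))"
proof (rule par_phase_local[where W = "segment (5 * y) o' N" and R = "\<lambda>_. {..<y} \<union> range (slot 2)" and
   Q = "bounded_by o' N"])
  show "block_disjoint p B (segment (5 * y) o' N) (\<lambda>_. {..<y} \<union> range (slot 2))"
    by (rule segments_disjoint[OF N(1)]) auto
next
  fix S m c
  assume pre: "(\<forall>c<p. base c (S c)) \<and> tables m \<and> contents m \<and> (\<forall>j\<in>D. m (5 * y + j) = bnd j)" and c: "c < p"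
  define st where "st = c * s + o'"
  define r where "r = S c"
  have r: "base c r" using pre c by (auto simp: r_def)
  have tab: "tables m" using pre by simp
  have stN: "st + N \<le> 2 * y" using s_bounds(2)[OF c] N(2) unfolding st_def by linarith
  define W where "W = (\<lambda>pos. 5 * y + pos) ` {st..<min (st + N) (Suc y)}"
  define R where "R = {..<y} \<union> range (slot 2)"
  define I where "I i tr r m' \<longleftrightarrow> length tr = 4 + i * 9 \<and> confined W R tr \<and> base c r \<and> r 19 = st + i \<and> r 23 = st + N \<and> tables m' \<and>
     (\<forall>j. st \<le> j \<longrightarrow> j < st + i \<longrightarrow> j \<le> t \<longrightarrow> m' (5 * y + j) = bnd j) \<and>
     accesses tr \<le> 2 * (\<Sum>j=st..<st+i. active j)" for i tr r m'
  define Q where "Q tr s' m' \<longleftrightarrow> length tr = 9 * N + 5 \<and> confined W R tr \<and> cost B [] tr \<le> 2 * (\<Sum>j=st..<st+N. active j) \<and>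
     base c s' \<and> (\<forall>j. st \<le> j \<longrightarrow> j < st + N \<longrightarrow> j \<le> t \<longrightarrow> m' (5 * y + j) = bnd j)" for tr s' m'
  have b': "eval w r b = st" using b[OF c r] by (simp add: st_def)
  have e': "eval w (r(19 := st)) e = st + N" using e[OF c, of "r(19 := st)"] r by (simp add: st_def base_def)
  have prep: "sp w (seqs [Assign 19 b, Assign 23 e]) (\<lambda>tr. I 0 (tr @ [None])) [] r m"
    using r b' e' tab by (simp add: I_def base_def)
  have "wp w (bound_code b e) Q [] r m"
    unfolding bound_code_def
  proof (rule wp_prepared_While[where I = I and N = N, OF prep])
    fix i tr r m' assume i: "i < N" and I: "I i tr r m'"
    show "eval w r (Reg 19 [<] Reg 23) \<noteq> 0" using I i w_pos by (auto simp: I_def)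
    have I': "base c r" "r 19 = st + i" "st + i < 2 * y" "tables m'"
      using I i stN by (auto simp: I_def)
    show "sp w bound_body (\<lambda>tr. I (Suc i) (tr @ [None])) (tr @ [None]) r m'"
    proof (rule sp_mono[OF sp_bound_body[OF I']])
      fix tr' r' m''
      assume *: "\<exists>ac. tr' = (tr @ [None]) @ ac \<and> length ac = 7 \<and> base c r' \<and> r' 19 = Suc (st + i) \<and> r' 23 = r 23 \<and>
        accesses ac \<le> 2 * active (st + i) \<and> m'' = (if st + i \<le> t then m'(5 * y + (st + i) := bnd (st + i)) else m') \<and>
        confined (if st + i \<le> t then {5 * y + (st + i)} else {}) (range (slot 2)) ac"
      then obtain ac where ac: "tr' = (tr @ [None]) @ ac" "length ac = 7" "base c r'" "r' 19 = Suc (st + i)" "r' 23 = r 23"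
        "accesses ac \<le> 2 * active (st + i)" "m'' = (if st + i \<le> t then m'(5 * y + (st + i) := bnd (st + i)) else m')"
        "confined (if st + i \<le> t then {5 * y + (st + i)} else {}) (range (slot 2)) ac" by blast
      have "confined W R ac"
        by (rule confined_mono[OF ac(8)]) (use i t_le in \<open>auto simp: W_def R_def image_iff\<close>)
      then have cf: "confined W R tr'" using I ac(1) by (simp add: I_def)
      have nt: "5 * y + (st + i) \<noteq> slot K j" if "st + i \<le> t" for K j
      proof -
        have "5 * y + (st + i) < 7 * y" using that t_le y_ge by linarith
        then show ?thesis using slot_low[of "5 * y + (st + i)" K j] by auto
      qed
      have tab': "tables m''" using I nt[symmetric] unfolding ac(7) by (simp add: I_def tables_def input_def)
      have vals: "m'' (5 * y + j) = bnd j" if "st \<le> j" "j < st + Suc i" "j \<le> t" for j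
        using I that unfolding ac(7) by (cases "j = st + i") (auto simp: I_def)
      show "I (Suc i) (tr' @ [None]) r' m''"
        unfolding I_def using I ac(1-6) cf tab' vals by (simp add: I_def)
    qed
  next
    fix tr r m' assume I: "I N tr r m'"
    have "cost B [] tr \<le> 2 * (\<Sum>j=st..<st+N. active j)"
      using I cost_le_accesses[of B "[]" tr] unfolding I_def by linarith
    then show "Q (tr @ [None]) r m'" using I by (auto simp: I_def Q_def)
    show "eval w r (Reg 19 [<] Reg 23) = 0" using I by (simp add: I_def)
  qed
  then show "wp w (bound_code b e) (\<lambda>tr s' m'. length tr = 9 * N + 5 \<and>
      confined (segment (5 * y) o' N c) ({..<y} \<union> range (slot 2)) tr \<and>
      cost B [] tr \<le> 2 * (\<Sum>j=c*s+o'..<c*s+o'+N. active j) \<and>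
      bounded_by o' N c s' m') [] (S c) m"
    unfolding Q_def r_def W_def R_def st_def .
next
  fix c s' m' m''
  assume Q: "bounded_by o' N c s' m'"
    and ag: "\<And>a. a \<in> segment (5 * y) o' N c \<Longrightarrow> m'' a = m' a"
  have "m'' (5 * y + j) = bnd j" if j: "c * s + o' \<le> j" "j < c * s + o' + N" "j \<le> t" for j
  proof -
    have "m'' (5 * y + j) = m' (5 * y + j)" by (rule ag, rule imageI) (use j t_le in auto)
    then show ?thesis using Q j by simp
  qed
  then show "bounded_by o' N c s' m''"
    using Q by blast
next
  fix S m S' m'
  assume pre: "(\<forall>c<p. base c (S c)) \<and> tables m \<and> contents m \<and> (\<forall>j\<in>D. m (5 * y + j) = bnd j)"
    and Q: "\<And>c. c < p \<Longrightarrow> bounded_by o' N c (S' c) m'"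
    and F: "\<And>a. (\<And>c. c < p \<Longrightarrow> a \<notin> segment (5 * y) o' N c) \<Longrightarrow> m' a = m a"
  show "(\<forall>c<p. base c (S' c)) \<and> tables m' \<and> contents m' \<and> (\<forall>j\<in>D. m' (5 * y + j) = bnd j) \<and>
        (\<forall>c<p. \<forall>j. c * s + o' \<le> j \<longrightarrow> j < c * s + o' + N \<longrightarrow> j \<le> t \<longrightarrow> m' (5 * y + j) = bnd j)"
  proof (intro conjI)
    have low: "m' a = m a" if "a < 5 * y" for a
      by (rule F) (use that in auto)
    show "tables m'" by (rule tables_frame[OF F]) (use pre in auto)
    show "contents m'" using pre low by simp
    show "\<forall>j\<in>D. m' (5 * y + j) = bnd j"
    proof
      fix j assume j: "j \<in> D"
      show "m' (5 * y + j) = bnd j"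
      proof (cases "\<exists>c<p. c * s + o' \<le> j \<and> j < c * s + o' + N")
        case True
        then show ?thesis using Q j D by blast
      next
        case False
        then have "m' (5 * y + j) = m (5 * y + j)" by (intro F) auto
        then show ?thesis using pre j by simp
      qed
    qed
  qed (use Q in blast)+
qed (use p B MB in auto)

lemma par_prefix_sums:
  "phase
    counted
    (scan 0 (Reg 16 [+] Reg 14)) (20 * rounds + 15) (8 * p)
    summed"
proof (rule par_cases)
  fix S0 m1
  assume pre: "counted S0 m1"
  have "phase (\<lambda>S m. S = S0 \<and> m = m1) (scan 0 (Reg 16 [+] Reg 14)) (20 * rounds + 15) (8 * p)
     (\<lambda>S m. (\<forall>c<p. S c 14 = PK (lo (Suc c)) - PK (lo 0) \<and> keeps (S c) (S0 c)) \<and>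
        except_slots 0 m m1)"
  \<comment> \<open>Written as differences of prefix values, adjacent sums telescope.\<close>
  proof (rule par_scan[where G = "\<lambda>l u. PK (lo u) - PK (lo l)"])
    fix c assume c: "c < p"
    have P: "base c (S0 c)" "S0 c 10 + PK (lo c) = PK (lo (Suc c))" "S0 c 14 = S0 c 10" "m1 (slot 0 c) = S0 c 10"
      using pre c by blast+
    show "S0 c 0 = c \<and> S0 c 1 = p \<and> S0 c 4 = y" using P(1) by (simp add: base_def)
    show "S0 c 14 = PK (lo (Suc c)) - PK (lo c) \<and> m1 (slot 0 c) = PK (lo (Suc c)) - PK (lo c)"
      using P(2-4) by linarith
  next
    fix l k u :: nat and r :: registers
    assume lku: "l < k" "k < u" and r: "r 16 = PK (lo k) - PK (lo l)" "r 14 = PK (lo u) - PK (lo k)"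
    have "PK (lo l) \<le> PK (lo k)" "PK (lo k) \<le> PK (lo u)" using lku by (auto intro!: PK_mono lo_mono)
    then have "r 16 + r 14 = PK (lo u) - PK (lo l)" using r by linarith
    moreover have "PK (lo u) - PK (lo l) < 2 ^ w" using PK_le[OF lo_le[of u]] w by linarith
    ultimately show "eval w r (Reg 16 [+] Reg 14) = PK (lo u) - PK (lo l)" by simp
  qed simp
  then show "phase (\<lambda>S m. S = S0 \<and> m = m1) (scan 0 (Reg 16 [+] Reg 14)) (20 * rounds + 15) (8 * p)
    summed"
  proof (rule par_weaken)
    fix S m
    assume *: "(\<forall>c<p. S c 14 = PK (lo (Suc c)) - PK (lo 0) \<and> keeps (S c) (S0 c)) \<and>
        except_slots 0 m m1"
    have "PK (lo 0) = 0" by (simp add: lo_0 PK_def rank_def)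
    moreover have "m (slot 1 c) = m1 (slot 1 c)" if "c < p" for c
      using * slot_eq_iff[of c _ 1 0] that p_le by simp
    moreover have "m a = m1 a" if "a < 3 * y" for a
    proof -
      have "a \<noteq> slot 0 c" for c using slot_low[of a 0 c] that by auto
      then show ?thesis using * by blast
    qed
    ultimately show "summed S m"
      using * pre by (simp add: base_def input_def)
  qed simp_all
qed

section \<open>Totals over all cores and assembly of the phases\<close>

lemma sum_segments:
  fixes f :: "nat \<Rightarrow> nat"
  assumes "o' + N \<le> s" "\<And>u. (\<Sum>pos<u. f pos) \<le> b"
  shows "(\<Sum>c<p. \<Sum>pos=c*s+o'..<c*s+o'+N. f pos) \<le> b"
proof -
  have "(\<Sum>c<p. \<Sum>pos=c*s+o'..<c*s+o'+N. f pos) \<le> (\<Sum>c<p. \<Sum>pos=c*s..<c*s+s. f pos)"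
    using assms(1) by (intro sum_mono sum_mono2) auto
  also have "\<dots> = (\<Sum>pos<p * s. f pos)" by (rule sum.nat_group)
  finally show ?thesis using assms(2)[of "p * s"] by linarith
qed

definition h :: nat where "h = s div 2"

text \<open>By \<open>s \<ge> 2 * B + 1\<close> either half has at least \<open>B\<close> words, so
  leaving one half unwritten separates the cores while they write the other.\<close>

lemma h: "h + B \<le> s + 1" "0 + h \<le> s" "s - h + B \<le> s + 1" "h + (s - h) \<le> s" "h \<le> s"
  using s_bounds(3) by (auto simp: h_def)

lemma copy_cost:
  assumes "o' + N \<le> s"
  shows "(\<Sum>c<p. 2 * N div B + 6 * (\<Sum>pos=c*s+o'..<c*s+o'+N. begins pos) + 5) \<le> p * (2 * s div B) + 6 * n + 5 * p"
proof -
  have "2 * N div B \<le> 2 * s div B" using assms by (intro div_le_mono) simp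
  then have "p * (2 * N div B) \<le> p * (2 * s div B)" by (rule mult_le_mono2)
  moreover have "(\<Sum>c<p. 2 * N div B + 6 * (\<Sum>pos=c*s+o'..<c*s+o'+N. begins pos) + 5) =
      p * (2 * N div B) + 6 * (\<Sum>c<p. \<Sum>pos=c*s+o'..<c*s+o'+N. begins pos) + 5 * p"
    by (simp add: sum.distrib sum_distrib_left)
  moreover have "(\<Sum>c<p. \<Sum>pos=c*s+o'..<c*s+o'+N. begins pos) \<le> n"
    using assms by (rule sum_segments) (rule sum_begins)
  ultimately show ?thesis by linarith
qed

lemma bound_cost:
  assumes "o' + N \<le> s"
  shows "(\<Sum>c<p. 2 * (\<Sum>j=c*s+o'..<c*s+o'+N. active j)) \<le> 4 * n"
proof -
  have "(\<Sum>c<p. \<Sum>j=c*s+o'..<c*s+o'+N. active j) \<le> t + 1"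
    using assms by (rule sum_segments) (rule sum_active)
  \<comment> \<open>As \<open>x\<close> and \<open>t\<close> are positive,
    \<open>t + 1 \<le> 2 * n\<close>, and the cost of the boundaries is absorbed by the bucket
    term.\<close>
  moreover have "1 * t \<le> n" using xt_pos by (intro mult_le_mono1) simp
  ultimately show ?thesis using xt_pos unfolding sum_distrib_left[symmetric] by linarith
qed

lemma segment_of: "pos \<le> y \<Longrightarrow> \<exists>c<p. c * s \<le> pos \<and> pos < c * s + s"
proof -
  assume "pos \<le> y"
  then have "pos < p * s" using s_bounds(1) by linarith
  then have "pos div s < p" using s_pos by (simp add: div_less_iff_less_mult)
  moreover have "pos div s * s \<le> pos" "pos < pos div s * s + s"
    using dividend_less_div_times[OF s_pos, of pos] by (simp_all add: add.commute)
  ultimately show ?thesis by blast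
qed

lemma halves_cover:
  assumes first: "\<forall>j\<in>{j. P j \<and> (\<exists>c<p. c * s \<le> j \<and> j < c * s + h)}. Q j"
    and second: "\<forall>c<p. \<forall>j. c * s + h \<le> j \<longrightarrow> j < c * s + h + (s - h) \<longrightarrow> P j \<longrightarrow> Q j"
    and j: "P j" "j \<le> y"
  shows "Q j"
proof -
  obtain c where c: "c < p" "c * s \<le> j" "j < c * s + s" using segment_of[OF j(2)] by auto
  show ?thesis
  proof (cases "j < c * s + h")
    case True
    then show ?thesis using first c j(1) by blast
  next
    case False
    then have "c * s + h \<le> j" "j < c * s + h + (s - h)" using c h(5) by linarith+
    then show ?thesis using second c(1) j(1) by blast
  qed
qed

text \<open>Counting and placing take 12 and 25 steps per bucket, each of the two scans 20 per
  round, copying and boundaries 21 and 9 per output word, where \<open>h + (s - h) = s\<close>. Of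
  the misses per bucket, \<open>2 + 5\<close> arise from counting and placing, \<open>6 + 6\<close>
  from the changes of bucket in the two copying phases and \<open>4 + 4\<close> from the
  boundaries.\<close>

lemma par_gather:
  "phase started
    gather (37 * q + 40 * rounds + 30 * s + 96) (27 * n + 30 * p + 2 * (p * (2 * s div B)))
    (\<lambda>S m. contents m \<and> (\<forall>j\<le>t. m (5 * y + j) = bnd j))"
proof -
  have ov: "c * s + h < 2 ^ w" "c * s < 2 ^ w" "(c + 1) * s < 2 ^ w" "c + 1 < 2 ^ w" "h < 2 ^ w" if "c < p" for c
  proof -
    have "(c + 1) * s \<le> 2 * y" using s_bounds(2)[OF that] by simp
    moreover have "c * s + h \<le> (c + 1) * s" using h(2) by simp
    moreover have "c + 1 \<le> y" using that p_le by linarith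
    ultimately show "c * s + h < 2 ^ w" "c * s < 2 ^ w" "(c + 1) * s < 2 ^ w" "c + 1 < 2 ^ w" "h < 2 ^ w"
      using w yy y_ge by linarith+
  qed
  have half: "eval w r half = h" if "base c r" "c < p" for c r
    using that ov(5)[OF that(2)] by (simp add: half_def base_def h_def)
  have e1: "eval w r (Reg 19 [+] half) = c * s + 0 + h" if "c < p" "base c r" "r 19 = c * s + 0" for c r
    using that half[OF that(2,1)] ov[OF that(1)] by simp
  have e2: "eval w r ((Reg 0 [+] Const 1) [*] Reg 7) = c * s + h + (s - h)" if "c < p" "base c r" for c r
  proof -
    have "eval w r ((Reg 0 [+] Const 1) [*] Reg 7) = (c + 1) * s"
      unfolding eval.simps(2,3) apply_op.simps eval_Const[of 1 r, simplified] using that ov(3,4)[OF that(1)]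
      by (simp add: base_def)
    then show ?thesis using h(5) by simp
  qed
  have b1: "eval w r (Reg 0 [*] Reg 7) = c * s + 0" if "c < p" "base c r" for c r
    using that ov[OF that(1)] by (simp add: base_def)
  have b2: "eval w r ((Reg 0 [*] Reg 7) [+] half) = c * s + h" if "c < p" "base c r" for c r
    using b1[OF that] half[OF that(2,1)] ov[OF that(1)] by simp
  have copy1: "phase
     sought
     (copy_code (Reg 19 [+] half)) (21 * h + 3) (p * (2 * s div B) + 6 * n + 5 * p)
     (\<lambda>S m. aligned h S m \<and>
        (\<forall>pos\<in>{pos. pos < y \<and> (\<exists>c<p. c * s \<le> pos \<and> pos < c * s + h)}. m (3 * y + pos) = val pos))"
    by (rule par_weaken[OF par_copy[OF h(1,2) _ e1, where D = "{}"] _ _ copy_cost[OF h(2)]]) auto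
  have copy2: "phase
     (\<lambda>S m. aligned h S m \<and>
        (\<forall>pos\<in>{pos. pos < y \<and> (\<exists>c<p. c * s \<le> pos \<and> pos < c * s + h)}. m (3 * y + pos) = val pos))
     (copy_code ((Reg 0 [+] Const 1) [*] Reg 7)) (21 * (s - h) + 3) (p * (2 * s div B) + 6 * n + 5 * p)
     (\<lambda>S m. (\<forall>c<p. base c (S c)) \<and> tables m \<and> contents m \<and> (\<forall>j\<in>{}. m (5 * y + j) = bnd j))"
  proof (rule par_weaken[OF par_copy[OF h(3,4) _ e2] _ _ copy_cost[OF h(4)]])
    fix S m
    assume *: "(\<forall>c<p. base c (S c) \<and> S c 19 = c * s + h + (s - h) \<and> (c * s + h + (s - h) < y \<longrightarrow> current (c * s + h + (s - h)) (S c))) \<and> tables m \<and>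
        (\<forall>pos\<in>{pos. pos < y \<and> (\<exists>c<p. c * s \<le> pos \<and> pos < c * s + h)}. m (3 * y + pos) = val pos) \<and>
        (\<forall>c<p. \<forall>pos. c * s + h \<le> pos \<longrightarrow> pos < c * s + h + (s - h) \<longrightarrow> pos < y \<longrightarrow> m (3 * y + pos) = val pos)"
    have "m (3 * y + pos) = val pos" if "pos < y" for pos
    proof (rule halves_cover[where P = "\<lambda>pos. pos < y" and Q = "\<lambda>pos. m (3 * y + pos) = val pos"])
      show "pos \<le> y" using that by simp
    qed (use * that in blast)+
    then show "(\<forall>c<p. base c (S c)) \<and> tables m \<and> contents m \<and> (\<forall>j\<in>{}. m (5 * y + j) = bnd j)"
      using * by blast
  qed auto
  have bound1: "phase
     (\<lambda>S m. (\<forall>c<p. base c (S c)) \<and> tables m \<and> contents m \<and> (\<forall>j\<in>{}. m (5 * y + j) = bnd j))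
     (bound_code (Reg 0 [*] Reg 7) (Reg 19 [+] half)) (9 * h + 5) (4 * n)
     (\<lambda>S m. (\<forall>c<p. base c (S c)) \<and> tables m \<and> contents m \<and>
        (\<forall>j\<in>{j. j \<le> t \<and> (\<exists>c<p. c * s \<le> j \<and> j < c * s + h)}. m (5 * y + j) = bnd j))"
    by (rule par_weaken[OF par_bound[OF h(1,2) _ b1 e1, where D = "{}"] _ _ bound_cost[OF h(2)]]) auto
  have bound2: "phase
     (\<lambda>S m. (\<forall>c<p. base c (S c)) \<and> tables m \<and> contents m \<and>
        (\<forall>j\<in>{j. j \<le> t \<and> (\<exists>c<p. c * s \<le> j \<and> j < c * s + h)}. m (5 * y + j) = bnd j))
     (bound_code ((Reg 0 [*] Reg 7) [+] half) ((Reg 0 [+] Const 1) [*] Reg 7)) (9 * (s - h) + 5) (4 * n)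
     (\<lambda>S m. contents m \<and> (\<forall>j\<le>t. m (5 * y + j) = bnd j))"
  proof (rule par_weaken[OF par_bound[OF h(3,4) _ b2 e2] _ _ bound_cost[OF h(4)]])
    fix S m
    assume *: "(\<forall>c<p. base c (S c)) \<and> tables m \<and> contents m \<and>
        (\<forall>j\<in>{j. j \<le> t \<and> (\<exists>c<p. c * s \<le> j \<and> j < c * s + h)}. m (5 * y + j) = bnd j) \<and>
        (\<forall>c<p. \<forall>j. c * s + h \<le> j \<longrightarrow> j < c * s + h + (s - h) \<longrightarrow> j \<le> t \<longrightarrow> m (5 * y + j) = bnd j)"
    have "m (5 * y + j) = bnd j" if "j \<le> t" for j
    proof (rule halves_cover[where P = "\<lambda>j. j \<le> t" and Q = "\<lambda>j. m (5 * y + j) = bnd j"])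
      show "j \<le> y" using that t_le by simp
    qed (use * that in blast)+
    then show "contents m \<and> (\<forall>j\<le>t. m (5 * y + j) = bnd j)"
      using * by blast
  qed auto
  let ?T = "7 + 1 + (12 * q + 13 + 1 + (20 * rounds + 15 + 1 + (25 * q + 7 + 1 + (20 * rounds + 17 + 1 + (12 + 1 + (21 * h + 3 + 1 +
     (21 * (s - h) + 3 + 1 + (9 * h + 5 + 1 + (9 * (s - h) + 5)))))))))"
  let ?C = "(\<Sum>c<p. 0) + ((\<Sum>c<p. 2 * (lo (Suc c) - lo c) + 2) + (8 * p + ((\<Sum>c<p. 5 * (lo (Suc c) - lo c)) + (9 * p + ((\<Sum>c<p. 1) +
     (p * (2 * s div B) + 6 * n + 5 * p + (p * (2 * s div B) + 6 * n + 5 * p + (4 * n + 4 * n))))))))"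
  have main: "phase started gather ?T ?C
    (\<lambda>S m. contents m \<and> (\<forall>j\<le>t. m (5 * y + j) = bnd j))"
    unfolding gather_def seqs.simps
    by (intro par_Seq[OF par_init] par_Seq[OF par_count] par_Seq[OF par_prefix_sums] par_Seq[OF par_place] par_Seq[OF par_locate]
        par_Seq[OF par_seek] par_Seq[OF copy1] par_Seq[OF copy2] par_Seq[OF bound1] bound2)
  have "?T = 37 * q + 40 * rounds + 30 * s + 96" using h(5) by simp
  moreover have "?C = 27 * n + 30 * p + 2 * (p * (2 * s div B))"
    unfolding sum.distrib sum_distrib_left[symmetric] sum_lo by simp
  ultimately show ?thesis using main by (simp only:)
qed

text \<open>Additive constants in the time are absorbed by \<open>y / p \<ge> 2\<close>, and the
  misses per core by \<open>p \<le> y / (2 * B)\<close>; the factor 200 is large enough for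
  both.\<close>

lemma gather_run:
  "\<exists>k. let cfg = run p M B w gather [p, x, t, y] m0 k in all_halted p cfg \<and>
     (\<forall>pos<y. mem cfg (3 * y + pos) = val pos) \<and> (\<forall>j\<le>t. mem cfg (5 * y + j) = bnd j) \<and>
     real k \<le> 200 * (real y / real p + log 2 (real p)) \<and>
     real (misses cfg) \<le> 200 * (real y / real B + real n)"
proof -
  define T where "T = 37 * q + 40 * rounds + 30 * s + 96"
  define cfg where "cfg = run p M B w gather [p, x, t, y] m0 T"
  have init: "\<forall>c<p. code (initial gather [p, x, t, y] m0) c = foldl Seq gather []"
    "mem (initial gather [p, x, t, y] m0) = m0" "misses (initial gather [p, x, t, y] m0) = 0"
    by (simp_all add: initial_def)
  have regs: "\<forall>c<p. cores p (initial gather [p, x, t, y] m0) c 0 = c \<and> cores p (initial gather [p, x, t, y] m0) c 1 = p \<and>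
     cores p (initial gather [p, x, t, y] m0) c 2 = x \<and> cores p (initial gather [p, x, t, y] m0) c 3 = t \<and>
     cores p (initial gather [p, x, t, y] m0) c 4 = y"
    by (simp add: initial_def cores_def numeral_eq_Suc)
  have res: "(\<forall>c<p. code cfg c = foldl Seq Skip []) \<and>
      ((\<forall>pos<y. mem cfg (3 * y + pos) = val pos) \<and> (\<forall>j\<le>t. mem cfg (5 * y + j) = bnd j)) \<and>
      misses cfg \<le> misses (initial gather [p, x, t, y] m0) + (27 * n + 30 * p + 2 * (p * (2 * s div B)))"
    using par_gather[unfolded par_def Let_def, rule_format, of "initial gather [p, x, t, y] m0" "[]"] init regs
    unfolding cfg_def run_def T_def by blast
  have p0: "0 < real p" "1 \<le> real p" and B0: "0 < real B" using p B by simp_all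
  have Yp: "2 \<le> real y / real p"
  proof -
    have "2 * real p \<le> real y" using p_le by (metis of_nat_le_iff of_nat_mult of_nat_numeral)
    then show ?thesis using p0 by (simp add: le_divide_eq)
  qed
  have L0: "0 \<le> log 2 (real p)" using p0 by simp
  have sr: "real s \<le> real y / real p + 1" using of_nat_div_le_of_nat[of y p, where ?'a = real] by (simp add: s_def)
  have "real n \<le> real y" using n_le by (simp only: of_nat_le_iff)
  then have "real n / real p \<le> real y / real p" using p0 by (intro divide_right_mono) simp_all
  then have qr: "real q \<le> real y / real p + 1" using of_nat_div_le_of_nat[of n p, where ?'a = real] unfolding q_def by simp
  have rr: "real rounds \<le> 1 + log 2 (real p)"
  proof -
    have "real rounds \<le> log 2 (real (2 * p))" using rounds(3) by (rule le_log2_of_power)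
    then show ?thesis using p0 by (simp add: log_mult)
  qed
  have time: "real T \<le> 200 * (real y / real p + log 2 (real p))"
  proof -
    have "real T = 37 * real q + 40 * real rounds + 30 * real s + 96" by (simp add: T_def)
    then show ?thesis using sr qr rr Yp L0 unfolding distrib_left by linarith
  qed
  have pB: "real p \<le> real y / real B / 2"
  proof -
    have "2 * real B * real p \<le> real y" using By by (metis of_nat_le_iff of_nat_mult of_nat_numeral)
    then show ?thesis using B0 by (simp add: field_simps)
  qed
  have ps: "real (p * (2 * s div B)) \<le> 3 * (real y / real B)"
  proof -
    have "p * s \<le> y + p" unfolding s_def by simp
    then have "2 * (p * s) \<le> 3 * y" using p_le by linarith
    then have a: "2 * (real p * real s) \<le> 3 * real y" by (metis of_nat_le_iff of_nat_mult of_nat_numeral)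
    have "real (p * (2 * s div B)) \<le> real p * (real (2 * s) / real B)"
      unfolding of_nat_mult[of p] using p0 by (intro mult_left_mono of_nat_div_le_of_nat) simp
    also have "\<dots> = 2 * (real p * real s) / real B" by simp
    also have "\<dots> \<le> 3 * real y / real B" using a B0 by (intro divide_right_mono) simp_all
    finally show ?thesis by simp
  qed
  have "real (misses cfg) \<le> real (27 * n + 30 * p + 2 * (p * (2 * s div B)))"
    using res init(3) by (simp only: of_nat_le_iff add_0)
  also have "\<dots> = 27 * real n + 30 * real p + 2 * real (p * (2 * s div B))" by simp
  also have "\<dots> \<le> 200 * (real y / real B + real n)"
  proof -
    have "27 * d + 30 * b + 2 * c \<le> 200 * a + 200 * d" if "0 \<le> a" "0 \<le> d" "b \<le> a / 2" "c \<le> 3 * a" for a b c d :: real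
      using that by linarith
    from this[OF _ _ pB ps] show ?thesis unfolding distrib_left by simp
  qed
  finally have miss: "real (misses cfg) \<le> 200 * (real y / real B + real n)" .
  show ?thesis
    by (rule exI[of _ T]) (use res time miss in \<open>simp add: Let_def cfg_def[symmetric] all_halted_def\<close>)
qed

end

section \<open>Lists of buckets in row-major and column-major order\<close>

lemma nth_concat_append:
  "k < length xss \<Longrightarrow> u < length (xss ! k) \<Longrightarrow> concat xss ! (length (concat (take k xss)) + u) = xss ! k ! u"
proof -
  assume k: "k < length xss" and u: "u < length (xss ! k)"
  have "concat xss = concat (take k xss) @ xss ! k @ concat (drop (Suc k) xss)"
    by (metis concat.simps(2) concat_append id_take_nth_drop k)
  then show ?thesis using u by (simp add: nth_append)
qed

lemma length_concat_take_Suc: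
  "k < length xss \<Longrightarrow> length (concat (take (Suc k) xss)) = length (concat (take k xss)) + length (xss ! k)"
  by (simp add: take_Suc_conv_app_nth)

lemma length_concat_take_le: "length (concat (take k xss)) \<le> length (concat xss)"
  by (metis append_take_drop_id concat_append le_add1 length_append)

lemma nth_concat_uniform:
  "\<lbrakk>\<forall>L\<in>set Ls. length L = t; i < length Ls; j < t\<rbrakk> \<Longrightarrow> concat Ls ! (i * t + j) = Ls ! i ! j"
proof (induction Ls arbitrary: i)
  case (Cons L Ls)
  then show ?case by (cases i) (auto simp: nth_append)
qed simp

lemma length_concat_uniform: "\<forall>L\<in>set Ls. length L = t \<Longrightarrow> length (concat Ls) = length Ls * t"
  by (induction Ls) auto

lemma nth_boundaries: "k \<le> length bs \<Longrightarrow> boundaries bs ! k = length (concat (take k bs))"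
  unfolding boundaries_def by (simp del: upt_Suc)

lemma length_boundaries: "length (boundaries bs) = Suc (length bs)"
  by (simp add: boundaries_def)

definition bucket :: "nat list list list \<Rightarrow> nat \<Rightarrow> nat list" where
  "bucket Ls k = Ls ! (k mod length Ls) ! (k div length Ls)"

text \<open>In the column-major numbering a column is a run of \<open>length Ls\<close> consecutive
  numbers, so gathering the columns merely enumerates all buckets in that order.\<close>

lemma concat_gathered_buckets:
  assumes "\<forall>L\<in>set Ls. length L = t" "j \<le> t" "Ls \<noteq> []"
  shows "concat (take j (gathered_buckets t Ls)) = concat (map (bucket Ls) [0..<j * length Ls])"
  using assms(2)
proof (induction j)
  case (Suc j)
  have row: "map (bucket Ls) [j * length Ls..<Suc j * length Ls] = map (\<lambda>L. L ! j) Ls"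
  proof (rule nth_equalityI)
    fix i assume "i < length (map (bucket Ls) [j * length Ls..<Suc j * length Ls])"
    then show "map (bucket Ls) [j * length Ls..<Suc j * length Ls] ! i = map (\<lambda>L. L ! j) Ls ! i"
      using assms(3) by (simp add: bucket_def)
  qed simp
  have "[0..<Suc j * length Ls] = [0..<j * length Ls] @ [j * length Ls..<Suc j * length Ls]"
    using upt_add_eq_append[of 0 "j * length Ls" "length Ls"] by (simp add: add.commute)
  moreover have "take (Suc j) (gathered_buckets t Ls) = take j (gathered_buckets t Ls) @ [concat (map (\<lambda>L. L ! j) Ls)]"
    using Suc.prems by (simp add: gathered_buckets_def take_Suc_conv_app_nth)
  ultimately show ?case using Suc row by simp
qed simp

theorem theorem2:
  shows "\<exists>(prog :: com) (k :: nat) (C :: real).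
    \<forall>(p :: nat) (M :: nat) (B :: nat) (w :: nat) (x :: nat) (t :: nat) (y :: nat)
      (Ls :: nat list list list) (m :: memory).
      1 \<le> p \<and> 1 \<le> B \<and> 2 * B \<le> M \<and> y ^ k \<le> 2 ^ w
      \<and> length Ls = x \<and> (\<forall>L \<in> set Ls. length L = t)
      \<and> (\<Sum>L\<leftarrow>Ls. length (concat L)) = y
      \<and> M * p \<le> y \<and> x * t \<le> y
      \<and> (\<forall>a. m a < 2 ^ w)
      \<and> stored_buckets m 0 y (concat Ls)
      \<longrightarrow> (\<exists>n. let \<sigma> = run p M B w prog [p, x, t, y] m n in
        all_halted p \<sigma>
        \<and> stored_buckets (mem \<sigma>) (3 * y) (5 * y) (gathered_buckets t Ls)
        \<and> real n \<le> C * (real y / real p + log 2 (real p))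
        \<and> real (misses \<sigma>) \<le> C * (real y / real B + real (x * t)))"
proof (rule exI[of _ gather], rule exI[of _ 12], rule exI[of _ 200], intro allI impI, elim conjE)
  fix p M B w x t y :: nat and Ls :: "nat list list list" and m :: memory
  assume p: "1 \<le> p" and B: "1 \<le> B" "2 * B \<le> M" and yw: "y ^ 12 \<le> 2 ^ w" and Lx: "length Ls = x"
    and Lt: "\<forall>L \<in> set Ls. length L = t" and Ly: "(\<Sum>L\<leftarrow>Ls. length (concat L)) = y"
    and yM: "M * p \<le> y" and xt: "x * t \<le> y" and st: "stored_buckets m 0 y (concat Ls)"
  have y2: "2 \<le> y" using p B yM mult_le_mono[of 2 M 1 p] by linarith
  \<comment> \<open>The origin of the exponent 12: \<open>y \<ge> 2\<close> yields
    \<open>y ^ 12 \<ge> 2 ^ 10 * (y * y)\<close>, and 1024 exceeds 1000.\<close>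
  have w: "1000 * (y * y) < 2 ^ w"
  proof -
    have "(2::nat) ^ 10 * (y * y) \<le> y ^ 10 * (y * y)" using y2 by (intro mult_le_mono1 power_mono) auto
    also have "\<dots> = y ^ 12" by (simp add: power_numeral_reduce)
    finally have "1024 * (y * y) \<le> 2 ^ w" using yw by simp
    moreover have "0 < y * y" using y2 by simp
    ultimately show ?thesis by linarith
  qed
  have Ls0: "Ls \<noteq> []" using Ly y2 by auto
  have x0: "0 < x" using Ls0 Lx by auto
  define bs where "bs = concat Ls"
  have lbs: "length bs = x * t" unfolding bs_def using length_concat_uniform[OF Lt] Lx by simp
  have lcb: "length (concat bs) = y" unfolding bs_def Ly[symmetric] by (induction Ls) auto
  define ix where "ix k = k mod x * t + k div x" for k
  have ix: "ix k < length bs" "bs ! ix k = bucket Ls k" if "k < x * t" for k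
  proof -
    have 1: "k mod x < x" "k div x < t" using that x0 by (simp_all add: less_mult_imp_div_less mult.commute)
    have "Suc (k mod x) * t \<le> x * t" using 1(1) by (intro mult_le_mono1) simp
    then show "ix k < length bs" unfolding ix_def lbs using 1(2) by simp
    show "bs ! ix k = bucket Ls k"
      unfolding bs_def ix_def bucket_def using nth_concat_uniform[OF Lt _ 1(2), of "k mod x"] 1(1) Lx by simp
  qed
  \<comment> \<open>\<open>ix\<close> takes the column-major number of a bucket to its row-major
    index. Prefix lengths are start addresses because the data begin at address 0.\<close>
  define src where "src k = length (concat (take (ix k) bs))" for k
  define len where "len k = length (bucket Ls k)" for k
  have src_len: "length (concat (take (Suc (ix k)) bs)) = src k + len k" if "k < x * t" for k
    unfolding src_def len_def using length_concat_take_Suc[OF ix(1)[OF that]] ix(2)[OF that] by simp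
  have bd: "m (y + k) = length (concat (take k bs))" if "k \<le> length bs" for k
    using st that nth_boundaries[OF that]
    unfolding stored_buckets_def array_at_def bs_def[symmetric] length_boundaries by (metis le_imp_less_Suc)
  have lists: "length (concat (map (bucket Ls) [0..<k])) = (\<Sum>i<k. len i)" for k
    by (induction k) (simp_all add: len_def)
  have gb: "length (gathered_buckets t Ls) = t" by (simp add: gathered_buckets_def)
  have gat: "concat (gathered_buckets t Ls) = concat (map (bucket Ls) [0..<x * t])"
    using concat_gathered_buckets[OF Lt order_refl Ls0] gb Lx by (simp add: mult.commute)
  have total: "length (concat (gathered_buckets t Ls)) = y"
  proof -
    have "length (concat (gathered_buckets t Ls)) = (\<Sum>j<t. \<Sum>i<x. length (Ls ! i ! j))"
      unfolding gathered_buckets_def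
      by (simp add: length_concat comp_def sum_list_sum_nth Lx atLeast0LessThan)
    \<comment> \<open>Exchanging the sums passes from columns back to lists, whose total length is
      known.\<close>
    also have "\<dots> = (\<Sum>i<x. \<Sum>j<t. length (Ls ! i ! j))" by (rule sum.swap)
    also have "\<dots> = (\<Sum>i<x. length (concat (Ls ! i)))"
      using Lt Lx by (intro sum.cong) (simp_all add: length_concat sum_list_sum_nth atLeast0LessThan)
    also have "\<dots> = y" using Ly Lx by (simp add: sum_list_sum_nth atLeast0LessThan)
    finally show ?thesis .
  qed
  interpret gathering p M B w y x t src len m
  proof unfold_locales
    show "m (y + (k mod x * t + k div x)) = src k \<and> m (Suc (y + (k mod x * t + k div x))) = src k + len k"
      if k: "k < x * t" for k
    proof -
      have "m (y + ix k) = src k" using bd[of "ix k"] ix(1)[OF k] by (simp add: src_def)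
      moreover have "m (y + Suc (ix k)) = src k + len k" using bd[of "Suc (ix k)"] ix(1)[OF k] src_len[OF k] by simp
      ultimately show ?thesis by (simp add: ix_def)
    qed
    show "src k + len k \<le> y" if k: "k < x * t" for k
      using src_len[OF k] length_concat_take_le[of "Suc (ix k)" bs] lcb by simp
    show "(\<Sum>k<x * t. len k) = y" using total lists[of "x * t"] gat by simp
  qed (use p B yM w xt in auto)
  have vals: "val pos = concat (gathered_buckets t Ls) ! pos" if pos: "pos < y" for pos
  proof -
    obtain k where k: "k < x * t" "off k \<le> pos" "pos < off k + len k" using exists_bucket[OF pos] by blast
    define u where "u = pos - off k"
    have u: "u < len k" "pos = off k + u" using k by (simp_all add: u_def)
    have "val pos = m (src k + u)" using val_eq[OF k(2,3)] by (simp add: u_def)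
    also have "\<dots> = concat bs ! (src k + u)"
    proof -
      have "src k + u < length (concat bs)" using src_le[OF k(1)] u lcb by simp
      then show ?thesis using st unfolding stored_buckets_def array_at_def bs_def[symmetric] by simp
    qed
    also have "\<dots> = bucket Ls k ! u"
      using nth_concat_append[OF ix(1)[OF k(1)], of u] ix(2)[OF k(1)] u by (simp add: src_def len_def)
    also have "\<dots> = concat (map (bucket Ls) [0..<x * t]) ! (length (concat (take k (map (bucket Ls) [0..<x * t]))) + u)"
      using nth_concat_append[of k "map (bucket Ls) [0..<x * t]" u] k(1) u by (simp add: len_def)
    also have "length (concat (take k (map (bucket Ls) [0..<x * t]))) = off k"
      using k(1) lists[of k] by (simp add: take_map off_def)
    finally show ?thesis using gat u by simp
  qed
  have bnds: "bnd j = boundaries (gathered_buckets t Ls) ! j" if j: "j \<le> t" for j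
  proof -
    have "off (j * x) = length (concat (take j (gathered_buckets t Ls)))"
      using concat_gathered_buckets[OF Lt j Ls0] lists[of "j * x"] Lx by (simp add: off_def)
    moreover have "bnd j = off (j * x)"
    proof (cases "j < t")
      case False
      then have "j = t" using j by simp
      then show ?thesis using off_n by (simp add: bnd_def mult.commute)
    qed (simp add: bnd_def)
    ultimately show ?thesis using j nth_boundaries[of j "gathered_buckets t Ls"] gb by simp
  qed
  obtain k where k: "let cfg = run p M B w gather [p, x, t, y] m k in all_halted p cfg \<and>
     (\<forall>pos<y. mem cfg (3 * y + pos) = val pos) \<and> (\<forall>j\<le>t. mem cfg (5 * y + j) = bnd j) \<and>
     real k \<le> 200 * (real y / real p + log 2 (real p)) \<and>
     real (misses cfg) \<le> 200 * (real y / real B + real (x * t))" using gather_run by blast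
  show "\<exists>n. let cfg = run p M B w gather [p, x, t, y] m n in
        all_halted p cfg
        \<and> stored_buckets (mem cfg) (3 * y) (5 * y) (gathered_buckets t Ls)
        \<and> real n \<le> 200 * (real y / real p + log 2 (real p))
        \<and> real (misses cfg) \<le> 200 * (real y / real B + real (x * t))"
    using k vals bnds total gb unfolding stored_buckets_def array_at_def Let_def length_boundaries
    by (intro exI[of _ k]) (auto simp: less_Suc_eq_le)
qed

end
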